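(* Let $\mathcal Z$ be finite with every subset measurable, let $\Gamma_\theta$, $L_\theta$, $\overline{\mathcal M}_\theta$ ($\theta\in\Theta$) be as in the context, with $\Gamma_\theta$ nonempty, and let $Z_1,\dots,Z_n$ be i.i.d. from $\mu^*\in\mathbf P$, where $\mathbf P$ is a collection of probability measures on $\mathcal Z$. (i) For any sequence of positive numbers $(\lambda_n)$, $$\sqrt n\,T_n(\theta)\ \le\ \sup_{\phi\in\Phi}\bigl(\mathbb G_{n,\mu^*}(\phi)+\lambda_n\eta_{\theta,n}(\phi)\bigr)-\lambda_nT_n(\theta)$$ for all $n$, all $\mu^*\in\mathbf P$ and all $\theta\in\Theta_I(\mu^* )$. (ii) If, in addition, $\lambda_n\to\infty$ and $\lambda_n=o(\sqrt n)$, then for each fixed $\mu^*\in\mathbf P$ and each fixed $\theta\in\Theta$ with $\Gamma_\theta\ne\varnothing$, the contact set $K_{\mu^*}(\theta)$ is nonempty and, as $n\to\infty$, $$\sqrt n\,(T_n(\theta)-T_{\mu^*}(\theta))\ \Rightarrow\ \sup_{\phi\in K_{\mu^*}(\theta)}\mathbb G_{\mu^*}(\phi),$$ and the bootstrap analog satisfies $$\sup_{\phi\in\Phi}\bigl(\mathbb G^*_{n,\mu^*}(\phi)+\lambda_n\eta_{\theta,n}(\phi)\bigr)-\lambda_nT_n(\theta)\ \overset{\mu^*}{\Rightarrow}\ \sup_{\phi\in K_{\mu^*}(\theta)}\mathbb G_{\mu^*}(\phi).$$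
   Context: Model. $\mathcal Y,\mathcal X,\mathcal U$ are measurable spaces, $\mathcal W=\mathcal X\times\mathcal U$, $\mathcal Z=\mathcal Y\times\mathcal X$. For each $\theta\in\Theta$, $\Gamma_\theta$ is the set of probability measures $\gamma$ on $\mathcal W$ with $\mathbb E_\gamma[g_{1,j}(W;\theta)]=0$ for all $j\in\mathcal J$ and $\mathbb E_\gamma[g_{2,k}(W;\theta)]\le 0$ for all $k\in\mathcal K$, for arbitrary index sets $\mathcal J,\mathcal K$ and real measurable functions $g_{1,j},g_{2,k}$ on $\mathcal W$ (assumed $\gamma$-integrable for $\gamma\in\Gamma_\theta$). $K_\theta$ is a probability kernel from $\mathcal W$ to $\mathcal Z$ whose $\mathcal X$-marginal at $(x,u)$ is $\delta_x$, and $(L_\theta\gamma)(B)=\int K_\theta(B\mid w)\,d\gamma(w)$. $\overline{\mathcal M}_\theta$ is the closure of $\{L_\theta\gamma:\gamma\in\Gamma_\theta\}$ in total variation within the probability measures on $\mathcal Z$. The identified set is $\Theta_I(\mu^* )=\{\theta\in\Theta:\mu^*\in\overline{\mathcal M}_\theta\}$. Notation. $\Phi=[0,1]^{\mathcal Z}$; $\mathbb E_n[\phi]=n^{-1}\sum_{i=1}^n\phi(Z_i)$; $$\eta_{\theta,\mu^*}(\phi)=\inf_{\mu\in\overline{\mathcal M}_\theta}(\mathbb E_{\mu^*}[\phi]-\mathbb E_\mu[\phi]),\qquad \eta_{\theta,n}(\phi)=\inf_{\mu\in\overline{\mathcal M}_\theta}(\mathbb E_n[\phi]-\mathbb E_\mu[\phi]),$$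 $T_{\mu^*}(\theta)=\sup_{\phi\in\Phi}\eta_{\theta,\mu^*}(\phi)$, $T_n(\theta)=\sup_{\phi\in\Phi}\eta_{\theta,n}(\phi)$. The contact set is $K_{\mu^*}(\theta)=\{\phi\in\Phi:\eta_{\theta,\mu^*}(\phi)=T_{\mu^*}(\theta)\}$. Processes. $\mathbb G_{n,\mu^*}(\phi)=\sqrt n(\mathbb E_n[\phi]-\mathbb E_{\mu^*}[\phi])$. $\mathbb G_{\mu^*}$ is its Gaussian limit: the mean-zero Gaussian process on $\Phi$ given by $\mathbb G_{\mu^*}(\phi)=\sum_{z}\phi(z)\xi_z$ with $(\xi_z)_{z\in\mathcal Z}\sim N(0,\mathrm{diag}(p)-pp')$, $p=(\mu^*(\{z\}))_{z\in\mathcal Z}$. Given the data, $Z_1^*,\dots,Z_n^*$ are drawn with replacement (i.i.d. uniformly) from $\{Z_1,\dots,Z_n\}$, and $\mathbb G^*_{n,\mu^*}(\phi)=\sqrt n\bigl(n^{-1}\sum_{i=1}^n\phi(Z_i^* )-\mathbb E_n[\phi]\bigr)$. Convergence. $d_{\mathrm{BL}}$ is the bounded Lipschitz metric between probability distributions. $\Rightarrow$ means that $d_{\mathrm{BL}}$ between the laws tends to $0$. For a bootstrap quantity, $\overset{\mu^*}{\Rightarrow}$ means that $d_{\mathrm{BL}}$ between its conditional law given the data $Z_1,\dots,Z_n$ and the law of the limit converges to $0$ in probability under $\mu^*$. *)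

theory Defs
  imports "HOL-Probability.Probability" "HOL-Library.Landau_Symbols"
begin

text \<open>Only the \<open>space\<close> and \<open>sets\<close> of \<open>y_space\<close>, \<open>x_space\<close>, \<open>u_space\<close> are used; they stand for the
  measurable spaces of outcomes, covariates and latent variables.\<close>

record ('y, 'x, 'u, 'j, 'k, 't) moment_model =
  y_space :: "'y measure"
  x_space :: "'x measure"
  u_space :: "'u measure"
  params :: "'t set"
  eq_index :: "'j set"
  ineq_index :: "'k set"
  eq_moment :: "'j \<Rightarrow> 'x \<times> 'u \<Rightarrow> 't \<Rightarrow> real"
  ineq_moment :: "'k \<Rightarrow> 'x \<times> 'u \<Rightarrow> 't \<Rightarrow> real"
  kernel :: "'t \<Rightarrow> 'x \<times> 'u \<Rightarrow> ('y \<times> 'x) measure"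

definition w_space :: "('y, 'x, 'u, 'j, 'k, 't) moment_model \<Rightarrow> ('x \<times> 'u) measure" where
  "w_space m = x_space m \<Otimes>\<^sub>M u_space m"

definition z_space :: "('y, 'x, 'u, 'j, 'k, 't) moment_model \<Rightarrow> ('y \<times> 'x) measure" where
  "z_space m = y_space m \<Otimes>\<^sub>M x_space m"

definition well_formed_model :: "('y, 'x, 'u, 'j, 'k, 't) moment_model \<Rightarrow> bool" where
  "well_formed_model m \<longleftrightarrow>
     (\<forall>\<theta>\<in>params m.
        (\<forall>j\<in>eq_index m. (\<lambda>w. eq_moment m j w \<theta>) \<in> borel_measurable (w_space m)) \<and>
        (\<forall>k\<in>ineq_index m. (\<lambda>w. ineq_moment m k w \<theta>) \<in> borel_measurable (w_space m)) \<and>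
        kernel m \<theta> \<in> w_space m \<rightarrow>\<^sub>M prob_algebra (z_space m) \<and>
        (\<forall>w\<in>space (w_space m).
           distr (kernel m \<theta> w) (x_space m) snd = return (x_space m) (fst w)))"

text \<open>Integrability is part of membership: the Bochner integral of a non-integrable function is
  \<open>0\<close> by convention, so the moment conditions alone would admit measures for which the
  expectations do not exist.\<close>

definition latent_laws ::
    "('y, 'x, 'u, 'j, 'k, 't) moment_model \<Rightarrow> 't \<Rightarrow> ('x \<times> 'u) measure set" where
  "latent_laws m \<theta> =
     {\<gamma> \<in> space (prob_algebra (w_space m)).
        (\<forall>j\<in>eq_index m. integrable \<gamma> (\<lambda>w. eq_moment m j w \<theta>) \<and>
                        (\<integral>w. eq_moment m j w \<theta> \<partial>\<gamma>) = 0) \<and>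
        (\<forall>k\<in>ineq_index m. integrable \<gamma> (\<lambda>w. ineq_moment m k w \<theta>) \<and>
                          (\<integral>w. ineq_moment m k w \<theta> \<partial>\<gamma>) \<le> 0)}"

definition predicted_laws ::
    "('y, 'x, 'u, 'j, 'k, 't) moment_model \<Rightarrow> 't \<Rightarrow> ('y \<times> 'x) measure set" where
  "predicted_laws m \<theta> = (\<lambda>\<gamma>. \<gamma> \<bind> kernel m \<theta>) ` latent_laws m \<theta>"

definition tv_dist :: "'a measure \<Rightarrow> 'a measure \<Rightarrow> real" where
  "tv_dist \<mu> \<nu> = (SUP A\<in>sets \<mu>. \<bar>measure \<mu> A - measure \<nu> A\<bar>)"

definition tv_closure :: "'a measure \<Rightarrow> 'a measure set \<Rightarrow> 'a measure set" where
  "tv_closure Z S =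
     {\<mu> \<in> space (prob_algebra Z). \<forall>\<epsilon>>0. \<exists>\<nu>\<in>S. tv_dist \<mu> \<nu> < \<epsilon>}"

definition closed_laws ::
    "('y, 'x, 'u, 'j, 'k, 't) moment_model \<Rightarrow> 't \<Rightarrow> ('y \<times> 'x) measure set" where
  "closed_laws m \<theta> = tv_closure (z_space m) (predicted_laws m \<theta>)"

definition identified_set ::
    "('y, 'x, 'u, 'j, 'k, 't) moment_model \<Rightarrow> ('y \<times> 'x) measure \<Rightarrow> 't set" where
  "identified_set m \<mu> = {\<theta> \<in> params m. \<mu> \<in> closed_laws m \<theta>}"


definition test_functions ::
    "('y, 'x, 'u, 'j, 'k, 't) moment_model \<Rightarrow> ('y \<times> 'x \<Rightarrow> real) set" where
  "test_functions m = space (z_space m) \<rightarrow>\<^sub>E {0..1}"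

definition emp_mean :: "nat \<Rightarrow> (nat \<Rightarrow> 'z) \<Rightarrow> ('z \<Rightarrow> real) \<Rightarrow> real" where
  "emp_mean n d \<phi> = (\<Sum>i<n. \<phi> (d i)) / real n"

text \<open>The argument \<open>E\<close> is an expectation functional: \<open>integral\<^sup>L \<mu>\<close> gives the population
  versions and \<open>emp_mean n d\<close> the sample versions of the criterion and of the statistic.\<close>

definition eta ::
    "('y, 'x, 'u, 'j, 'k, 't) moment_model \<Rightarrow> 't \<Rightarrow> (('y \<times> 'x \<Rightarrow> real) \<Rightarrow> real)
     \<Rightarrow> ('y \<times> 'x \<Rightarrow> real) \<Rightarrow> real" where
  "eta m \<theta> E \<phi> = (INF \<nu>\<in>closed_laws m \<theta>. E \<phi> - integral\<^sup>L \<nu> \<phi>)"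

definition T_stat ::
    "('y, 'x, 'u, 'j, 'k, 't) moment_model \<Rightarrow> 't \<Rightarrow> (('y \<times> 'x \<Rightarrow> real) \<Rightarrow> real) \<Rightarrow> real" where
  "T_stat m \<theta> E = (SUP \<phi>\<in>test_functions m. eta m \<theta> E \<phi>)"

definition contact_set ::
    "('y, 'x, 'u, 'j, 'k, 't) moment_model \<Rightarrow> 't \<Rightarrow> ('y \<times> 'x) measure
     \<Rightarrow> ('y \<times> 'x \<Rightarrow> real) set" where
  "contact_set m \<theta> \<mu> =
     {\<phi> \<in> test_functions m. eta m \<theta> (integral\<^sup>L \<mu>) \<phi> = T_stat m \<theta> (integral\<^sup>L \<mu>)}"


definition iid_sample ::
    "'o measure \<Rightarrow> (nat \<Rightarrow> 'o \<Rightarrow> 'z) \<Rightarrow> 'z measure \<Rightarrow> bool" where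
  "iid_sample M Zs \<mu> \<longleftrightarrow>
     prob_space M \<and> prob_space.indep_vars M (\<lambda>_. \<mu>) Zs UNIV \<and> (\<forall>i. distr M \<mu> (Zs i) = \<mu>)"

definition emp_process ::
    "nat \<Rightarrow> (nat \<Rightarrow> 'z) \<Rightarrow> 'z measure \<Rightarrow> ('z \<Rightarrow> real) \<Rightarrow> real" where
  "emp_process n d \<mu> \<phi> = sqrt (real n) * (emp_mean n d \<phi> - integral\<^sup>L \<mu> \<phi>)"

text \<open>The univariate normal law with mean \<open>a\<close> and variance \<open>v \<ge> 0\<close>, including the degenerate
  case, which \<open>normal_density\<close> does not cover.\<close>

definition normal_law :: "real \<Rightarrow> real \<Rightarrow> real measure" where
  "normal_law a v =
     (if v = 0 then return borel a else density lborel (\<lambda>x. ennreal (normal_density a (sqrt v) x)))"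

text \<open>A random vector is \<open>N(0, C)\<close> iff all its linear combinations are normal with the induced
  variance; \<open>C\<close> may be singular.\<close>

definition centered_gaussian ::
    "'b measure \<Rightarrow> 'i set \<Rightarrow> ('i \<Rightarrow> 'b \<Rightarrow> real) \<Rightarrow> ('i \<Rightarrow> 'i \<Rightarrow> real) \<Rightarrow> bool" where
  "centered_gaussian N I \<xi> C \<longleftrightarrow>
     prob_space N \<and> (\<forall>i\<in>I. \<xi> i \<in> borel_measurable N) \<and>
     (\<forall>a. distr N borel (\<lambda>\<omega>. \<Sum>i\<in>I. a i * \<xi> i \<omega>) =
          normal_law 0 (\<Sum>i\<in>I. \<Sum>j\<in>I. a i * C i j * a j))"

definition multinomial_cov :: "'z measure \<Rightarrow> 'z \<Rightarrow> 'z \<Rightarrow> real" where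
  "multinomial_cov \<mu> z z' =
     (if z = z' then measure \<mu> {z} else 0) - measure \<mu> {z} * measure \<mu> {z'}"

definition gaussian_process ::
    "'z set \<Rightarrow> ('z \<Rightarrow> 'b \<Rightarrow> real) \<Rightarrow> ('z \<Rightarrow> real) \<Rightarrow> 'b \<Rightarrow> real" where
  "gaussian_process S \<xi> \<phi> \<omega> = (\<Sum>z\<in>S. \<phi> z * \<xi> z \<omega>)"

definition boot_process ::
    "nat \<Rightarrow> (nat \<Rightarrow> 'z) \<Rightarrow> (nat \<Rightarrow> 'z) \<Rightarrow> ('z \<Rightarrow> real) \<Rightarrow> real" where
  "boot_process n d zs \<phi> = sqrt (real n) * (emp_mean n zs \<phi> - emp_mean n d \<phi>)"

text \<open>The conditional law, given the data \<open>d\<close>, of a statistic \<open>S\<close> of a bootstrap sample: \<open>n\<close>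
  independent draws, each the value of \<open>d\<close> at a uniformly chosen index, so that repeated data
  points are counted with multiplicity.\<close>

definition boot_law ::
    "nat \<Rightarrow> (nat \<Rightarrow> 'z) \<Rightarrow> ((nat \<Rightarrow> 'z) \<Rightarrow> real) \<Rightarrow> real measure" where
  "boot_law n d S =
     distr (measure_pmf (Pi_pmf {..<n} undefined (\<lambda>_. map_pmf d (pmf_of_set {..<n})))) borel S"


definition d_BL :: "real measure \<Rightarrow> real measure \<Rightarrow> real" where
  "d_BL \<mu> \<nu> =
     (SUP f\<in>{f :: real \<Rightarrow> real. (\<forall>x. \<bar>f x\<bar> \<le> 1) \<and> 1-lipschitz_on UNIV f}.
        \<bar>integral\<^sup>L \<mu> f - integral\<^sup>L \<nu> f\<bar>)"

text \<open>Measurability is required explicitly, since \<open>distr\<close> of a non-measurable function is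
  not the law of anything.\<close>

definition converges_in_law ::
    "'o measure \<Rightarrow> (nat \<Rightarrow> 'o \<Rightarrow> real) \<Rightarrow> 'b measure \<Rightarrow> ('b \<Rightarrow> real) \<Rightarrow> bool" where
  "converges_in_law M X N Y \<longleftrightarrow>
     (\<forall>n. X n \<in> borel_measurable M) \<and> Y \<in> borel_measurable N \<and>
     (\<lambda>n. d_BL (distr M borel (X n)) (distr N borel Y)) \<longlonglongrightarrow> 0"

definition converges_in_prob :: "'o measure \<Rightarrow> (nat \<Rightarrow> 'o \<Rightarrow> real) \<Rightarrow> real \<Rightarrow> bool" where
  "converges_in_prob M X c \<longleftrightarrow>
     (\<forall>n. X n \<in> borel_measurable M) \<and>
     (\<forall>\<epsilon>>0. (\<lambda>n. measure M {\<omega> \<in> space M. \<bar>X n \<omega> - c\<bar> > \<epsilon>}) \<longlonglongrightarrow> 0)"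

text \<open>\<open>L n \<omega>\<close> is the conditional law of the bootstrap quantity given the data at \<open>\<omega>\<close>.\<close>

definition converges_in_cond_law ::
    "'o measure \<Rightarrow> (nat \<Rightarrow> 'o \<Rightarrow> real measure) \<Rightarrow> 'b measure \<Rightarrow> ('b \<Rightarrow> real) \<Rightarrow> bool" where
  "converges_in_cond_law M L N Y \<longleftrightarrow>
     Y \<in> borel_measurable N \<and>
     converges_in_prob M (\<lambda>n \<omega>. d_BL (L n \<omega>) (distr N borel Y)) 0"

end

theory Submission
  imports Defs
begin

text \<open>On a finite outcome space everything is a functional of the vector of scaled frequency deviations
  $V$. Since $\eta_{\theta,n}(\phi) = \eta_{\theta,\mu}(\phi) + (\mathbb{E}_n - \mathbb{E}_\mu)\phi$, the
  statistic equals $D_{\sqrt n}(V)$ with $D_\lambda(v) = \sup_\phi (\langle v, \phi\rangle +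
  \lambda(\eta_{\theta,\mu}(\phi) - T_\mu(\theta)))$, and the bootstrap quantity differs from
  $D_{\lambda_n}(V^*)$ by at most $2\lambda_n$ times the deviation of the frequencies of the data, which
  is $o_p(1)$. As $\lambda \to \infty$, $D_\lambda(v)$ decreases to the supremum over the contact set, with
  an error of at most $\epsilon(1 + \|v\|_1^2)$, so bounded second moments suffice.

  The multivariate central limit theorem is obtained without a uniqueness theorem for characteristic
  functions: a Lipschitz function of $v$ is replaced by the same function of $L \sin(v/L)$ at a cost of
  $O(1/L)$ in mean, and that one is a uniform limit of trigonometric polynomials by Stone--Weierstrass.
  The characteristic functions are controlled uniformly in the law of the draws, which covers the sample
  and the bootstrap at once.\<close>

text \<open>Three obstacles shape the argument. The distance \<open>d_BL\<close> is a supremum over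
  a whole class of Lipschitz functions, while trigonometric approximation handles one function at a
  time; a fixed finite partition of unity by tents approximates the whole class at once. The
  functional \<open>penalized\<close> changes with the index, so the limit theorem is run on the
  fixed functional \<open>contact_sup\<close>, and the difference is absorbed in mean. Bootstrap
  laws are indexed by the data and converge only in probability, so limits are taken along an
  arbitrary filter, with a law of the draws that may vary with the index.

  The model enters only through one fact: the criterion is Lipschitz in \<phi> on the compact cube
  of test functions. Statistics of the data, including distances between conditional laws, are
  measurable because they depend on finitely many observations with finitely many values.\<close>

section \<open>Compact cubes, second moments of independent sums, and a bound for the sine\<close>

lemma compact_PiE_real:
  fixes A :: "'i \<Rightarrow> real set"
  assumes "\<And>i. i \<in> I \<Longrightarrow> compact (A i)"
  shows "compact (PiE I A)"
proof -
  \<comment> \<open>An extensional function is a point of the full product whose factors outside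
    \<open>I\<close> are the singleton of \<open>undefined\<close>. Singletons are compact, so
    Tychonoff applies.\<close>
  have "PiE I A = (\<Pi>\<^sub>E i\<in>UNIV. if i \<in> I then A i else {undefined})"
    by (auto simp: PiE_def Pi_def extensional_def split: if_splits)
  moreover have "compactin (product_topology (\<lambda>_. euclidean) UNIV) \<dots>"
    using assms by (subst compactin_PiE) (auto simp: compactin_euclidean_iff)
  ultimately show ?thesis
    by (metis compactin_euclidean_iff euclidean_product_topology)
qed

lemma indep_vars_pair:
  fixes Y :: "nat \<Rightarrow> 'a \<Rightarrow> real"
  assumes "prob_space P" "prob_space.indep_vars P (\<lambda>_. borel) Y {i,j}" "i \<noteq> j"
    and int: "integrable P (Y i)" "integrable P (Y j)"
  shows "integrable P (\<lambda>\<omega>. Y i \<omega> * Y j \<omega>)"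
    and "(\<integral>\<omega>. Y i \<omega> * Y j \<omega> \<partial>P) = (\<integral>\<omega>. Y i \<omega> \<partial>P) * (\<integral>\<omega>. Y j \<omega> \<partial>P)"
proof -
  interpret prob_space P by fact
  have "\<And>k. k \<in> {i, j} \<Longrightarrow> integrable P (Y k)" using int by auto
  note * = indep_vars_lebesgue_integral[OF _ assms(2) this] indep_vars_integrable[OF _ assms(2) this]
  show "integrable P (\<lambda>\<omega>. Y i \<omega> * Y j \<omega>)" using *(2) assms(3) by simp
  show "(\<integral>\<omega>. Y i \<omega> * Y j \<omega> \<partial>P) = (\<integral>\<omega>. Y i \<omega> \<partial>P) * (\<integral>\<omega>. Y j \<omega> \<partial>P)"
    using *(1) assms(3) by simp
qed
lemma indep_sum_square:
  fixes Y :: "nat \<Rightarrow> 'a \<Rightarrow> real"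
  assumes "prob_space P" "prob_space.indep_vars P (\<lambda>_. borel) Y {..<n}"
    and int: "\<And>i. i < n \<Longrightarrow> integrable P (Y i)" "\<And>i. i < n \<Longrightarrow> integrable P (\<lambda>\<omega>. (Y i \<omega>)\<^sup>2)"
    and "\<And>i. i < n \<Longrightarrow> (\<integral>\<omega>. Y i \<omega> \<partial>P) = 0"
  shows "integrable P (\<lambda>\<omega>. (\<Sum>i<n. Y i \<omega>)\<^sup>2)"
    and "(\<integral>\<omega>. (\<Sum>i<n. Y i \<omega>)\<^sup>2 \<partial>P) = (\<Sum>i<n. \<integral>\<omega>. (Y i \<omega>)\<^sup>2 \<partial>P)"
proof -
  interpret prob_space P by fact
  have ij: "integrable P (\<lambda>\<omega>. Y i \<omega> * Y j \<omega>) \<and> (\<integral>\<omega>. Y i \<omega> * Y j \<omega> \<partial>P) = (if i = j then \<integral>\<omega>. (Y i \<omega>)\<^sup>2 \<partial>P else 0)"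
    if "i < n" "j < n" for i j
  proof (cases "i = j")
    case True
    then show ?thesis using int that by (simp add: power2_eq_square)
  next
    case False
    have "indep_vars (\<lambda>_. borel) Y {i, j}"
      by (rule indep_vars_subset[OF assms(2)]) (use that in auto)
    note indep_vars_pair[OF assms(1) this False int(1)[OF that(1)] int(1)[OF that(2)]]
    then show ?thesis using that assms(5) False by simp
  qed
  have eq: "(\<lambda>\<omega>. (\<Sum>i<n. Y i \<omega>)\<^sup>2) = (\<lambda>\<omega>. \<Sum>i<n. \<Sum>j<n. Y i \<omega> * Y j \<omega>)"
    by (simp add: power2_eq_square sum_product)
  show "integrable P (\<lambda>\<omega>. (\<Sum>i<n. Y i \<omega>)\<^sup>2)"
    unfolding eq using ij by (intro Bochner_Integration.integrable_sum) auto
  have "(\<integral>\<omega>. (\<Sum>i<n. Y i \<omega>)\<^sup>2 \<partial>P) = (\<Sum>i<n. \<integral>\<omega>. (\<Sum>j<n. Y i \<omega> * Y j \<omega>) \<partial>P)"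
    unfolding eq using ij by (intro Bochner_Integration.integral_sum Bochner_Integration.integrable_sum) auto
  also have "\<dots> = (\<Sum>i<n. \<Sum>j<n. \<integral>\<omega>. Y i \<omega> * Y j \<omega> \<partial>P)"
    using ij by (intro sum.cong Bochner_Integration.integral_sum) auto
  also have "\<dots> = (\<Sum>i<n. \<Sum>j<n. if i = j then \<integral>\<omega>. (Y i \<omega>)\<^sup>2 \<partial>P else 0)"
    using ij by (intro sum.cong) auto
  finally show "(\<integral>\<omega>. (\<Sum>i<n. Y i \<omega>)\<^sup>2 \<partial>P) = (\<Sum>i<n. \<integral>\<omega>. (Y i \<omega>)\<^sup>2 \<partial>P)"
    by simp
qed

text \<open>A quadratic bound instead of the cubic Taylor bound: scaled by \<open>L\<close>, it
  makes the error of replacing v by L sin(v/L) at most v^2/(2L), which second moments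
  control.\<close>

lemma abs_diff_sin_le:
  fixes x :: real
  shows "\<bar>x - sin x\<bar> \<le> x\<^sup>2 / 2"
proof -
  have pos: "\<bar>x - sin x\<bar> \<le> x\<^sup>2 / 2" if "x \<ge> 0" for x :: real
  proof -
    have a: "x - sin x \<ge> 0" using sin_x_le_x[OF that] by simp
    have "(\<lambda>t. t\<^sup>2 / 2 - t + sin t) 0 \<le> (\<lambda>t. t\<^sup>2 / 2 - t + sin t) x"
    proof (rule DERIV_nonneg_imp_nondecreasing[OF that])
      fix t :: real assume t: "0 \<le> t" "t \<le> x"
      have "(\<lambda>t. t - 1 + cos t) 0 \<le> (\<lambda>t. t - 1 + cos t) t"
        by (rule DERIV_nonneg_imp_nondecreasing[OF t(1)])
           (auto intro!: exI[of _ "1 - sin _"] derivative_eq_intros)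
      then have "1 - cos t \<le> t" by simp
      then show "\<exists>y. ((\<lambda>t. t\<^sup>2 / 2 - t + sin t) has_real_derivative y) (at t) \<and> 0 \<le> y"
        by (intro exI[of _ "t - 1 + cos t"]) (auto intro!: derivative_eq_intros)
    qed
    then show ?thesis using a by simp
  qed
  show ?thesis
  proof (cases "x \<ge> 0")
    case False
    then show ?thesis using pos[of "-x"] by (simp add: abs_minus_commute)
  qed (rule pos)
qed

section \<open>Trigonometric approximation and the multivariate limit theorem\<close>

abbreviation sin_cube :: "nat \<Rightarrow> (nat \<Rightarrow> real) set" where
  "sin_cube d \<equiv> {..<d} \<rightarrow>\<^sub>E {-1..1}"

text \<open>The restriction to \<open>{..<d}\<close> puts all values into one compact extensional
  cube, the domain for Stone--Weierstrass.\<close>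

definition sin_coords :: "nat \<Rightarrow> real \<Rightarrow> (nat \<Rightarrow> 'w \<Rightarrow> real) \<Rightarrow> 'w \<Rightarrow> nat \<Rightarrow> real" where
  "sin_coords d L V \<omega> = (\<lambda>z\<in>{..<d}. sin (V z \<omega> / L))"

text \<open>The phase \<open>b\<close> keeps everything real: b = 0 and b = -pi/2 give the cosine
  and the sine. With \<open>k\<close> = 1, letting \<open>a\<close> and \<open>b\<close> vary
  recovers the characteristic function of \<open>V\<close>.\<close>

definition trig_mean ::
    "nat \<Rightarrow> real \<Rightarrow> 'w measure \<Rightarrow> (nat \<Rightarrow> 'w \<Rightarrow> real) \<Rightarrow> ((nat \<Rightarrow> real) \<Rightarrow> real)
     \<Rightarrow> (nat \<Rightarrow> real) \<Rightarrow> real \<Rightarrow> real" where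
  "trig_mean d L P V k a b =
     (\<integral>\<omega>. k (sin_coords d L V \<omega>) * cos ((\<Sum>z<d. a z * V z \<omega>) + b) \<partial>P)"

lemma sin_coords_in_cube: "sin_coords d L V \<omega> \<in> sin_cube d"
  by (auto simp: sin_coords_def)

lemma measurable_sin_coords:
  assumes "\<And>z. z < d \<Longrightarrow> V z \<in> borel_measurable P" "continuous_on (sin_cube d) k"
  shows "(\<lambda>\<omega>. k (sin_coords d L V \<omega>)) \<in> borel_measurable P"
proof -
  have "(\<lambda>\<omega>. sin_coords d L V \<omega>) \<in> borel_measurable P"
  proof (rule measurable_coordinatewise_then_product)
    fix z show "(\<lambda>\<omega>. sin_coords d L V \<omega> z) \<in> borel_measurable P"
      using assms(1)[of z] by (cases "z < d") (simp_all add: sin_coords_def)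
  qed
  then have "(\<lambda>\<omega>. sin_coords d L V \<omega>) \<in> measurable P (restrict_space borel (sin_cube d))"
    by (intro measurable_restrict_space2) (auto simp: sin_coords_in_cube)
  then show ?thesis
    using borel_measurable_continuous_on_restrict[OF assms(2)] by (rule measurable_compose)
qed

lemma bounded_on_sin_cube:
  assumes "continuous_on (sin_cube d) k"
  obtains B where "\<And>x. x \<in> sin_cube d \<Longrightarrow> \<bar>k x\<bar> \<le> (B::real)"
proof -
  have "compact (k ` sin_cube d)"
    using assms by (intro compact_continuous_image compact_PiE_real) auto
  then have "bounded (k ` sin_cube d)" by (rule compact_imp_bounded)
  then show ?thesis using that by (auto simp: bounded_iff)
qed

lemma integrable_trig_mean:
  assumes "prob_space P" "\<And>z. z < d \<Longrightarrow> V z \<in> borel_measurable P" "continuous_on (sin_cube d) k"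
  shows "integrable P (\<lambda>\<omega>. k (sin_coords d L V \<omega>) * cos ((\<Sum>z<d. a z * V z \<omega>) + b))"
proof -
  interpret prob_space P by fact
  obtain B where B: "\<And>x. x \<in> sin_cube d \<Longrightarrow> \<bar>k x\<bar> \<le> B"
    using bounded_on_sin_cube[OF assms(3)] by metis
  note [measurable] = measurable_sin_coords[where V = V, OF assms(2,3)]
  have [measurable]: "(\<lambda>\<omega>. \<Sum>z<d. a z * V z \<omega>) \<in> borel_measurable P"
    using assms(2) by (intro borel_measurable_sum) auto
  show ?thesis
  proof (rule integrable_const_bound[where B = B])
    have "\<bar>k (sin_coords d L V \<omega>)\<bar> * \<bar>cos ((\<Sum>z<d. a z * V z \<omega>) + b)\<bar> \<le> B * 1" for \<omega>
      using B[OF sin_coords_in_cube[of d L V \<omega>]] by (intro mult_mono) auto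
    then show "AE \<omega> in P. norm (k (sin_coords d L V \<omega>) * cos ((\<Sum>z<d. a z * V z \<omega>) + b)) \<le> B"
      by (simp add: abs_mult)
  qed measurable
qed

lemma trig_mean_add:
  assumes "prob_space P" "\<And>z. z < d \<Longrightarrow> V z \<in> borel_measurable P"
    and "continuous_on (sin_cube d) k" "continuous_on (sin_cube d) l"
  shows "trig_mean d L P V (\<lambda>x. k x + l x) a b = trig_mean d L P V k a b + trig_mean d L P V l a b"
  unfolding trig_mean_def using assms
  by (simp add: distrib_right integrable_trig_mean)

lemma trig_mean_cmult: "trig_mean d L P V (\<lambda>x. c * k x) a b = c * trig_mean d L P V k a b"
  unfolding trig_mean_def by (simp add: mult.assoc)

text \<open>Product-to-sum formula 2 sin y cos x = sin(x+y) - sin(x-y), with each sine written as a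
  cosine of shifted phase. Multiplying \<open>k\<close> by a coordinate thus only moves the
  frequency by 1/L and the phase by pi/2, so convergence for all \<open>a\<close> and
  \<open>b\<close> survives.\<close>

lemma trig_mean_coordinate:
  assumes "prob_space P" "\<And>z. z < d \<Longrightarrow> V z \<in> borel_measurable P"
    and "continuous_on (sin_cube d) k" and z: "z < d"
  shows "trig_mean d L P V (\<lambda>x. x z * k x) a b =
    (trig_mean d L P V k (a(z := a z + 1 / L)) (b - pi / 2)
     - trig_mean d L P V k (a(z := a z - 1 / L)) (b - pi / 2)) / 2"
proof -
  have upd: "(\<Sum>w<d. (a(z := a z + c)) w * v w) = (\<Sum>w<d. a w * v w) + c * v z" for c and v :: "nat \<Rightarrow> real"
  proof -
    have "(\<Sum>w<d. (a(z := a z + c)) w * v w) = (\<Sum>w<d. a w * v w + (if w = z then c * v z else 0))"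
      by (intro sum.cong) (auto simp: algebra_simps)
    then show ?thesis using z by (simp add: sum.distrib)
  qed
  have eq: "sin (V z \<omega> / L) * cos ((\<Sum>w<d. a w * V w \<omega>) + b) =
      (cos ((\<Sum>w<d. (a(z := a z + 1 / L)) w * V w \<omega>) + (b - pi / 2))
       - cos ((\<Sum>w<d. (a(z := a z - 1 / L)) w * V w \<omega>) + (b - pi / 2))) / 2" for \<omega>
  proof -
    have c: "cos (x - pi / 2) = sin x" for x :: real by (simp add: cos_diff)
    define x where "x = (\<Sum>w<d. a w * V w \<omega>) + b"
    have p: "(\<Sum>w<d. (a(z := a z + 1 / L)) w * V w \<omega>) + (b - pi / 2) = (x + V z \<omega> / L) - pi / 2"
      unfolding upd x_def by simp
    have m: "(\<Sum>w<d. (a(z := a z - 1 / L)) w * V w \<omega>) + (b - pi / 2) = (x - V z \<omega> / L) - pi / 2"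
      using upd[of "- (1 / L)" "\<lambda>w. V w \<omega>"] unfolding x_def
      by (simp del: fun_upd_apply)
    show ?thesis
      unfolding p m c by (simp add: x_def[symmetric] sin_add sin_diff)
  qed
  have "trig_mean d L P V (\<lambda>x. x z * k x) a b =
     (\<integral>\<omega>. (k (sin_coords d L V \<omega>) * cos ((\<Sum>w<d. (a(z := a z + 1 / L)) w * V w \<omega>) + (b - pi / 2))
       - k (sin_coords d L V \<omega>) * cos ((\<Sum>w<d. (a(z := a z - 1 / L)) w * V w \<omega>) + (b - pi / 2))) / 2 \<partial>P)"
    unfolding trig_mean_def
  proof (intro Bochner_Integration.integral_cong refl)
    fix \<omega>
    have "sin_coords d L V \<omega> z = sin (V z \<omega> / L)" using z by (simp add: sin_coords_def)
    then have "sin_coords d L V \<omega> z * k (sin_coords d L V \<omega>) * cos ((\<Sum>z<d. a z * V z \<omega>) + b)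
      = k (sin_coords d L V \<omega>) * (sin (V z \<omega> / L) * cos ((\<Sum>w<d. a w * V w \<omega>) + b))"
      by simp
    then show "sin_coords d L V \<omega> z * k (sin_coords d L V \<omega>) * cos ((\<Sum>z<d. a z * V z \<omega>) + b) =
      (k (sin_coords d L V \<omega>) * cos ((\<Sum>w<d. (a(z := a z + 1 / L)) w * V w \<omega>) + (b - pi / 2))
       - k (sin_coords d L V \<omega>) * cos ((\<Sum>w<d. (a(z := a z - 1 / L)) w * V w \<omega>) + (b - pi / 2))) / 2"
      unfolding eq by (simp add: right_diff_distrib)
  qed
  also have "\<dots> = (trig_mean d L P V k (a(z := a z + 1 / L)) (b - pi / 2)
     - trig_mean d L P V k (a(z := a z - 1 / L)) (b - pi / 2)) / 2"
    unfolding trig_mean_def integral_divide_zero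
    by (subst Bochner_Integration.integral_diff) (use assms in \<open>auto intro!: integrable_trig_mean\<close>)
  finally show ?thesis .
qed

text \<open>Convergence of all trigonometric means of \<open>g\<close> is not visibly closed under products of such \<open>g\<close>;
  preservation of that convergence under multiplication by \<open>g\<close> is, and this is the ring fed to
  Stone--Weierstrass.\<close>

lemma tendsto_trig_mean:
  fixes F :: "'i filter" and P :: "'i \<Rightarrow> 'w measure" and N :: "'v measure"
  assumes P: "\<And>i. prob_space (P i)" "\<And>i z. z < d \<Longrightarrow> V i z \<in> borel_measurable (P i)"
    and N: "prob_space N" "\<And>z. z < d \<Longrightarrow> \<xi> z \<in> borel_measurable N"
    and char: "\<And>a b. ((\<lambda>i. trig_mean d L (P i) (V i) (\<lambda>_. 1) a b) \<longlongrightarrow> trig_mean d L N \<xi> (\<lambda>_. 1) a b) F"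
    and f: "continuous_on (sin_cube d) f" and \<epsilon>: "\<epsilon> > 0"
  shows "\<exists>g. continuous_on (sin_cube d) g \<and> (\<forall>x\<in>sin_cube d. \<bar>f x - g x\<bar> < \<epsilon>) \<and>
    (\<forall>a b. ((\<lambda>i. trig_mean d L (P i) (V i) g a b) \<longlongrightarrow> trig_mean d L N \<xi> g a b) F)"
proof -
  let ?K = "sin_cube d"
  define Q where "Q k \<longleftrightarrow> continuous_on ?K k \<and>
    (\<forall>a b. ((\<lambda>i. trig_mean d L (P i) (V i) k a b) \<longlongrightarrow> trig_mean d L N \<xi> k a b) F)" for k
  define R where "R = {g. continuous_on ?K g \<and> (\<forall>k. Q k \<longrightarrow> Q (\<lambda>x. g x * k x))}"
  interpret function_ring_on R ?K
  proof
    show "compact ?K" by (intro compact_PiE_real) auto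
  next
    fix f assume "f \<in> R" then show "continuous_on ?K f" by (simp add: R_def)
  next
    fix f g assume fg: "f \<in> R" "g \<in> R"
    have "Q (\<lambda>x. (f x + g x) * k x)" if "Q k" for k
    proof -
      have q: "Q (\<lambda>x. f x * k x)" "Q (\<lambda>x. g x * k x)" using fg that by (auto simp: R_def)
      then have c: "continuous_on ?K (\<lambda>x. f x * k x)" "continuous_on ?K (\<lambda>x. g x * k x)"
        by (auto simp: Q_def)
      show ?thesis
        unfolding Q_def distrib_right
        using q by (auto simp: Q_def trig_mean_add[where V = "V _", OF P c] trig_mean_add[where V = \<xi>, OF N c]
            intro!: continuous_intros tendsto_intros)
    qed
    then show "(\<lambda>x. f x + g x) \<in> R" using fg by (auto simp: R_def intro!: continuous_intros)
  next
    fix f g assume fg: "f \<in> R" "g \<in> R"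
    then show "(\<lambda>x. f x * g x) \<in> R"
      by (auto simp: R_def mult.assoc intro!: continuous_intros)
  next
    fix c :: real
    show "(\<lambda>_. c) \<in> R"
      by (auto simp: R_def Q_def trig_mean_cmult intro!: continuous_intros tendsto_intros)
  next
    fix x y assume xy: "x \<in> ?K" "y \<in> ?K" "x \<noteq> y"
    then obtain z where z: "z < d" "x z \<noteq> y z"
      by (metis PiE_ext lessThan_iff)
    have cz: "continuous_on ?K (\<lambda>x. x z)"
      by (rule continuous_on_subset[OF continuous_on_product_coordinates]) auto
    have "Q (\<lambda>x. x z * k x)" if "Q k" for k
    proof -
      have c: "continuous_on ?K k" using that by (simp add: Q_def)
      show ?thesis
        using that cz unfolding Q_def
        by (auto simp: trig_mean_coordinate[where V = "V _", OF P c z(1)] trig_mean_coordinate[where V = \<xi>, OF N c z(1)]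
            simp del: fun_upd_apply intro!: continuous_intros tendsto_intros)
    qed
    then show "\<exists>f\<in>R. f x \<noteq> f y"
      using z cz by (intro bexI[of _ "\<lambda>x. x z"]) (auto simp: R_def)
  qed
  obtain g where g: "g \<in> R" "\<forall>x\<in>?K. \<bar>f x - g x\<bar> < \<epsilon>"
    using Stone_Weierstrass_basic[OF f \<epsilon>] by auto
  \<comment> \<open>The elements of \<open>R\<close> are multipliers. Letting \<open>g\<close> act
    on the constant 1, whose trigonometric means converge by \<open>char\<close>, yields the
    convergence for \<open>g\<close> itself.\<close>
  have "Q (\<lambda>_. 1)" using char by (simp add: Q_def)
  then have "Q (\<lambda>x. g x * 1)" using g by (auto simp: R_def)
  then show ?thesis using g by (auto simp: Q_def)
qed

section \<open>Bounded Lipschitz functions of finitely many coordinates\<close>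

text \<open>The function space carries the product topology. The Lipschitz bound is a finite sum of
  continuous coordinate terms that vanishes at the base point, which gives continuity by
  comparison.\<close>

lemma continuous_on_lipschitz_coords:
  fixes h :: "(nat \<Rightarrow> real) \<Rightarrow> real"
  assumes h: "\<And>v w. \<bar>h v - h w\<bar> \<le> C * (\<Sum>z<d. \<bar>v z - w z\<bar>)"
  shows "continuous_on A h"
proof -
  have "isCont h w" for w
  proof -
    have c: "isCont (\<lambda>v::nat \<Rightarrow> real. v z) w" for z
      by (rule continuous_on_interior[OF continuous_on_product_coordinates]) simp
    have "((\<lambda>v. C * (\<Sum>z<d. \<bar>v z - w z\<bar>)) \<longlongrightarrow> C * (\<Sum>z<d. \<bar>w z - w z\<bar>)) (at w)"
      by (intro tendsto_intros c[unfolded isCont_def])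
    then have lim: "((\<lambda>v. C * (\<Sum>z<d. \<bar>v z - w z\<bar>)) \<longlongrightarrow> 0) (at w)" by simp
    have "((\<lambda>v. h v - h w) \<longlongrightarrow> 0) (at w)"
      by (rule Lim_null_comparison[OF _ lim]) (simp add: h)
    then show ?thesis
      unfolding isCont_def by (rule LIM_zero_cancel)
  qed
  then show ?thesis
    by (simp add: continuous_at_imp_continuous_on)
qed

lemma finite_reindex_nat:
  assumes "finite S"
  obtains e where "bij_betw e {..<card S} S"
  using ex_bij_betw_nat_finite[OF assms] by (auto simp: atLeast0LessThan)

text \<open>\<open>S\<close> may sit in an uncountable type, where coordinatewise measurability does
  not give Borel measurability into the function space. Enumerating \<open>S\<close> moves the
  problem to sequences, where it does.\<close>

lemma borel_measurable_lipschitz_coords: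
  fixes h :: "('z \<Rightarrow> real) \<Rightarrow> real"
  assumes S: "finite S" and V: "\<And>z. z \<in> S \<Longrightarrow> V z \<in> borel_measurable P"
    and h: "\<And>v w. \<bar>h v - h w\<bar> \<le> C * (\<Sum>z\<in>S. \<bar>v z - w z\<bar>)"
  shows "(\<lambda>\<omega>. h (\<lambda>z. V z \<omega>)) \<in> borel_measurable P"
proof -
  obtain e where e: "bij_betw e {..<card S} S" using finite_reindex_nat[OF S] .
  define e' where "e' = inv_into {..<card S} e"
  have e': "e' z < card S" "e (e' z) = z" if "z \<in> S" for z
    using e that inv_into_into[of z e "{..<card S}"] by (auto simp: e'_def bij_betw_def f_inv_into_f)
  have inv: "e' (e k) = k" if "k < card S" for k
    using e that by (auto simp: e'_def bij_betw_def)
  define h' where "h' u = h (\<lambda>z. u (e' z))" for u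
  have "\<bar>h' u - h' w\<bar> \<le> C * (\<Sum>k<card S. \<bar>u k - w k\<bar>)" for u w
  proof -
    have "(\<Sum>z\<in>S. \<bar>u (e' z) - w (e' z)\<bar>) = (\<Sum>k<card S. \<bar>u k - w k\<bar>)"
      using inv by (subst sum.reindex_bij_betw[OF e, symmetric]) auto
    then show ?thesis using h[of "\<lambda>z. u (e' z)" "\<lambda>z. w (e' z)"] by (simp add: h'_def)
  qed
  then have c: "continuous_on UNIV h'" by (rule continuous_on_lipschitz_coords)
  define U where "U \<omega> k = (if k < card S then V (e k) \<omega> else 0)" for \<omega> k
  have "U \<in> borel_measurable P"
  proof (rule measurable_coordinatewise_then_product)
    fix k show "(\<lambda>\<omega>. U \<omega> k) \<in> borel_measurable P"
      using V[of "e k"] e by (cases "k < card S") (auto simp: U_def bij_betw_def)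
  qed
  then have "(\<lambda>\<omega>. h' (U \<omega>)) \<in> borel_measurable P"
    using borel_measurable_continuous_onI[OF c] by (rule measurable_compose)
  moreover have "h' (U \<omega>) = h (\<lambda>z. V z \<omega>)" for \<omega>
  proof -
    \<comment> \<open>The two vectors agree on \<open>S\<close>, so the Lipschitz bound between them
      is zero: \<open>h\<close> cannot see coordinates outside \<open>S\<close>.\<close>
    have "(\<Sum>z\<in>S. \<bar>U \<omega> (e' z) - V z \<omega>\<bar>) = 0"
      using e' by (auto simp: U_def)
    then show ?thesis using h[of "\<lambda>z. U \<omega> (e' z)" "\<lambda>z. V z \<omega>"] by (simp add: h'_def)
  qed
  ultimately show ?thesis by simp
qed

text \<open>Two errors add up. Passing from \<open>V\<close> to L sin(V/L) costs C times the sum of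
  V^2/(2L), whose mean is at most the first term; passing from \<open>h\<close> to \<open>g\<close>
  on the cube costs \<open>\<epsilon>\<close>.\<close>

lemma sin_approximation:
  fixes h :: "(nat \<Rightarrow> real) \<Rightarrow> real"
  assumes "prob_space P" and V: "\<And>z. z < d \<Longrightarrow> V z \<in> borel_measurable P"
    and mom: "\<And>z. z < d \<Longrightarrow> integrable P (\<lambda>\<omega>. (V z \<omega>)\<^sup>2)" "\<And>z. z < d \<Longrightarrow> (\<integral>\<omega>. (V z \<omega>)\<^sup>2 \<partial>P) \<le> B"
    and h: "\<And>v w. \<bar>h v - h w\<bar> \<le> C * (\<Sum>z<d. \<bar>v z - w z\<bar>)" and bdd: "\<And>v. \<bar>h v\<bar> \<le> D"
    and L: "L > 0" and C: "C \<ge> 0"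
    and g: "continuous_on (sin_cube d) g" "\<And>x. x \<in> sin_cube d \<Longrightarrow> \<bar>h (\<lambda>z. L * x z) - g x\<bar> < \<epsilon>"
  shows "\<bar>(\<integral>\<omega>. h (\<lambda>z. V z \<omega>) \<partial>P) - trig_mean d L P V g (\<lambda>_. 0) 0\<bar> \<le> C * d * B / (2 * L) + \<epsilon>"
proof -
  interpret prob_space P by fact
  let ?U = "sin_coords d L V"
  have hV: "integrable P (\<lambda>\<omega>. h (\<lambda>z. V z \<omega>))"
    using bdd by (intro integrable_const_bound[where B = D]
        borel_measurable_lipschitz_coords[OF finite_lessThan V h]) auto
  have gU: "integrable P (\<lambda>\<omega>. g (?U \<omega>))"
    using integrable_trig_mean[where V = V and L = L and a = "\<lambda>_. 0" and b = 0, OF assms(1) V g(1)] by simp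
  have pt: "\<bar>h (\<lambda>z. V z \<omega>) - g (?U \<omega>)\<bar> \<le> C * (\<Sum>z<d. (V z \<omega>)\<^sup>2 / (2 * L)) + \<epsilon>" for \<omega>
  proof -
    have "\<bar>V z \<omega> - L * ?U \<omega> z\<bar> \<le> (V z \<omega>)\<^sup>2 / (2 * L)" if "z < d" for z
    proof -
      have "\<bar>V z \<omega> - L * ?U \<omega> z\<bar> = L * \<bar>V z \<omega> / L - sin (V z \<omega> / L)\<bar>"
      proof -
        have "V z \<omega> - L * ?U \<omega> z = L * (V z \<omega> / L - sin (V z \<omega> / L))"
          using L that by (simp add: sin_coords_def right_diff_distrib)
        then show ?thesis using L by (simp only: abs_mult)
      qed
      also have "\<dots> \<le> L * ((V z \<omega> / L)\<^sup>2 / 2)"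
        using L by (intro mult_left_mono abs_diff_sin_le) auto
      also have "\<dots> = (V z \<omega>)\<^sup>2 / (2 * L)"
        using L by (simp add: power2_eq_square field_simps)
      finally show ?thesis .
    qed
    then have "(\<Sum>z<d. \<bar>V z \<omega> - L * ?U \<omega> z\<bar>) \<le> (\<Sum>z<d. (V z \<omega>)\<^sup>2 / (2 * L))"
      by (intro sum_mono) auto
    then have "\<bar>h (\<lambda>z. V z \<omega>) - h (\<lambda>z. L * ?U \<omega> z)\<bar> \<le> C * (\<Sum>z<d. (V z \<omega>)\<^sup>2 / (2 * L))"
      using h[of "\<lambda>z. V z \<omega>" "\<lambda>z. L * ?U \<omega> z"] mult_left_mono[OF _ C] by (meson order_trans)
    with g(2)[OF sin_coords_in_cube[of d L V \<omega>]] show ?thesis by linarith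
  qed
  have "\<bar>(\<integral>\<omega>. h (\<lambda>z. V z \<omega>) \<partial>P) - (\<integral>\<omega>. g (?U \<omega>) \<partial>P)\<bar> = \<bar>\<integral>\<omega>. h (\<lambda>z. V z \<omega>) - g (?U \<omega>) \<partial>P\<bar>"
    using hV gU by simp
  also have "\<dots> \<le> (\<integral>\<omega>. \<bar>h (\<lambda>z. V z \<omega>) - g (?U \<omega>)\<bar> \<partial>P)"
    by (rule integral_abs_bound)
  also have "\<dots> \<le> (\<integral>\<omega>. C * (\<Sum>z<d. (V z \<omega>)\<^sup>2 / (2 * L)) + \<epsilon> \<partial>P)"
    using hV gU mom pt by (intro integral_mono Bochner_Integration.integrable_add
        integrable_mult_right Bochner_Integration.integrable_sum integrable_divide) auto
  also have "\<dots> = C * (\<Sum>z<d. (\<integral>\<omega>. (V z \<omega>)\<^sup>2 \<partial>P) / (2 * L)) + \<epsilon>"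
    using mom by (subst Bochner_Integration.integral_add) (auto simp: prob_space)
  also have "\<dots> \<le> C * (\<Sum>z<d. B / (2 * L)) + \<epsilon>"
    using mom L C by (intro add_right_mono mult_left_mono sum_mono divide_right_mono) auto
  finally show ?thesis by (simp add: trig_mean_def)
qed

text \<open>The bound \<open>B\<close> on second moments is uniform in the index and takes the place
  of tightness: it makes the sine truncation uniformly good, and the truncated function is a uniform
  limit of functions whose means are known to converge.\<close>

lemma cramer_wold_nat:
  fixes F :: "'i filter" and P :: "'i \<Rightarrow> 'w measure" and N :: "'v measure"
    and h :: "(nat \<Rightarrow> real) \<Rightarrow> real"
  assumes P: "\<And>i. prob_space (P i)" "\<And>i z. z < d \<Longrightarrow> V i z \<in> borel_measurable (P i)"
      "\<And>i z. z < d \<Longrightarrow> integrable (P i) (\<lambda>\<omega>. (V i z \<omega>)\<^sup>2)"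
      "\<And>i z. z < d \<Longrightarrow> (\<integral>\<omega>. (V i z \<omega>)\<^sup>2 \<partial>P i) \<le> B"
    and N: "prob_space N" "\<And>z. z < d \<Longrightarrow> \<xi> z \<in> borel_measurable N"
      "\<And>z. z < d \<Longrightarrow> integrable N (\<lambda>\<omega>. (\<xi> z \<omega>)\<^sup>2)"
      "\<And>z. z < d \<Longrightarrow> (\<integral>\<omega>. (\<xi> z \<omega>)\<^sup>2 \<partial>N) \<le> B"
    and char: "\<And>a b. ((\<lambda>i. \<integral>\<omega>. cos ((\<Sum>z<d. a z * V i z \<omega>) + b) \<partial>P i) \<longlongrightarrow>
        (\<integral>\<omega>. cos ((\<Sum>z<d. a z * \<xi> z \<omega>) + b) \<partial>N)) F"
    and h: "\<And>v w. \<bar>h v - h w\<bar> \<le> C * (\<Sum>z<d. \<bar>v z - w z\<bar>)" and bdd: "\<And>v. \<bar>h v\<bar> \<le> D"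
    and C: "C \<ge> 0" and B: "B \<ge> 0"
  shows "((\<lambda>i. \<integral>\<omega>. h (\<lambda>z. V i z \<omega>) \<partial>P i) \<longlongrightarrow> (\<integral>\<omega>. h (\<lambda>z. \<xi> z \<omega>) \<partial>N)) F"
proof (rule tendstoI)
  fix r :: real assume "r > 0"
  \<comment> \<open>Each of the two laws contributes at most 2 \<epsilon> and the trigonometric
    means less than \<epsilon>, which is less than 5 \<epsilon> in total.\<close>
  define \<epsilon> where "\<epsilon> = r / 5"
  have \<epsilon>: "\<epsilon> > 0" using \<open>r > 0\<close> by (simp add: \<epsilon>_def)
  \<comment> \<open>Large enough for C d B / (2 L) \<le> \<epsilon>; the summand 1 keeps
    \<open>L\<close> positive when C d B = 0.\<close>
  define L where "L = C * d * B / (2 * \<epsilon>) + 1"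
  have L: "L > 0" using C B \<epsilon> by (auto simp: L_def intro!: add_nonneg_pos)
  have small: "C * d * B / (2 * L) \<le> \<epsilon>"
    using L \<epsilon> by (simp add: L_def field_simps)
  have "\<bar>h (\<lambda>z. L * v z) - h (\<lambda>z. L * w z)\<bar> \<le> C * L * (\<Sum>z<d. \<bar>v z - w z\<bar>)" for v w
    using h[of "\<lambda>z. L * v z" "\<lambda>z. L * w z"] L
    by (simp add: right_diff_distrib[symmetric] abs_mult sum_distrib_left[symmetric] mult.assoc)
  then have "continuous_on (sin_cube d) (\<lambda>x. h (\<lambda>z. L * x z))"
    by (rule continuous_on_lipschitz_coords)
  moreover have "((\<lambda>i. trig_mean d L (P i) (V i) (\<lambda>_. 1) a b) \<longlongrightarrow> trig_mean d L N \<xi> (\<lambda>_. 1) a b) F" for a b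
    using char by (simp add: trig_mean_def)
  ultimately obtain g where g: "continuous_on (sin_cube d) g"
      "\<forall>x\<in>sin_cube d. \<bar>h (\<lambda>z. L * x z) - g x\<bar> < \<epsilon>"
    and lims: "\<forall>a b. ((\<lambda>i. trig_mean d L (P i) (V i) g a b) \<longlongrightarrow> trig_mean d L N \<xi> g a b) F"
    using tendsto_trig_mean[where V = V and \<xi> = \<xi> and L = L and F = F, OF P(1,2) N(1,2) _ _ \<epsilon>]
    by blast
  note g = g(1) g(2)[rule_format]
  note lim = lims[rule_format, of "\<lambda>_. 0" 0]
  have 1: "\<bar>(\<integral>\<omega>. h (\<lambda>z. V i z \<omega>) \<partial>P i) - trig_mean d L (P i) (V i) g (\<lambda>_. 0) 0\<bar> \<le> 2 * \<epsilon>" for i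
  proof -
    have "\<bar>(\<integral>\<omega>. h (\<lambda>z. V i z \<omega>) \<partial>P i) - trig_mean d L (P i) (V i) g (\<lambda>_. 0) 0\<bar> \<le> C * d * B / (2 * L) + \<epsilon>"
      by (rule sin_approximation[where V = "V i", OF P h bdd L C g])
    then show ?thesis using small by linarith
  qed
  have 2: "\<bar>(\<integral>\<omega>. h (\<lambda>z. \<xi> z \<omega>) \<partial>N) - trig_mean d L N \<xi> g (\<lambda>_. 0) 0\<bar> \<le> 2 * \<epsilon>"
  proof -
    have "\<bar>(\<integral>\<omega>. h (\<lambda>z. \<xi> z \<omega>) \<partial>N) - trig_mean d L N \<xi> g (\<lambda>_. 0) 0\<bar> \<le> C * d * B / (2 * L) + \<epsilon>"
      by (rule sin_approximation[where V = \<xi>, OF N h bdd L C g])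
    then show ?thesis using small by linarith
  qed
  show "\<forall>\<^sub>F i in F. dist (\<integral>\<omega>. h (\<lambda>z. V i z \<omega>) \<partial>P i) (\<integral>\<omega>. h (\<lambda>z. \<xi> z \<omega>) \<partial>N) < r"
    using tendstoD[OF lim \<epsilon>]
  proof eventually_elim
    case (elim i)
    then show ?case using 1[of i] 2 unfolding dist_real_def \<epsilon>_def by linarith
  qed
qed

lemma cramer_wold:
  fixes F :: "'i filter" and P :: "'i \<Rightarrow> 'w measure" and N :: "'v measure"
    and h :: "('z \<Rightarrow> real) \<Rightarrow> real"
  assumes S: "finite S"
    and P: "\<And>i. prob_space (P i)" "\<And>i z. z \<in> S \<Longrightarrow> V i z \<in> borel_measurable (P i)"
      "\<And>i z. z \<in> S \<Longrightarrow> integrable (P i) (\<lambda>\<omega>. (V i z \<omega>)\<^sup>2)"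
      "\<And>i z. z \<in> S \<Longrightarrow> (\<integral>\<omega>. (V i z \<omega>)\<^sup>2 \<partial>P i) \<le> B"
    and N: "prob_space N" "\<And>z. z \<in> S \<Longrightarrow> \<xi> z \<in> borel_measurable N"
      "\<And>z. z \<in> S \<Longrightarrow> integrable N (\<lambda>\<omega>. (\<xi> z \<omega>)\<^sup>2)"
      "\<And>z. z \<in> S \<Longrightarrow> (\<integral>\<omega>. (\<xi> z \<omega>)\<^sup>2 \<partial>N) \<le> B"
    and char: "\<And>a b. ((\<lambda>i. \<integral>\<omega>. cos ((\<Sum>z\<in>S. a z * V i z \<omega>) + b) \<partial>P i) \<longlongrightarrow>
        (\<integral>\<omega>. cos ((\<Sum>z\<in>S. a z * \<xi> z \<omega>) + b) \<partial>N)) F"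
    and h: "\<And>v w. \<bar>h v - h w\<bar> \<le> C * (\<Sum>z\<in>S. \<bar>v z - w z\<bar>)" and bdd: "\<And>v. \<bar>h v\<bar> \<le> D"
    and C: "C \<ge> 0" and B: "B \<ge> 0"
  shows "((\<lambda>i. \<integral>\<omega>. h (\<lambda>z. V i z \<omega>) \<partial>P i) \<longlongrightarrow> (\<integral>\<omega>. h (\<lambda>z. \<xi> z \<omega>) \<partial>N)) F"
proof -
  obtain e where e: "bij_betw e {..<card S} S" using finite_reindex_nat[OF S] .
  define e' where "e' = inv_into {..<card S} e"
  have e': "e (e' z) = z" if "z \<in> S" for z
    using e that by (auto simp: e'_def bij_betw_def f_inv_into_f)
  have inv: "e' (e k) = k" if "k < card S" for k
    using e that by (auto simp: e'_def bij_betw_def)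
  have eS: "e k \<in> S" if "k < card S" for k using e that by (auto simp: bij_betw_def)
  have sum: "(\<Sum>k<card S. f (e k)) = (\<Sum>z\<in>S. f z)" for f :: "'z \<Rightarrow> real"
    by (rule sum.reindex_bij_betw[OF e])
  define h' where "h' u = h (\<lambda>z. u (e' z))" for u
  have h': "\<bar>h' u - h' w\<bar> \<le> C * (\<Sum>k<card S. \<bar>u k - w k\<bar>)" for u w
    using h[of "\<lambda>z. u (e' z)" "\<lambda>z. w (e' z)"] inv by (simp add: h'_def sum[symmetric])
  have hh: "h' (\<lambda>k. v (e k)) = h v" for v
    using h[of "\<lambda>z. v (e (e' z))" v] e' by (simp add: h'_def)
  have char': "((\<lambda>i. \<integral>\<omega>. cos ((\<Sum>k<card S. a k * V i (e k) \<omega>) + b) \<partial>P i) \<longlongrightarrow>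
        (\<integral>\<omega>. cos ((\<Sum>k<card S. a k * \<xi> (e k) \<omega>) + b) \<partial>N)) F" for a b
  proof -
    have "(\<Sum>k<card S. a k * v (e k)) = (\<Sum>z\<in>S. a (e' z) * v z)" for v :: "'z \<Rightarrow> real"
      using sum[of "\<lambda>z. a (e' z) * v z"] inv by simp
    then have "(\<Sum>k<card S. a k * V i (e k) \<omega>) = (\<Sum>z\<in>S. a (e' z) * V i z \<omega>)"
        "(\<Sum>k<card S. a k * \<xi> (e k) \<omega>') = (\<Sum>z\<in>S. a (e' z) * \<xi> z \<omega>')" for i \<omega> \<omega>'
      by this+
    then show ?thesis using char[of "\<lambda>z. a (e' z)" b] by simp
  qed
  have "((\<lambda>i. \<integral>\<omega>. h' (\<lambda>k. V i (e k) \<omega>) \<partial>P i) \<longlongrightarrow> (\<integral>\<omega>. h' (\<lambda>k. \<xi> (e k) \<omega>) \<partial>N)) F"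
  proof (rule cramer_wold_nat[where V = "\<lambda>i k. V i (e k)" and \<xi> = "\<lambda>k. \<xi> (e k)" and d = "card S",
        OF P(1) P(2)[OF eS] P(3)[OF eS] P(4)[OF eS] N(1) N(2)[OF eS] N(3)[OF eS] N(4)[OF eS] char' h' _ C B])
    show "\<bar>h' v\<bar> \<le> D" for v by (simp add: h'_def bdd)
  qed
  moreover have "h' (\<lambda>k. V i (e k) \<omega>) = h (\<lambda>z. V i z \<omega>)" "h' (\<lambda>k. \<xi> (e k) \<omega>') = h (\<lambda>z. \<xi> z \<omega>')" for i \<omega> \<omega>'
    by (rule hh)+
  ultimately show ?thesis by simp
qed

section \<open>The bounded Lipschitz metric\<close>

abbreviation BL1 :: "(real \<Rightarrow> real) set" where
  "BL1 \<equiv> {f. (\<forall>x. \<bar>f x\<bar> \<le> 1) \<and> 1-lipschitz_on UNIV f}"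

lemma lipschitz_on_real_iff:
  fixes f :: "real \<Rightarrow> real"
  shows "C-lipschitz_on UNIV f \<longleftrightarrow> C \<ge> 0 \<and> (\<forall>x y. \<bar>f x - f y\<bar> \<le> C * \<bar>x - y\<bar>)"
  by (auto simp: lipschitz_on_def dist_real_def)

lemma borel_measurable_BL1:
  assumes "f \<in> BL1"
  shows "f \<in> borel_measurable borel"
  using assms by (auto intro: borel_measurable_continuous_onI lipschitz_on_continuous_on)

lemma abs_integral_le_1:
  fixes f :: "'a \<Rightarrow> real"
  assumes "prob_space \<mu>" "\<And>x. \<bar>f x\<bar> \<le> 1"
  shows "\<bar>integral\<^sup>L \<mu> f\<bar> \<le> 1"
proof -
  interpret prob_space \<mu> by fact
  have "\<bar>integral\<^sup>L \<mu> f\<bar> \<le> (\<integral>x. \<bar>f x\<bar> \<partial>\<mu>)" by (rule integral_abs_bound)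
  also have "\<dots> \<le> (\<integral>x. 1 \<partial>\<mu>)" using assms(2) by (intro integral_mono') auto
  finally show ?thesis by (simp add: prob_space)
qed

lemma bdd_above_BL1:
  assumes "prob_space \<mu>" "prob_space \<nu>"
  shows "bdd_above ((\<lambda>f. \<bar>integral\<^sup>L \<mu> f - integral\<^sup>L \<nu> f\<bar>) ` BL1)"
proof (rule bdd_aboveI2[where M = 2])
  fix f assume "f \<in> BL1"
  then show "\<bar>integral\<^sup>L \<mu> f - integral\<^sup>L \<nu> f\<bar> \<le> 2"
    using abs_integral_le_1[OF assms(1), of f] abs_integral_le_1[OF assms(2), of f] by force
qed

lemma zero_in_BL1: "(\<lambda>_. 0) \<in> BL1"
  by (auto simp: lipschitz_on_real_iff)

lemma d_BL_nonneg:
  assumes "prob_space \<mu>" "prob_space \<nu>"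
  shows "d_BL \<mu> \<nu> \<ge> 0"
  using cSUP_upper[OF zero_in_BL1 bdd_above_BL1[OF assms]] by (simp add: d_BL_def)

lemma d_BL_leI:
  assumes "\<And>f. f \<in> BL1 \<Longrightarrow> \<bar>integral\<^sup>L \<mu> f - integral\<^sup>L \<nu> f\<bar> \<le> c"
  shows "d_BL \<mu> \<nu> \<le> c"
  unfolding d_BL_def
proof (rule cSUP_least)
  show "BL1 \<noteq> {}" using zero_in_BL1 by (metis empty_iff)
qed (rule assms)

section \<open>A partition of unity on the line and convergence in \<open>d_BL\<close>\<close>

definition ramp :: "real \<Rightarrow> real" where
  "ramp x = min 1 (max 0 x)"

lemma ramp_lipschitz: "\<bar>ramp x - ramp y\<bar> \<le> \<bar>x - y\<bar>"
  by (auto simp: ramp_def)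

lemma ramp_mono: "x \<le> y \<Longrightarrow> ramp x \<le> ramp y"
  by (auto simp: ramp_def)

lemma ramp_bounds: "0 \<le> ramp x" "ramp x \<le> 1"
  by (auto simp: ramp_def)

text \<open>Differences of consecutive ramps telescope, so that the \<open>tent \<epsilon> m k\<close>, centred at \<open>(k - m) \<epsilon>\<close>, form a
  partition of unity on a long interval.\<close>

definition tent :: "real \<Rightarrow> nat \<Rightarrow> nat \<Rightarrow> real \<Rightarrow> real" where
  "tent \<epsilon> m k x = ramp (x / \<epsilon> + m + 1 - k) - ramp (x / \<epsilon> + m - k)"

lemma sum_tent: "(\<Sum>k<n. tent \<epsilon> m k x) = ramp (x / \<epsilon> + m + 1) - ramp (x / \<epsilon> + m + 1 - n)"
proof -
  have "(\<Sum>k<n. tent \<epsilon> m k x) = (\<Sum>k<n. ramp (x / \<epsilon> + m + 1 - k) - ramp (x / \<epsilon> + m + 1 - Suc k))"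
    unfolding tent_def by (intro sum.cong) (simp_all add: algebra_simps)
  then show ?thesis by (subst (asm) sum_lessThan_telescope') simp
qed

lemma tent_bounds: "0 \<le> tent \<epsilon> m k x" "tent \<epsilon> m k x \<le> 1"
  using ramp_mono[of "x / \<epsilon> + m - k" "x / \<epsilon> + m + 1 - k"]
    ramp_bounds[of "x / \<epsilon> + m + 1 - k"] ramp_bounds[of "x / \<epsilon> + m - k"]
  by (auto simp: tent_def)

lemma tent_support:
  assumes "\<epsilon> > 0" "tent \<epsilon> m k x \<noteq> 0"
  shows "\<bar>x - (real k - real m) * \<epsilon>\<bar> \<le> \<epsilon>"
proof -
  have "\<bar>x / \<epsilon> - (real k - real m)\<bar> \<le> 1"
    using assms(2) by (auto simp: tent_def ramp_def min_def max_def split: if_splits)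
  then have "\<epsilon> * \<bar>x / \<epsilon> - (real k - real m)\<bar> \<le> \<epsilon> * 1"
    using assms(1) by (intro mult_left_mono) auto
  moreover have "\<bar>x - (real k - real m) * \<epsilon>\<bar> = \<epsilon> * \<bar>x / \<epsilon> - (real k - real m)\<bar>"
  proof -
    have "x - (real k - real m) * \<epsilon> = \<epsilon> * (x / \<epsilon> - (real k - real m))"
      using assms(1) by (simp add: right_diff_distrib mult.commute)
    then show ?thesis using assms(1) by (simp only: abs_mult)
  qed
  ultimately show ?thesis by simp
qed

lemma tent_lipschitz:
  assumes "\<epsilon> > 0"
  shows "\<bar>tent \<epsilon> m k x - tent \<epsilon> m k y\<bar> \<le> 2 / \<epsilon> * \<bar>x - y\<bar>"
proof -
  have "\<bar>tent \<epsilon> m k x - tent \<epsilon> m k y\<bar> \<le> 2 * \<bar>x / \<epsilon> - y / \<epsilon>\<bar>"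
    using ramp_lipschitz[of "x / \<epsilon> + m + 1 - k" "y / \<epsilon> + m + 1 - k"]
      ramp_lipschitz[of "x / \<epsilon> + m - k" "y / \<epsilon> + m - k"]
    unfolding tent_def by argo
  also have "\<dots> = 2 / \<epsilon> * \<bar>x - y\<bar>"
    using assms by (simp add: diff_divide_distrib[symmetric] abs_divide)
  finally show ?thesis .
qed

lemma borel_measurable_tent [measurable]: "tent \<epsilon> m k \<in> borel_measurable borel"
  unfolding tent_def[abs_def] ramp_def[abs_def] by measurable

text \<open>With t the sum of the tents at \<open>x\<close>, the difference splits into f(x)(1 - t),
  bounded by 1 - t, and a weighted sum of differences between \<open>f\<close> at \<open>x\<close>
  and at the nodes. Each tent is active only within \<epsilon> of its node, so that sum is at most
  \<epsilon>. The term 1 - t is zero on the interval the tents cover.\<close>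

lemma tent_interpolation:
  assumes "\<epsilon> > 0" "f \<in> BL1"
  shows "\<bar>f x - (\<Sum>k<n. f ((real k - real m) * \<epsilon>) * tent \<epsilon> m k x)\<bar> \<le> \<epsilon> + (1 - (\<Sum>k<n. tent \<epsilon> m k x))"
proof -
  let ?t = "\<Sum>k<n. tent \<epsilon> m k x"
  have t: "0 \<le> ?t" "?t \<le> 1"
    using ramp_bounds[of "x / \<epsilon> + m + 1"] ramp_bounds[of "x / \<epsilon> + m + 1 - n"]
    by (auto intro: sum_nonneg tent_bounds) (simp add: sum_tent)
  have "\<bar>\<Sum>k<n. (f x - f ((real k - real m) * \<epsilon>)) * tent \<epsilon> m k x\<bar> \<le> (\<Sum>k<n. \<epsilon> * tent \<epsilon> m k x)"
  proof (rule order_trans[OF sum_abs], rule sum_mono)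
    fix k
    show "\<bar>(f x - f ((real k - real m) * \<epsilon>)) * tent \<epsilon> m k x\<bar> \<le> \<epsilon> * tent \<epsilon> m k x"
    proof (cases "tent \<epsilon> m k x = 0")
      case False
      have "\<bar>f x - f ((real k - real m) * \<epsilon>)\<bar> \<le> \<bar>x - (real k - real m) * \<epsilon>\<bar>"
        using assms(2) by (simp add: lipschitz_on_real_iff)
      also have "\<dots> \<le> \<epsilon>" by (rule tent_support[OF assms(1) False])
      finally show ?thesis
        using tent_bounds[of \<epsilon> m k x] by (simp add: abs_mult mult_right_mono)
    qed simp
  qed
  also have "\<dots> \<le> \<epsilon>"
    using t assms(1) by (simp add: sum_distrib_left[symmetric] mult_left_le)
  finally have 1: "\<bar>\<Sum>k<n. (f x - f ((real k - real m) * \<epsilon>)) * tent \<epsilon> m k x\<bar> \<le> \<epsilon>" .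
  have 2: "\<bar>f x * (1 - ?t)\<bar> \<le> 1 * (1 - ?t)"
    using assms(2) t unfolding abs_mult by (intro mult_mono) auto
  have "f x - (\<Sum>k<n. f ((real k - real m) * \<epsilon>) * tent \<epsilon> m k x)
      = f x * (1 - ?t) + (\<Sum>k<n. (f x - f ((real k - real m) * \<epsilon>)) * tent \<epsilon> m k x)"
    by (simp add: left_diff_distrib right_diff_distrib sum_subtractf sum_distrib_left)
  then have "\<bar>f x - (\<Sum>k<n. f ((real k - real m) * \<epsilon>) * tent \<epsilon> m k x)\<bar>
      \<le> \<bar>f x * (1 - ?t)\<bar> + \<bar>\<Sum>k<n. (f x - f ((real k - real m) * \<epsilon>)) * tent \<epsilon> m k x\<bar>"
    by (simp only: abs_triangle_ineq)
  also have "\<dots> \<le> 1 * (1 - ?t) + \<epsilon>"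
    by (rule add_mono[OF 2 1])
  finally show ?thesis by simp
qed

text \<open>The hypothesis speaks of one test function at a time, the conclusion of a supremum.
  Finitely many tents interpolate all of \<open>BL1\<close> simultaneously, up to the mass outside a
  long interval. That mass is small under \<open>\<nu>\<close>, and then under
  \<open>\<mu> i\<close> as well, because the covered mass is itself a sum of integrals of
  tents.\<close>

lemma tendsto_d_BL_zero:
  fixes F :: "'i filter" and \<mu> :: "'i \<Rightarrow> real measure"
  assumes \<mu>: "\<And>i. real_distribution (\<mu> i)" and \<nu>: "real_distribution \<nu>"
    and conv: "\<And>g C. (\<And>x. \<bar>g x\<bar> \<le> 1) \<Longrightarrow> (\<And>x y. \<bar>g x - g y\<bar> \<le> C * \<bar>x - y\<bar>) \<Longrightarrow> C \<ge> 0 \<Longrightarrow>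
      ((\<lambda>i. integral\<^sup>L (\<mu> i) g) \<longlongrightarrow> integral\<^sup>L \<nu> g) F"
  shows "((\<lambda>i. d_BL (\<mu> i) \<nu>) \<longlongrightarrow> 0) F"
proof (rule tendstoI)
  fix r :: real assume "r > 0"
  define \<epsilon> where "\<epsilon> = r / 8"
  have \<epsilon>: "\<epsilon> > 0" using \<open>r > 0\<close> by (simp add: \<epsilon>_def)
  interpret \<nu>: real_distribution \<nu> by fact
  \<comment> \<open>The 2m+1 nodes are -m \<epsilon>, ..., m \<epsilon>, so the sum equals 1 on the
    closed interval between the outermost nodes.\<close>
  define \<tau> where "\<tau> m x = (\<Sum>k<2*m+1. tent \<epsilon> m k x)" for m x
  have \<tau>: "\<tau> m x = ramp (x / \<epsilon> + m + 1) - ramp (x / \<epsilon> - m)" for m x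
    by (simp add: \<tau>_def sum_tent algebra_simps)
  have "(\<lambda>m. \<integral>x. \<tau> m x \<partial>\<nu>) \<longlonglongrightarrow> (\<integral>x. 1 \<partial>\<nu>)"
  proof (rule integral_dominated_convergence[where w = "\<lambda>_. 1"])
    show "AE x in \<nu>. (\<lambda>m. \<tau> m x) \<longlonglongrightarrow> 1"
    proof (rule AE_I2)
      fix x
      obtain n :: nat where n: "\<bar>x / \<epsilon>\<bar> \<le> n" using real_arch_simple by blast
      have "\<tau> m x = 1" if "m \<ge> n" for m
      proof -
        have "\<bar>x / \<epsilon>\<bar> \<le> real m" using n that by linarith
        then have "x / \<epsilon> + m + 1 \<ge> 1" "x / \<epsilon> - m \<le> 0" by linarith+
        then show ?thesis by (simp add: \<tau> ramp_def)
      qed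
      then show "(\<lambda>m. \<tau> m x) \<longlonglongrightarrow> 1"
        by (intro tendsto_eventually eventually_sequentiallyI)
    qed
    show "AE x in \<nu>. norm (\<tau> m x) \<le> 1" for m
      using ramp_bounds by (auto simp: \<tau> abs_le_iff intro!: AE_I2) (smt (verit))+
  qed (auto simp: \<tau>_def)
  then have "(\<lambda>m. \<integral>x. \<tau> m x \<partial>\<nu>) \<longlonglongrightarrow> 1" using \<nu>.prob_space by simp
  from tendstoD[OF this \<epsilon>] obtain m where m: "\<bar>(\<integral>x. \<tau> m x \<partial>\<nu>) - 1\<bar> < \<epsilon>"
    by (auto simp: eventually_sequentially dist_real_def)
  define \<Delta> where "\<Delta> i = (\<Sum>k<2*m+1. \<bar>integral\<^sup>L (\<mu> i) (tent \<epsilon> m k) - integral\<^sup>L \<nu> (tent \<epsilon> m k)\<bar>)" for i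
  have "(\<Delta> \<longlongrightarrow> (\<Sum>k<2*m+1. \<bar>integral\<^sup>L \<nu> (tent \<epsilon> m k) - integral\<^sup>L \<nu> (tent \<epsilon> m k)\<bar>)) F"
    unfolding \<Delta>_def
    using tent_bounds tent_lipschitz[OF \<epsilon>] \<epsilon>
    by (intro tendsto_intros conv[where C = "2 / \<epsilon>"]) (auto simp: abs_le_iff intro: order_trans[OF _ tent_bounds(1)])
  then have "(\<Delta> \<longlongrightarrow> 0) F" by simp
  from tendstoD[OF this \<epsilon>] show "\<forall>\<^sub>F i in F. dist (d_BL (\<mu> i) \<nu>) 0 < r"
  proof eventually_elim
    case (elim i)
    interpret \<mu>: real_distribution "\<mu> i" by fact
    have int: "integrable M' (tent \<epsilon> m k)" if "real_distribution M'" for M' k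
    proof -
      interpret real_distribution M' by fact
      show ?thesis
        using tent_bounds by (intro integrable_const_bound[where B = 1]) auto
    qed
    have \<Delta>: "\<Delta> i < \<epsilon>" using elim by (simp add: dist_real_def)
    have \<tau>1: "\<bar>(\<integral>x. \<tau> m x \<partial>\<mu> i) - (\<integral>x. \<tau> m x \<partial>\<nu>)\<bar> \<le> \<Delta> i"
    proof -
      have "(\<integral>x. \<tau> m x \<partial>\<mu> i) - (\<integral>x. \<tau> m x \<partial>\<nu>) = (\<Sum>k<2*m+1. integral\<^sup>L (\<mu> i) (tent \<epsilon> m k) - integral\<^sup>L \<nu> (tent \<epsilon> m k))"
        unfolding \<tau>_def by (simp only: Bochner_Integration.integral_sum int \<mu> \<nu> sum_subtractf)
      then show ?thesis unfolding \<Delta>_def by (simp only: sum_abs)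
    qed
    \<comment> \<open>Three \<epsilon> come from \<open>\<mu> i\<close> (interpolation, mass lost
      under \<open>\<nu>\<close>, transfer of that mass to \<open>\<mu> i\<close>), two from
      \<open>\<nu>\<close>, and one from the tents.\<close>
    have "d_BL (\<mu> i) \<nu> \<le> 6 * \<epsilon>"
    proof (rule d_BL_leI)
      fix f assume f: "f \<in> BL1"
      let ?g = "\<lambda>x. \<Sum>k<2*m+1. f ((real k - real m) * \<epsilon>) * tent \<epsilon> m k x"
      have f1: "\<bar>f x\<bar> \<le> 1" for x using f by simp
      have approx: "\<bar>integral\<^sup>L M' f - integral\<^sup>L M' ?g\<bar> \<le> \<epsilon> + (1 - (\<integral>x. \<tau> m x \<partial>M'))"
        if M': "real_distribution M'" for M'
      proof -
        interpret real_distribution M' by fact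
        have [measurable]: "f \<in> borel_measurable borel" using f by (rule borel_measurable_BL1)
        have i: "integrable M' f" using f1 by (intro integrable_const_bound[where B = 1]) auto
        have g: "integrable M' ?g" using int[OF M'] by (intro Bochner_Integration.integrable_sum integrable_mult_right)
        have t: "integrable M' (\<tau> m)" unfolding \<tau>_def using int[OF M'] by (intro Bochner_Integration.integrable_sum)
        have "\<bar>integral\<^sup>L M' f - integral\<^sup>L M' ?g\<bar> = \<bar>\<integral>x. f x - ?g x \<partial>M'\<bar>"
          by (subst Bochner_Integration.integral_diff[OF i g]) simp
        also have "\<dots> \<le> (\<integral>x. \<bar>f x - ?g x\<bar> \<partial>M')" by (rule integral_abs_bound)
        also have "\<dots> \<le> (\<integral>x. \<epsilon> + (1 - \<tau> m x) \<partial>M')"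
          unfolding \<tau>_def using i g t[unfolded \<tau>_def]
          by (intro integral_mono tent_interpolation[OF \<epsilon> f] Bochner_Integration.integrable_add
              Bochner_Integration.integrable_diff integrable_abs) auto
        also have "\<dots> = \<epsilon> + (1 - (\<integral>x. \<tau> m x \<partial>M'))"
          using t prob_space by simp
        finally show ?thesis .
      qed
      have "\<bar>integral\<^sup>L (\<mu> i) ?g - integral\<^sup>L \<nu> ?g\<bar> \<le> \<Delta> i"
      proof -
        have "integral\<^sup>L (\<mu> i) ?g - integral\<^sup>L \<nu> ?g = (\<Sum>k<2*m+1. f ((real k - real m) * \<epsilon>) * (integral\<^sup>L (\<mu> i) (tent \<epsilon> m k) - integral\<^sup>L \<nu> (tent \<epsilon> m k)))"
          using int[OF \<mu>] int[OF \<nu>] by (simp add: Bochner_Integration.integral_sum right_diff_distrib sum_subtractf del: sum.lessThan_Suc)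
        also have "\<bar>\<dots>\<bar> \<le> \<Delta> i"
          unfolding \<Delta>_def
        proof (rule order_trans[OF sum_abs], rule sum_mono)
          fix k
          show "\<bar>f ((real k - real m) * \<epsilon>) * (integral\<^sup>L (\<mu> i) (tent \<epsilon> m k) - integral\<^sup>L \<nu> (tent \<epsilon> m k))\<bar>
            \<le> \<bar>integral\<^sup>L (\<mu> i) (tent \<epsilon> m k) - integral\<^sup>L \<nu> (tent \<epsilon> m k)\<bar>"
            unfolding abs_mult by (rule mult_left_le_one_le) (auto simp: f1)
        qed
        finally show ?thesis .
      qed
      then show "\<bar>integral\<^sup>L (\<mu> i) f - integral\<^sup>L \<nu> f\<bar> \<le> 6 * \<epsilon>"
        using approx[OF \<mu>, of i] approx[OF \<nu>] \<Delta> \<tau>1 m by linarith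
    qed
    moreover have "d_BL (\<mu> i) \<nu> \<ge> 0"
      by (rule d_BL_nonneg) (simp_all add: \<mu>.prob_space_axioms \<nu>.prob_space_axioms)
    ultimately show ?case using \<open>r > 0\<close> by (simp add: dist_real_def \<epsilon>_def)
  qed
qed

section \<open>Characteristic functions of frequency deviations\<close>

definition cov_form :: "'z set \<Rightarrow> 'z measure \<Rightarrow> ('z \<Rightarrow> real) \<Rightarrow> real" where
  "cov_form S Q a = (\<Sum>z\<in>S. \<Sum>z'\<in>S. a z * multinomial_cov Q z z' * a z')"

definition freq_dev :: "nat \<Rightarrow> (nat \<Rightarrow> 'z) \<Rightarrow> 'z measure \<Rightarrow> 'z \<Rightarrow> real" where
  "freq_dev n d Q z = sqrt (real n) * (emp_mean n d (indicator {z}) - measure Q {z})"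

text \<open>Zero outside \<open>S\<close>, so that no almost-sure restriction of the draws to \<open>S\<close> is needed.\<close>

definition finite_comb :: "'z set \<Rightarrow> ('z \<Rightarrow> real) \<Rightarrow> 'z \<Rightarrow> real" where
  "finite_comb S a x = (\<Sum>z\<in>S. a z * indicator {z} x)"

lemma exp_minus_taylor:
  fixes s :: real
  assumes "s \<ge> 0"
  shows "\<bar>exp (- s) - (1 - s)\<bar> \<le> s\<^sup>2 / 2"
proof -
  have 1: "1 - t \<le> exp (- t)" for t :: real
    using exp_ge_add_one_self[of "-t"] by simp
  have "(\<lambda>t. 1 - t + t\<^sup>2 / 2 - exp (- t)) 0 \<le> (\<lambda>t. 1 - t + t\<^sup>2 / 2 - exp (- t)) s"
  proof (rule DERIV_nonneg_imp_nondecreasing[OF assms])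
    fix t :: real
    show "\<exists>y. ((\<lambda>t. 1 - t + t\<^sup>2 / 2 - exp (- t)) has_real_derivative y) (at t) \<and> 0 \<le> y"
      using 1[of t] by (intro exI[of _ "- 1 + t + exp (- t)"]) (auto intro!: derivative_eq_intros)
  qed
  then show ?thesis using 1[of s] by simp
qed

lemma cov_form_eq:
  assumes "finite S"
  shows "cov_form S Q a = (\<Sum>z\<in>S. (a z)\<^sup>2 * measure Q {z}) - (\<Sum>z\<in>S. a z * measure Q {z})\<^sup>2"
proof -
  have "cov_form S Q a = (\<Sum>z\<in>S. \<Sum>z'\<in>S. (if z = z' then a z * measure Q {z} * a z' else 0)
      - (a z * measure Q {z}) * (a z' * measure Q {z'}))"
    unfolding cov_form_def multinomial_cov_def by (intro sum.cong refl) (auto simp: algebra_simps)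
  also have "\<dots> = (\<Sum>z\<in>S. a z * measure Q {z} * a z) - (\<Sum>z\<in>S. a z * measure Q {z}) * (\<Sum>z\<in>S. a z * measure Q {z})"
    using assms by (simp add: sum_subtractf sum_product)
  finally show ?thesis by (simp add: power2_eq_square mult_ac)
qed

text \<open>Only an inclusion relates \<open>S\<close> to the space: the law of the data lives on
  \<open>S\<close>, while the resampling law is a pmf on the whole type. Both are instances, which
  is what lets one limit theorem serve both.\<close>

locale finite_support =
  fixes S :: "'z set" and Q :: "'z measure"
  assumes finite_S: "finite S" and S_subset: "S \<subseteq> space Q"
    and prob_Q: "prob_space Q" and sets_Q: "sets Q = Pow (space Q)"
begin

sublocale Q: prob_space Q by (rule prob_Q)

lemma measurable_Q: "f \<in> borel_measurable Q"
  by (rule measurableI) (auto simp: sets_Q)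

lemma integrable_bounded:
  fixes f :: "'z \<Rightarrow> real"
  assumes "\<And>x. \<bar>f x\<bar> \<le> B"
  shows "integrable Q f"
  using assms measurable_Q by (intro Q.integrable_const_bound[where B = B]) auto

lemma finite_comb_bound: "\<bar>finite_comb S a x\<bar> \<le> (\<Sum>z\<in>S. \<bar>a z\<bar>)"
  unfolding finite_comb_def
  by (rule order_trans[OF sum_abs], rule sum_mono) (simp add: abs_mult indicator_def)

lemma finite_comb_square: "(finite_comb S a x)\<^sup>2 = finite_comb S (\<lambda>z. (a z)\<^sup>2) x"
proof -
  have "finite_comb S b x = (if x \<in> S then b x else 0)" for b
    unfolding finite_comb_def using finite_S
    by (simp add: indicator_def if_distrib[of "(*) _"] cong: if_cong)
  then show ?thesis by simp
qed

lemma integral_finite_comb: "(\<integral>x. finite_comb S a x \<partial>Q) = (\<Sum>z\<in>S. a z * measure Q {z})"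
proof -
  have *: "{z} \<in> sets Q" if "z \<in> S" for z using that S_subset by (auto simp: sets_Q)
  have "(\<integral>x. finite_comb S a x \<partial>Q) = (\<Sum>z\<in>S. \<integral>x. a z * indicator {z} x \<partial>Q)"
    unfolding finite_comb_def using *
    by (intro Bochner_Integration.integral_sum) (auto intro!: integrable_mult_right simp: Q.emeasure_eq_measure)
  also have "\<dots> = (\<Sum>z\<in>S. a z * measure Q {z})"
    using * by (intro sum.cong) (auto simp: sets.sets_into_space Int_absorb1)
  finally show ?thesis .
qed

definition cdev :: "('z \<Rightarrow> real) \<Rightarrow> 'z \<Rightarrow> real" where
  "cdev a x = finite_comb S a x - (\<Sum>z\<in>S. a z * measure Q {z})"

lemma cdev_bound: "\<bar>cdev a x\<bar> \<le> 2 * (\<Sum>z\<in>S. \<bar>a z\<bar>)"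
proof -
  have "\<bar>\<Sum>z\<in>S. a z * measure Q {z}\<bar> \<le> (\<Sum>z\<in>S. \<bar>a z\<bar>)"
    by (rule order_trans[OF sum_abs], rule sum_mono) (simp add: abs_mult mult_left_le)
  then show ?thesis using finite_comb_bound[of a x] unfolding cdev_def by linarith
qed

lemma integral_cdev: "(\<integral>x. cdev a x \<partial>Q) = 0"
  unfolding cdev_def using Q.prob_space
  by (subst Bochner_Integration.integral_diff)
     (auto simp: integral_finite_comb intro!: integrable_bounded[OF finite_comb_bound])

lemma integral_cdev_square: "(\<integral>x. (cdev a x)\<^sup>2 \<partial>Q) = cov_form S Q a"
proof -
  let ?m = "\<Sum>z\<in>S. a z * measure Q {z}"
  have i: "integrable Q (finite_comb S b)" for b
    by (rule integrable_bounded[OF finite_comb_bound])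
  have "(\<integral>x. (cdev a x)\<^sup>2 \<partial>Q) = (\<integral>x. finite_comb S (\<lambda>z. (a z)\<^sup>2) x + ?m\<^sup>2 - 2 * ?m * finite_comb S a x \<partial>Q)"
    by (intro Bochner_Integration.integral_cong refl)
       (simp add: cdev_def power2_diff finite_comb_square)
  also have "\<dots> = (\<Sum>z\<in>S. (a z)\<^sup>2 * measure Q {z}) + ?m\<^sup>2 - 2 * ?m * ?m"
    using i Q.prob_space by (simp add: integral_finite_comb)
  finally show ?thesis by (simp add: cov_form_eq[OF finite_S] power2_eq_square)
qed

lemma cov_form_nonneg: "cov_form S Q a \<ge> 0"
  unfolding integral_cdev_square[symmetric] by (rule integral_nonneg_AE) auto

lemma cov_form_le: "cov_form S Q a \<le> (2 * (\<Sum>z\<in>S. \<bar>a z\<bar>))\<^sup>2"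
proof -
  have b: "(cdev a x)\<^sup>2 \<le> (2 * (\<Sum>z\<in>S. \<bar>a z\<bar>))\<^sup>2" for x
    using power_mono[OF cdev_bound, of a x 2] by simp
  have "(\<integral>x. (cdev a x)\<^sup>2 \<partial>Q) \<le> (\<integral>x. (2 * (\<Sum>z\<in>S. \<bar>a z\<bar>))\<^sup>2 \<partial>Q)"
    using b by (intro integral_mono integrable_bounded) auto
  then show ?thesis using Q.prob_space by (simp add: integral_cdev_square)
qed

text \<open>Reduces every linear combination of frequency deviations to a normalized sum of centred
  bounded variables, the form needed for the one-dimensional estimate. At n = 0 both sides are
  zero.\<close>

lemma sum_freq_dev:
  "(\<Sum>z\<in>S. a z * freq_dev n x Q z) = (\<Sum>i<n. cdev a (x i) / sqrt (real n))"
proof (cases "n = 0")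
  case False
  have "(\<Sum>z\<in>S. a z * freq_dev n x Q z)
      = sqrt (real n) * ((\<Sum>z\<in>S. a z * ((\<Sum>i<n. indicator {z} (x i)) / real n)) - (\<Sum>z\<in>S. a z * measure Q {z}))"
    by (simp add: freq_dev_def emp_mean_def sum_distrib_left sum_subtractf algebra_simps)
  also have "(\<Sum>z\<in>S. a z * ((\<Sum>i<n. indicator {z} (x i)) / real n)) = (\<Sum>i<n. finite_comb S a (x i)) / real n"
    unfolding finite_comb_def by (subst sum.swap) (simp only: sum_distrib_left sum_divide_distrib times_divide_eq_right)
  also have "(\<Sum>i<n. finite_comb S a (x i)) / real n - (\<Sum>z\<in>S. a z * measure Q {z}) = (\<Sum>i<n. cdev a (x i)) / real n"
    using False by (simp add: cdev_def sum_subtractf diff_divide_distrib)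
  also have "sqrt (real n) * ((\<Sum>i<n. cdev a (x i)) / real n) = (\<Sum>i<n. cdev a (x i)) / sqrt (real n)"
    using False by (simp add: real_div_sqrt field_simps)
  finally show ?thesis by (simp add: sum_divide_distrib)
qed (simp add: freq_dev_def)

section \<open>Independent draws: rate for the characteristic function, bound for the second
  moment\<close>

context
  fixes P :: "'w measure" and X :: "nat \<Rightarrow> 'w \<Rightarrow> 'z" and n :: nat
  assumes prob_P: "prob_space P" and indep: "prob_space.indep_vars P (\<lambda>_. Q) X {..<n}"
    and distr: "\<And>i. i < n \<Longrightarrow> distr P Q (X i) = Q"
begin

interpretation P: prob_space P by (rule prob_P)

lemma measurable_X: "i < n \<Longrightarrow> X i \<in> measurable P Q"
  using indep by (auto simp: P.indep_vars_def)

lemma indep_scaled: "P.indep_vars (\<lambda>_. borel) (\<lambda>i \<omega>. cdev a (X i \<omega>) / c) {..<n}"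
  by (rule P.indep_vars_compose2[OF indep]) (rule measurable_Q)

lemma integral_X:
  fixes f :: "'z \<Rightarrow> 'c :: {banach, second_countable_topology}"
  assumes "i < n" "f \<in> borel_measurable Q"
  shows "(\<integral>\<omega>. f (X i \<omega>) \<partial>P) = integral\<^sup>L Q f"
  using integral_distr[OF measurable_X[OF assms(1)] assms(2)] distr[OF assms(1)] by simp

lemma borel_measurable_freq_dev: "(\<lambda>\<omega>. freq_dev n (\<lambda>i. X i \<omega>) Q z) \<in> borel_measurable P"
proof -
  have "(\<lambda>\<omega>. indicator {z} (X i \<omega>) :: real) \<in> borel_measurable P" if "i < n" for i
    using measurable_X[OF that] measurable_Q by (rule measurable_compose)
  then show ?thesis
    unfolding freq_dev_def emp_mean_def
    by (intro borel_measurable_times borel_measurable_diff borel_measurable_divide borel_measurable_sum) auto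
qed

text \<open>The bound involves \<open>a\<close> and \<open>S\<close> but not \<open>Q\<close>,
  because \<bar>\<open>cdev a\<close>\<bar> \<le> B for every law; this uniformity is what later
  allows the law to vary. The term B^3/6 is the third-order Taylor remainder of the characteristic
  function of one draw, and B^4/8 is the cost of replacing 1 - s by exp(-s).\<close>

lemma freq_dev_char:
  fixes a :: "'z \<Rightarrow> real"
  assumes "n \<ge> 1"
  defines "B \<equiv> 2 * (\<Sum>z\<in>S. \<bar>a z\<bar>)"
  shows "cmod ((\<integral>\<omega>. iexp (\<Sum>z\<in>S. a z * freq_dev n (\<lambda>i. X i \<omega>) Q z) \<partial>P) - exp (- cov_form S Q a / 2))
    \<le> (B ^ 3 / 6 + B ^ 4 / 8) / sqrt (real n)"
proof -
  let ?\<nu> = "distr Q borel (cdev a)"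
  interpret \<nu>: real_distribution ?\<nu>
    by (rule Q.real_distribution_distr) (rule measurable_Q)
  define t where "t = 1 / sqrt (real n)"
  have t: "t > 0" using assms(1) by (simp add: t_def)
  have t2: "t\<^sup>2 = 1 / real n" by (simp add: t_def power_divide)
  have B: "B \<ge> 0" by (simp add: B_def sum_nonneg)
  let ?\<sigma> = "cov_form S Q a"
  have "(\<integral>\<omega>. iexp (\<Sum>z\<in>S. a z * freq_dev n (\<lambda>i. X i \<omega>) Q z) \<partial>P)
      = char (distr P borel (\<lambda>\<omega>. \<Sum>i<n. cdev a (X i \<omega>) / sqrt (real n))) 1"
    unfolding char_def sum_freq_dev
  proof (subst integral_distr)
    show "(\<lambda>\<omega>. \<Sum>i<n. cdev a (X i \<omega>) / sqrt (real n)) \<in> borel_measurable P"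
      using measurable_compose[OF measurable_X measurable_Q]
      by (intro borel_measurable_sum borel_measurable_divide) auto
  qed simp_all
  also have "\<dots> = (\<Prod>i<n. char (distr P borel (\<lambda>\<omega>. cdev a (X i \<omega>) / sqrt (real n))) 1)"
    by (rule P.char_distr_sum) (rule indep_scaled)
  also have "\<dots> = (\<Prod>i<n. char ?\<nu> t)"
  proof (intro prod.cong refl)
    fix i assume "i \<in> {..<n}"
    then have i: "i < n" by simp
    have "char (distr P borel (\<lambda>\<omega>. cdev a (X i \<omega>) / sqrt (real n))) 1 = (\<integral>\<omega>. iexp (t * cdev a (X i \<omega>)) \<partial>P)"
      unfolding char_def
      by (subst integral_distr) (auto simp: t_def intro!: borel_measurable_divide measurable_compose[OF measurable_X[OF i] measurable_Q])
    also have "\<dots> = (\<integral>x. iexp (t * cdev a x) \<partial>Q)"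
      by (rule integral_X[OF i]) (intro borel_measurable_times measurable_compose[OF measurable_Q] borel_measurable_exp; auto intro: measurable_compose[OF measurable_Q])
    also have "\<dots> = char ?\<nu> t"
      unfolding char_def by (subst integral_distr) (auto simp: measurable_Q)
    finally show "char (distr P borel (\<lambda>\<omega>. cdev a (X i \<omega>) / sqrt (real n))) 1 = char ?\<nu> t" .
  qed
  finally have lhs: "(\<integral>\<omega>. iexp (\<Sum>z\<in>S. a z * freq_dev n (\<lambda>i. X i \<omega>) Q z) \<partial>P) = char ?\<nu> t ^ n"
    by simp
  define s where "s = t\<^sup>2 * ?\<sigma> / 2"
  have s: "s \<ge> 0" using cov_form_nonneg by (simp add: s_def)
  have ns: "real n * s = ?\<sigma> / 2" using assms(1) by (simp add: s_def t2)
  have b2: "(cdev a x)\<^sup>2 \<le> B\<^sup>2" and b3: "\<bar>cdev a x\<bar> ^ 3 \<le> B ^ 3" for x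
    using power_mono[OF cdev_bound, of a x 2] power_mono[OF cdev_bound, of a x 3] unfolding B_def by simp_all
  have "cmod (char ?\<nu> t - (1 - t\<^sup>2 * ?\<sigma> / 2)) \<le> t\<^sup>2 / 6 * (\<integral>x. min (6 * (cdev a x)\<^sup>2) (\<bar>t\<bar> * \<bar>cdev a x\<bar> ^ 3) \<partial>Q)"
  proof (rule Q.char_approx3')
    show "integrable Q (cdev a)" by (rule integrable_bounded[OF cdev_bound])
    show "integrable Q (\<lambda>x. (cdev a x)\<^sup>2)" using b2 by (intro integrable_bounded) auto
  qed (auto simp: measurable_Q integral_cdev integral_cdev_square)
  also have "\<dots> \<le> t\<^sup>2 / 6 * (\<integral>x. t * B ^ 3 \<partial>Q)"
  proof (intro mult_left_mono integral_mono)
    show "integrable Q (\<lambda>x. min (6 * (cdev a x)\<^sup>2) (\<bar>t\<bar> * \<bar>cdev a x\<bar> ^ 3))"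
    proof (rule integrable_bounded)
      fix x
      have "0 \<le> min (6 * (cdev a x)\<^sup>2) (\<bar>t\<bar> * \<bar>cdev a x\<bar> ^ 3)" by simp
      moreover have "min (6 * (cdev a x)\<^sup>2) (\<bar>t\<bar> * \<bar>cdev a x\<bar> ^ 3) \<le> 6 * B\<^sup>2"
        using b2[of x] by (simp add: min_le_iff_disj)
      ultimately show "\<bar>min (6 * (cdev a x)\<^sup>2) (\<bar>t\<bar> * \<bar>cdev a x\<bar> ^ 3)\<bar> \<le> 6 * B\<^sup>2" by simp
    qed
    fix x
    have "\<bar>t\<bar> * \<bar>cdev a x\<bar> ^ 3 \<le> t * B ^ 3"
      using b3[of x] t by (simp add: mult_left_mono)
    then show "min (6 * (cdev a x)\<^sup>2) (\<bar>t\<bar> * \<bar>cdev a x\<bar> ^ 3) \<le> t * B ^ 3"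
      by (simp add: min_le_iff_disj)
  qed auto
  also have "\<dots> = t\<^sup>2 * t * (B ^ 3 / 6)" using Q.prob_space by simp
  finally have 1: "cmod (char ?\<nu> t - complex_of_real (1 - s)) \<le> t\<^sup>2 * t * (B ^ 3 / 6)"
    by (simp add: s_def)
  have 2: "cmod (complex_of_real (1 - s) - complex_of_real (exp (- s))) \<le> s\<^sup>2 / 2"
    using exp_minus_taylor[OF s] unfolding of_real_diff[symmetric] norm_of_real by (simp add: abs_minus_commute)
  \<comment> \<open>Both bases lie in the closed unit disc, so the powers differ by at most
    \<open>n\<close> times the difference of the bases. The factor \<open>n\<close> is paid for by n
    t^2 = 1.\<close>
  have "cmod (char ?\<nu> t ^ n - complex_of_real (exp (- s)) ^ n) \<le> n * cmod (char ?\<nu> t - complex_of_real (exp (- s)))"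
    using s by (intro norm_power_diff \<nu>.cmod_char_le_1) simp
  also have "\<dots> \<le> n * (t\<^sup>2 * t * (B ^ 3 / 6) + s\<^sup>2 / 2)"
    using norm_triangle_ineq[of "char ?\<nu> t - complex_of_real (1 - s)" "complex_of_real (1 - s) - complex_of_real (exp (- s))"] 1 2
    by (intro mult_left_mono) auto
  also have "\<dots> = (B ^ 3 / 6) * t + (n * s) * s / 2"
  proof -
    have nt: "real n * t\<^sup>2 = 1" using assms(1) by (simp add: t2)
    have "n * (t\<^sup>2 * t * (B ^ 3 / 6) + s\<^sup>2 / 2) = (real n * t\<^sup>2) * ((B ^ 3 / 6) * t) + (n * s) * s / 2"
      by (simp add: power2_eq_square algebra_simps)
    then show ?thesis unfolding nt by simp
  qed
  also have "(n * s) * s / 2 \<le> (B ^ 4 / 8) * t"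
  proof -
    have \<sigma>: "?\<sigma> \<le> B\<^sup>2" "0 \<le> ?\<sigma>" using cov_form_le cov_form_nonneg by (auto simp: B_def)
    \<comment> \<open>The quantity \<open>s\<close> is of order t^2; weakening this to order
      \<open>t\<close> gives both errors the common factor 1/sqrt n.\<close>
    have "t \<le> 1" using assms(1) by (simp add: t_def)
    then have "t\<^sup>2 \<le> t" using t by (simp add: power2_eq_square mult_left_le)
    then have "s \<le> t * (B\<^sup>2 / 2)"
      unfolding s_def using \<sigma> t by (auto intro!: mult_mono)
    then have "(n * s) * s / 2 \<le> (B\<^sup>2 / 2) * (t * (B\<^sup>2 / 2)) / 2"
      unfolding ns using \<sigma> s by (intro divide_right_mono mult_mono) auto
    then show ?thesis by (simp add: power2_eq_square eval_nat_numeral mult_ac)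
  qed
  finally have "cmod (char ?\<nu> t ^ n - complex_of_real (exp (- s)) ^ n) \<le> (B ^ 3 / 6) * t + (B ^ 4 / 8) * t"
    by simp
  moreover have "complex_of_real (exp (- s)) ^ n = exp (- ?\<sigma> / 2)"
    using ns by (simp add: exp_of_nat_mult[symmetric] of_real_exp[symmetric] flip: of_real_power)
  ultimately show ?thesis
    unfolding lhs by (simp add: t_def add_divide_distrib)
qed

text \<open>For the indicator of \<open>z\<close> the centred variable is bounded by 2, so its
  second moment is at most 4, and independence carries this to the normalized sum. The constant
  depends neither on \<open>n\<close> nor on \<open>Q\<close>.\<close>

lemma freq_dev_moment:
  assumes "z \<in> S"
  shows "integrable P (\<lambda>\<omega>. (freq_dev n (\<lambda>i. X i \<omega>) Q z)\<^sup>2)"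
    and "(\<integral>\<omega>. (freq_dev n (\<lambda>i. X i \<omega>) Q z)\<^sup>2 \<partial>P) \<le> 4"
proof -
  define a :: "'z \<Rightarrow> real" where "a = indicator {z}"
  have A: "(\<Sum>z'\<in>S. \<bar>a z'\<bar>) = 1" using assms finite_S by (simp add: a_def indicator_def)
  have "freq_dev n x Q z = (\<Sum>z'\<in>S. a z' * freq_dev n x Q z')" for x
    using assms finite_S by (simp add: a_def indicator_def if_distrib[of "\<lambda>u. u * _"] cong: if_cong)
  then have eq: "freq_dev n x Q z = (\<Sum>i<n. cdev a (x i) / sqrt (real n))" for x
    by (simp only: sum_freq_dev)
  have b: "\<bar>cdev a x / sqrt (real n)\<bar> \<le> 2 / sqrt (real n)" for x
    using cdev_bound[of a x] by (simp add: A divide_right_mono)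
  have b2: "(cdev a x / sqrt (real n))\<^sup>2 \<le> 4 / real n" for x
    using power_mono[OF b, of x 2] by (simp add: power_divide)
  have m: "(\<lambda>\<omega>. cdev a (X i \<omega>)) \<in> borel_measurable P" if "i < n" for i
    by (rule measurable_compose[OF measurable_X[OF that] measurable_Q])
  have int: "integrable P (\<lambda>\<omega>. cdev a (X i \<omega>) / sqrt (real n))"
       "integrable P (\<lambda>\<omega>. (cdev a (X i \<omega>) / sqrt (real n))\<^sup>2)" if "i < n" for i
  proof -
    show "integrable P (\<lambda>\<omega>. cdev a (X i \<omega>) / sqrt (real n))"
      using b m[OF that] by (intro P.integrable_const_bound[where B = "2 / sqrt (real n)"]) auto
    show "integrable P (\<lambda>\<omega>. (cdev a (X i \<omega>) / sqrt (real n))\<^sup>2)"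
      using b2 m[OF that] by (intro P.integrable_const_bound[where B = "4 / real n"]) auto
  qed
  have mean: "(\<integral>\<omega>. cdev a (X i \<omega>) / sqrt (real n) \<partial>P) = 0" if "i < n" for i
    using integral_X[OF that measurable_Q, of "cdev a"] by (simp add: integral_cdev)
  note * = indep_sum_square[OF prob_P indep_scaled int mean]
  show "integrable P (\<lambda>\<omega>. (freq_dev n (\<lambda>i. X i \<omega>) Q z)\<^sup>2)"
    unfolding eq by (rule *(1))
  have "(\<integral>\<omega>. (freq_dev n (\<lambda>i. X i \<omega>) Q z)\<^sup>2 \<partial>P) = (\<Sum>i<n. \<integral>\<omega>. (cdev a (X i \<omega>) / sqrt (real n))\<^sup>2 \<partial>P)"
    unfolding eq by (rule *(2))
  also have "\<dots> \<le> (\<Sum>i<n. \<integral>\<omega>. 4 / real n \<partial>P)"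
    using b2 int by (intro sum_mono integral_mono) auto
  also have "\<dots> \<le> 4" using P.prob_space by simp
  finally show "(\<integral>\<omega>. (freq_dev n (\<lambda>i. X i \<omega>) Q z)\<^sup>2 \<partial>P) \<le> 4" .
qed

end

end

section \<open>Characteristic function and second moment of univariate normal laws\<close>

text \<open>As a scaled standard normal the degenerate law is no exception: scaling by zero yields
  the point mass at zero. Later facts about normal laws then need no case distinction.\<close>

lemma normal_law_eq_distr:
  assumes "v \<ge> 0"
  shows "normal_law 0 v = distr std_normal_distribution borel (\<lambda>x. sqrt v * x)"
proof (cases "v = 0")
  case True
  interpret real_distribution std_normal_distribution by (rule real_dist_normal_dist)
  have "distr std_normal_distribution borel (\<lambda>x. 0) = return borel (0::real)"
    by (rule distr_const) simp
  then show ?thesis using True by (simp add: normal_law_def)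
next
  case False
  then have v: "sqrt v > 0" using assms by simp
  interpret real_distribution std_normal_distribution by (rule real_dist_normal_dist)
  have "distributed std_normal_distribution lborel (\<lambda>x. x) std_normal_density"
    by (auto simp: distributed_def distr_id2)
  from normal_density_affine[OF this, of "sqrt v" 0] v
  have "distributed std_normal_distribution lborel (\<lambda>x. sqrt v * x) (normal_density 0 (sqrt v))" by simp
  then have "distr std_normal_distribution lborel (\<lambda>x. sqrt v * x) = density lborel (normal_density 0 (sqrt v))"
    by (rule distributed_distr_eq_density)
  moreover have "distr std_normal_distribution lborel (\<lambda>x. sqrt v * x) = distr std_normal_distribution borel (\<lambda>x. sqrt v * x)"
    by (rule distr_cong) auto
  ultimately show ?thesis using False by (simp add: normal_law_def)
qed

lemma char_normal_law:
  assumes "v \<ge> 0"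
  shows "(\<integral>x. iexp x \<partial>normal_law 0 v) = exp (- v / 2)"
proof -
  have "(\<integral>x. iexp x \<partial>normal_law 0 v) = char std_normal_distribution (sqrt v)"
    unfolding char_def normal_law_eq_distr[OF assms] by (subst integral_distr) auto
  then show ?thesis using assms by (simp add: char_std_normal_distribution of_real_exp of_real_power[symmetric] del: of_real_power)
qed

lemma normal_law_moment:
  assumes "v \<ge> 0"
  shows "integrable (normal_law 0 v) (\<lambda>x. x\<^sup>2)" "(\<integral>x. x\<^sup>2 \<partial>normal_law 0 v) = v"
proof -
  have 2: "(\<integral>x. x\<^sup>2 \<partial>std_normal_distribution) = 1"
    using std_normal_distribution_even_moments[of 1] by (simp add: eval_nat_numeral)
  have 3: "integrable std_normal_distribution (\<lambda>x. x\<^sup>2)"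
    by (rule integrable_std_normal_distribution_moment)
  show "integrable (normal_law 0 v) (\<lambda>x. x\<^sup>2)" 
    unfolding normal_law_eq_distr[OF assms]
    by (subst integrable_distr_eq) (use 3 in \<open>auto simp: power_mult_distrib\<close>)
  show "(\<integral>x. x\<^sup>2 \<partial>normal_law 0 v) = v"
    unfolding normal_law_eq_distr[OF assms]
    by (subst integral_distr) (use 2 assms in \<open>auto simp: power_mult_distrib\<close>)
qed

section \<open>Penalized suprema and the contact set\<close>

definition lin :: "'z set \<Rightarrow> ('z \<Rightarrow> real) \<Rightarrow> ('z \<Rightarrow> real) \<Rightarrow> real" where
  "lin S v \<phi> = (\<Sum>z\<in>S. \<phi> z * v z)"

definition l1 :: "'z set \<Rightarrow> ('z \<Rightarrow> real) \<Rightarrow> real" where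
  "l1 S v = (\<Sum>z\<in>S. \<bar>v z\<bar>)"

lemma l1_nonneg: "l1 S v \<ge> 0"
  by (simp add: l1_def sum_nonneg)

lemma cSUP_affine:
  fixes f :: "'a \<Rightarrow> real"
  assumes "A \<noteq> {}" "bdd_above (f ` A)" "a \<ge> 0"
  shows "(SUP x\<in>A. a * f x + b) = a * (SUP x\<in>A. f x) + b"
proof (rule antisym)
  have up: "a * f x + b \<le> a * (SUP x\<in>A. f x) + b" if "x \<in> A" for x
    using cSUP_upper[OF that assms(2)] assms(3) by (simp add: mult_left_mono)
  then show "(SUP x\<in>A. a * f x + b) \<le> a * (SUP x\<in>A. f x) + b"
    by (intro cSUP_least assms(1))
  have bdd: "bdd_above ((\<lambda>x. a * f x + b) ` A)"
    by (rule bdd_aboveI2) (rule up)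
  show "a * (SUP x\<in>A. f x) + b \<le> (SUP x\<in>A. a * f x + b)"
  proof (cases "a = 0")
    case False
    then have a: "a > 0" using assms(3) by simp
    have "f x \<le> ((SUP x\<in>A. a * f x + b) - b) / a" if "x \<in> A" for x
      using cSUP_upper[OF that bdd] a by (simp add: field_simps)
    then have "(SUP x\<in>A. f x) \<le> ((SUP x\<in>A. a * f x + b) - b) / a"
      by (intro cSUP_least assms(1))
    then show ?thesis using a by (simp add: field_simps)
  qed (use assms(1) in simp)
qed

lemma cSUP_diff_le:
  fixes f g :: "'a \<Rightarrow> real"
  assumes "A \<noteq> {}" "bdd_above (g ` A)" "\<And>x. x \<in> A \<Longrightarrow> f x \<le> g x + \<delta>"
  shows "(SUP x\<in>A. f x) \<le> (SUP x\<in>A. g x) + \<delta>"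
proof (rule cSUP_least[OF assms(1)])
  fix x assume "x \<in> A"
  then show "f x \<le> (SUP x\<in>A. g x) + \<delta>"
    using assms(3)[of x] cSUP_upper[OF _ assms(2), of x] by simp
qed

text \<open>\<open>e\<close> stands for the population criterion. All that is kept of the model is a
  Lipschitz bound on the cube: it gives continuity, hence an attained maximum \<open>T\<close> and a
  nonempty contact set \<open>K\<close>.\<close>

locale contact_problem =
  fixes S :: "'z set" and e :: "('z \<Rightarrow> real) \<Rightarrow> real" and C :: real
  assumes finite_S: "finite S"
    and e_lipschitz: "\<And>\<phi> \<psi>. \<phi> \<in> S \<rightarrow>\<^sub>E {0..1} \<Longrightarrow> \<psi> \<in> S \<rightarrow>\<^sub>E {0..1} \<Longrightarrow>
      \<bar>e \<phi> - e \<psi>\<bar> \<le> C * l1 S (\<lambda>z. \<phi> z - \<psi> z)"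
begin

abbreviation \<Phi> :: "('z \<Rightarrow> real) set" where "\<Phi> \<equiv> S \<rightarrow>\<^sub>E {0..1}"

definition T :: real where "T = (SUP \<phi>\<in>\<Phi>. e \<phi>)"

definition K :: "('z \<Rightarrow> real) set" where "K = {\<phi> \<in> \<Phi>. e \<phi> = T}"

definition penalized :: "real \<Rightarrow> ('z \<Rightarrow> real) \<Rightarrow> real" where
  "penalized \<kappa> v = (SUP \<phi>\<in>\<Phi>. lin S v \<phi> + \<kappa> * (e \<phi> - T))"

definition contact_sup :: "('z \<Rightarrow> real) \<Rightarrow> real" where
  "contact_sup v = (SUP \<phi>\<in>K. lin S v \<phi>)"

lemma compact_\<Phi>: "compact \<Phi>"
  by (rule compact_PiE_real) auto

lemma \<Phi>_nonempty: "\<Phi> \<noteq> {}"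
  by (auto simp: PiE_eq_empty_iff)

lemma \<Phi>_bounds: "\<phi> \<in> \<Phi> \<Longrightarrow> z \<in> S \<Longrightarrow> 0 \<le> \<phi> z \<and> \<phi> z \<le> 1"
  by (auto dest: PiE_mem)

lemma continuous_l1_diff: "continuous_on A (\<lambda>\<phi>. l1 S (\<lambda>z. \<phi> z - \<psi> z))"
  unfolding l1_def
  by (intro continuous_intros continuous_on_subset[OF continuous_on_product_coordinates subset_UNIV])

lemma continuous_e: "continuous_on \<Phi> e"
  unfolding continuous_on_def
proof (intro ballI)
  fix \<psi> assume \<psi>: "\<psi> \<in> \<Phi>"
  have "((\<lambda>\<phi>. C * l1 S (\<lambda>z. \<phi> z - \<psi> z)) \<longlongrightarrow> C * l1 S (\<lambda>z. \<psi> z - \<psi> z)) (at \<psi> within \<Phi>)"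
    using continuous_l1_diff[of \<Phi> \<psi>] \<psi> by (intro tendsto_mult_left) (auto simp: continuous_on_def)
  then have lim: "((\<lambda>\<phi>. C * l1 S (\<lambda>z. \<phi> z - \<psi> z)) \<longlongrightarrow> 0) (at \<psi> within \<Phi>)"
    by (simp add: l1_def)
  have "((\<lambda>\<phi>. e \<phi> - e \<psi>) \<longlongrightarrow> 0) (at \<psi> within \<Phi>)"
    by (rule Lim_null_comparison[OF _ lim])
       (use e_lipschitz \<psi> in \<open>auto simp: eventually_at_filter\<close>)
  then show "(e \<longlongrightarrow> e \<psi>) (at \<psi> within \<Phi>)" by (rule LIM_zero_cancel)
qed

lemma bdd_above_e: "bdd_above (e ` \<Phi>)"
  using compact_imp_bounded[OF compact_continuous_image[OF continuous_e compact_\<Phi>]]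
  by (rule bounded_imp_bdd_above)

lemma e_le_T: "\<phi> \<in> \<Phi> \<Longrightarrow> e \<phi> \<le> T"
  unfolding T_def by (rule cSUP_upper[OF _ bdd_above_e])

lemma K_nonempty: "K \<noteq> {}"
proof -
  obtain \<phi> where \<phi>: "\<phi> \<in> \<Phi>" "\<forall>\<psi>\<in>\<Phi>. e \<psi> \<le> e \<phi>"
    using continuous_attains_sup[OF compact_\<Phi> \<Phi>_nonempty continuous_e] by auto
  then have "T \<le> e \<phi>" unfolding T_def by (intro cSUP_least \<Phi>_nonempty) auto
  then show ?thesis using e_le_T[OF \<phi>(1)] \<phi>(1) by (auto simp: K_def intro: antisym)
qed

lemma K_subset: "K \<subseteq> \<Phi>"
  by (auto simp: K_def)

lemma lin_bound:
  assumes "\<phi> \<in> \<Phi>"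
  shows "\<bar>lin S v \<phi>\<bar> \<le> l1 S v"
  unfolding lin_def l1_def
proof (rule order_trans[OF sum_abs], rule sum_mono)
  fix z assume "z \<in> S"
  then show "\<bar>\<phi> z * v z\<bar> \<le> \<bar>v z\<bar>"
    using \<Phi>_bounds[OF assms] by (simp add: abs_mult mult_left_le_one_le)
qed

lemma lin_diff: "lin S v \<phi> - lin S w \<phi> = lin S (\<lambda>z. v z - w z) \<phi>"
  by (simp add: lin_def right_diff_distrib sum_subtractf)

lemma lin_diff_arg_bound:
  assumes "\<And>z. z \<in> S \<Longrightarrow> \<bar>\<phi> z - \<psi> z\<bar> \<le> c"
  shows "lin S v \<phi> - lin S v \<psi> \<le> c * l1 S v"
proof -
  have "lin S v \<phi> - lin S v \<psi> = (\<Sum>z\<in>S. (\<phi> z - \<psi> z) * v z)"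
    by (simp add: lin_def left_diff_distrib sum_subtractf)
  also have "\<dots> \<le> (\<Sum>z\<in>S. c * \<bar>v z\<bar>)"
  proof (rule sum_mono)
    fix z assume "z \<in> S"
    have "(\<phi> z - \<psi> z) * v z \<le> \<bar>\<phi> z - \<psi> z\<bar> * \<bar>v z\<bar>" by (metis abs_ge_self abs_mult)
    also have "\<dots> \<le> c * \<bar>v z\<bar>" using assms[OF \<open>z \<in> S\<close>] by (rule mult_right_mono) simp
    finally show "(\<phi> z - \<psi> z) * v z \<le> c * \<bar>v z\<bar>" .
  qed
  finally show ?thesis by (simp add: l1_def sum_distrib_left)
qed

lemma bdd_above_lin: "A \<subseteq> \<Phi> \<Longrightarrow> bdd_above (lin S v ` A)"
  by (rule bdd_aboveI2[where M = "l1 S v"]) (rule order_trans[OF abs_ge_self lin_bound], blast)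

lemma bdd_above_penalized:
  assumes "\<kappa> \<ge> 0"
  shows "bdd_above ((\<lambda>\<phi>. lin S v \<phi> + \<kappa> * (e \<phi> - T)) ` \<Phi>)"
proof (rule bdd_aboveI2[where M = "l1 S v"])
  fix \<phi> assume \<phi>: "\<phi> \<in> \<Phi>"
  have "\<kappa> * (e \<phi> - T) \<le> 0" using e_le_T[OF \<phi>] assms by (simp add: mult_nonneg_nonpos)
  then show "lin S v \<phi> + \<kappa> * (e \<phi> - T) \<le> l1 S v" using lin_bound[OF \<phi>, of v] by linarith
qed

lemma contact_sup_upper: "\<phi> \<in> K \<Longrightarrow> lin S v \<phi> \<le> contact_sup v"
  unfolding contact_sup_def by (rule cSUP_upper[OF _ bdd_above_lin[OF K_subset]])

lemma contact_sup_le_penalized: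
  assumes "\<kappa> \<ge> 0"
  shows "contact_sup v \<le> penalized \<kappa> v"
  unfolding contact_sup_def
proof (rule cSUP_least[OF K_nonempty])
  fix \<phi> assume "\<phi> \<in> K"
  then have "\<phi> \<in> \<Phi>" "e \<phi> = T" by (auto simp: K_def)
  then show "lin S v \<phi> \<le> penalized \<kappa> v"
    using cSUP_upper[OF _ bdd_above_penalized[OF assms], of \<phi> v] by (simp add: penalized_def)
qed

lemma contact_sup_lipschitz: "\<bar>contact_sup v - contact_sup w\<bar> \<le> l1 S (\<lambda>z. v z - w z)"
proof -
  have "contact_sup v \<le> contact_sup w + l1 S (\<lambda>z. v z - w z)" for v w
    unfolding contact_sup_def
  proof (rule cSUP_diff_le[OF K_nonempty bdd_above_lin[OF K_subset]])
    fix \<phi> assume "\<phi> \<in> K"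
    then show "lin S v \<phi> \<le> lin S w \<phi> + l1 S (\<lambda>z. v z - w z)"
      using lin_bound[of \<phi> "\<lambda>z. v z - w z"] K_subset lin_diff[of v \<phi> w] by auto
  qed
  from this[of v w] this[of w v] show ?thesis by (simp add: l1_def abs_minus_commute abs_le_iff)
qed

text \<open>Split the cube by distance to \<open>K\<close>. A point near \<open>K\<close> is
  replaced by a contact point at linear cost \<epsilon> times the norm of v, and its penalty is
  nonpositive. On the compact rest \<open>e\<close> stays below \<open>T\<close> by some \<delta>,
  so the penalty is at most -\<kappa> \<delta>, while the linear term gains at most the norm of v. A
  threshold for \<kappa> that is uniform in v cannot absorb a gain growing with v; the quadratic
  term does.\<close>

lemma penalized_le:
  assumes \<epsilon>: "\<epsilon> > 0"
  shows "\<exists>\<Lambda>\<ge>0. \<forall>\<kappa>\<ge>\<Lambda>. \<forall>v. penalized \<kappa> v \<le> contact_sup v + \<epsilon> * (1 + (l1 S v)\<^sup>2)"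
proof -
  define far where "far = \<Phi> \<inter> (\<Inter>\<psi>\<in>K. {\<phi>. \<epsilon> \<le> l1 S (\<lambda>z. \<phi> z - \<psi> z)})"
  have "compact far"
    unfolding far_def
    by (intro compact_Int_closed compact_\<Phi> closed_INT ballI closed_Collect_le continuous_l1_diff) auto
  \<comment> \<open>On the compact set \<open>far\<close> the maximum of \<open>e\<close> is
    attained, at a point outside \<open>K\<close> since a contact point has distance zero to itself.
    It is therefore strictly below \<open>T\<close>.\<close>
  have "\<exists>\<delta>>0. \<forall>\<phi>\<in>far. e \<phi> \<le> T - \<delta>"
  proof (cases "far = {}")
    case True
    then show ?thesis by (intro exI[of _ 1]) auto
  next
    case False
    have "continuous_on far e" by (rule continuous_on_subset[OF continuous_e]) (auto simp: far_def)
    from continuous_attains_sup[OF \<open>compact far\<close> False this]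
    obtain \<phi> where \<phi>: "\<phi> \<in> far" "\<forall>\<psi>\<in>far. e \<psi> \<le> e \<phi>" by auto
    have "\<phi> \<notin> K"
    proof
      assume "\<phi> \<in> K"
      then have "\<epsilon> \<le> l1 S (\<lambda>z. \<phi> z - \<phi> z)" using \<phi>(1) unfolding far_def by blast
      then show False using \<epsilon> by (simp add: l1_def)
    qed
    then have "e \<phi> < T" using \<phi>(1) e_le_T[of \<phi>] by (auto simp: far_def K_def less_le)
    then show ?thesis using \<phi>(2) by (intro exI[of _ "T - e \<phi>"]) auto
  qed
  then obtain \<delta> where \<delta>: "\<delta> > 0" "\<And>\<phi>. \<phi> \<in> far \<Longrightarrow> e \<phi> \<le> T - \<delta>" by auto
  \<comment> \<open>Chosen so that \<kappa> \<delta> \<ge> 1/(4 \<epsilon>), the constant in the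
    inequality x \<le> \<epsilon> x^2 + 1/(4 \<epsilon>) that comes from completing the
    square.\<close>
  define \<Lambda> where "\<Lambda> = 1 / (4 * \<epsilon> * \<delta>)"
  have \<Lambda>: "\<Lambda> \<ge> 0" using \<epsilon> \<delta> by (simp add: \<Lambda>_def)
  have "penalized \<kappa> v \<le> contact_sup v + \<epsilon> * (1 + (l1 S v)\<^sup>2)" if \<kappa>: "\<kappa> \<ge> \<Lambda>" for \<kappa> v
    unfolding penalized_def
  proof (rule cSUP_least[OF \<Phi>_nonempty])
    fix \<phi> assume \<phi>: "\<phi> \<in> \<Phi>"
    let ?n = "l1 S v"
    show "lin S v \<phi> + \<kappa> * (e \<phi> - T) \<le> contact_sup v + \<epsilon> * (1 + ?n\<^sup>2)"
    proof (cases "\<phi> \<in> far")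
      case True
      obtain \<psi> where \<psi>: "\<psi> \<in> K" using K_nonempty by auto
      have "lin S v \<phi> - lin S v \<psi> \<le> 1 * ?n"
      proof (rule lin_diff_arg_bound)
        fix z assume "z \<in> S"
        then show "\<bar>\<phi> z - \<psi> z\<bar> \<le> 1"
          using \<Phi>_bounds[OF \<phi>, of z] \<Phi>_bounds[of \<psi> z] \<psi> K_subset by fastforce
      qed
      moreover have "\<kappa> * (e \<phi> - T) \<le> \<kappa> * (- \<delta>)"
        using \<delta>(2)[OF True] \<kappa> \<Lambda> by (intro mult_left_mono) auto
      moreover have "1 / (4 * \<epsilon>) \<le> \<kappa> * \<delta>"
        using mult_right_mono[OF \<kappa>, of \<delta>] \<delta>(1) by (simp add: \<Lambda>_def)
      moreover have "?n \<le> \<epsilon> * ?n\<^sup>2 + 1 / (4 * \<epsilon>)"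
      proof -
        have "0 \<le> \<epsilon> * (?n - 1 / (2 * \<epsilon>))\<^sup>2" using \<epsilon> by simp
        also have "\<dots> = \<epsilon> * ?n\<^sup>2 + 1 / (4 * \<epsilon>) - ?n"
          using \<epsilon> by (simp add: power2_eq_square field_simps)
        finally show ?thesis by simp
      qed
      ultimately have "lin S v \<phi> + \<kappa> * (e \<phi> - T) \<le> lin S v \<psi> + \<epsilon> * ?n\<^sup>2" by linarith
      with contact_sup_upper[OF \<psi>, of v] \<epsilon> show ?thesis by (simp add: distrib_left)
    next
      case False
      then obtain \<psi> where \<psi>: "\<psi> \<in> K" "l1 S (\<lambda>z. \<phi> z - \<psi> z) < \<epsilon>"
        using \<phi> unfolding far_def by (auto simp: not_le)
      have "lin S v \<phi> - lin S v \<psi> \<le> \<epsilon> * ?n"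
      proof (rule lin_diff_arg_bound)
        fix z assume "z \<in> S"
        then have "\<bar>\<phi> z - \<psi> z\<bar> \<le> l1 S (\<lambda>z. \<phi> z - \<psi> z)"
          unfolding l1_def using finite_S by (intro member_le_sum) auto
        then show "\<bar>\<phi> z - \<psi> z\<bar> \<le> \<epsilon>" using \<psi>(2) by simp
      qed
      moreover have "\<kappa> * (e \<phi> - T) \<le> 0"
        using e_le_T[OF \<phi>] \<kappa> \<Lambda> by (simp add: mult_nonneg_nonpos)
      moreover have "\<epsilon> * ?n \<le> \<epsilon> * (1 + ?n\<^sup>2)"
      proof (rule mult_left_mono)
        have "0 \<le> (?n - 1 / 2)\<^sup>2" by simp
        then show "?n \<le> 1 + ?n\<^sup>2" by (simp add: power2_eq_square algebra_simps)
      qed (use \<epsilon> in simp)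
      ultimately show ?thesis using contact_sup_upper[OF \<psi>(1), of v] by linarith
    qed
  qed
  then show ?thesis using \<Lambda> by auto
qed

lemma abs_penalized_diff:
  assumes "\<epsilon> > 0"
  shows "\<exists>\<Lambda>\<ge>0. \<forall>\<kappa>\<ge>\<Lambda>. \<forall>v. \<bar>penalized \<kappa> v - contact_sup v\<bar> \<le> \<epsilon> * (1 + (l1 S v)\<^sup>2)"
proof -
  obtain \<Lambda> where "\<Lambda> \<ge> 0" "\<And>\<kappa> v. \<kappa> \<ge> \<Lambda> \<Longrightarrow> penalized \<kappa> v \<le> contact_sup v + \<epsilon> * (1 + (l1 S v)\<^sup>2)"
    using penalized_le[OF assms] by blast
  moreover have "contact_sup v \<le> penalized \<kappa> v" if "\<Lambda> \<le> \<kappa>" for \<kappa> v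
    using contact_sup_le_penalized that \<open>\<Lambda> \<ge> 0\<close> by simp
  moreover have "0 \<le> \<epsilon> * (1 + (l1 S v)\<^sup>2)" for v
    using assms by simp
  ultimately show ?thesis
    by (intro exI[of _ \<Lambda>]) (smt (verit))
qed

lemma bdd_above_perturbed: "bdd_above ((\<lambda>\<phi>. e \<phi> + lin S u \<phi>) ` \<Phi>)"
  by (rule bdd_aboveI2[where M = "T + l1 S u"])
     (rule add_mono[OF e_le_T order_trans[OF abs_ge_self lin_bound]])

text \<open>An identity without remainder. With \<open>a\<close> = sqrt n and \<open>u\<close> the
  unscaled deviation of the frequencies, the recentred statistic becomes a penalized supremum whose
  penalty weight is the rate itself.\<close>

lemma scaled_sup_diff:
  assumes "a \<ge> 0"
  shows "a * ((SUP \<phi>\<in>\<Phi>. e \<phi> + lin S u \<phi>) - T) = penalized a (\<lambda>z. a * u z)"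
proof -
  have "penalized a (\<lambda>z. a * u z) = (SUP \<phi>\<in>\<Phi>. a * (e \<phi> + lin S u \<phi>) + - (a * T))"
    unfolding penalized_def by (intro SUP_cong refl) (simp add: lin_def sum_distrib_left algebra_simps)
  then show ?thesis
    using cSUP_affine[OF \<Phi>_nonempty bdd_above_perturbed assms, of u "- (a * T)"] by (simp add: right_diff_distrib)
qed

lemma bdd_above_perturbed_penalized:
  assumes "\<kappa> \<ge> 0"
  shows "bdd_above ((\<lambda>\<phi>. lin S w \<phi> + \<kappa> * (e \<phi> + lin S u \<phi>)) ` \<Phi>)"
proof (rule bdd_aboveI2[where M = "l1 S w + \<kappa> * (T + l1 S u)"])
  fix \<phi> assume \<phi>: "\<phi> \<in> \<Phi>"
  show "lin S w \<phi> + \<kappa> * (e \<phi> + lin S u \<phi>) \<le> l1 S w + \<kappa> * (T + l1 S u)"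
    using assms e_le_T[OF \<phi>] order_trans[OF abs_ge_self lin_bound[OF \<phi>]]
    by (intro add_mono mult_left_mono)
qed

text \<open>The perturbation \<open>u\<close> of the criterion enters twice, inside the penalty and
  through the maximum that is subtracted. Each occurrence moves the value by at most \<kappa> times
  the norm of \<open>u\<close>.\<close>

lemma perturbed_penalized:
  assumes \<kappa>: "\<kappa> \<ge> 0"
  shows "\<bar>(SUP \<phi>\<in>\<Phi>. lin S w \<phi> + \<kappa> * (e \<phi> + lin S u \<phi>)) - \<kappa> * (SUP \<phi>\<in>\<Phi>. e \<phi> + lin S u \<phi>)
      - penalized \<kappa> w\<bar> \<le> 2 * \<kappa> * l1 S u"
proof -
  let ?n = "l1 S u"
  have b: "- ?n \<le> lin S u \<phi>" "lin S u \<phi> \<le> ?n" if "\<phi> \<in> \<Phi>" for \<phi>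
    using lin_bound[OF that, of u] by linarith+
  have \<kappa>b: "- (\<kappa> * ?n) \<le> \<kappa> * lin S u \<phi>" "\<kappa> * lin S u \<phi> \<le> \<kappa> * ?n" if "\<phi> \<in> \<Phi>" for \<phi>
    using mult_left_mono[OF b(1)[OF that] \<kappa>] mult_left_mono[OF b(2)[OF that] \<kappa>] by simp_all
  let ?s = "SUP \<phi>\<in>\<Phi>. lin S w \<phi> + \<kappa> * (e \<phi> + lin S u \<phi>)"
  note bdd = bdd_above_perturbed_penalized[OF \<kappa>, of w u]
  have 1: "penalized \<kappa> w \<le> ?s + (\<kappa> * ?n - \<kappa> * T)"
    unfolding penalized_def
  proof (rule cSUP_diff_le[OF \<Phi>_nonempty bdd])
    fix \<phi> assume "\<phi> \<in> \<Phi>"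
    from \<kappa>b(1)[OF this]
    show "lin S w \<phi> + \<kappa> * (e \<phi> - T) \<le> lin S w \<phi> + \<kappa> * (e \<phi> + lin S u \<phi>) + (\<kappa> * ?n - \<kappa> * T)"
      by (simp add: algebra_simps)
  qed
  have 2: "?s \<le> penalized \<kappa> w + (\<kappa> * ?n + \<kappa> * T)"
    unfolding penalized_def
    by (rule cSUP_diff_le[OF \<Phi>_nonempty bdd_above_penalized[OF \<kappa>]]) (use \<kappa>b(2) in \<open>simp add: algebra_simps\<close>)
  have 3: "T \<le> (SUP \<phi>\<in>\<Phi>. e \<phi> + lin S u \<phi>) + ?n"
    unfolding T_def
  proof (rule cSUP_diff_le[OF \<Phi>_nonempty bdd_above_perturbed])
    fix \<phi> assume "\<phi> \<in> \<Phi>"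
    from b(1)[OF this] show "e \<phi> \<le> e \<phi> + lin S u \<phi> + ?n" by simp
  qed
  have 4: "(SUP \<phi>\<in>\<Phi>. e \<phi> + lin S u \<phi>) \<le> T + ?n"
    unfolding T_def
    by (rule cSUP_diff_le[OF \<Phi>_nonempty bdd_above_e]) (use b(2) in simp)
  show ?thesis
    using 1 2 mult_left_mono[OF 3 \<kappa>] mult_left_mono[OF 4 \<kappa>] by (simp add: abs_le_iff algebra_simps)
qed

end

section \<open>The limit theorem for penalized suprema\<close>

lemma l1_square_le: "(l1 S v)\<^sup>2 \<le> real (card S) * (\<Sum>z\<in>S. (v z)\<^sup>2)"
  using sum_squared_le_sum_of_squares[of "\<lambda>z. \<bar>v z\<bar>" S] by (cases "finite S") (simp_all add: l1_def mult.commute)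

text \<open>Independence is asked for below \<open>n\<close> only: a bootstrap sample consists of
  \<open>n\<close> draws, on a probability space that depends on \<open>n\<close> and on the
  data.\<close>

definition iid_draws :: "'w measure \<Rightarrow> (nat \<Rightarrow> 'w \<Rightarrow> 'z) \<Rightarrow> nat \<Rightarrow> 'z measure \<Rightarrow> bool" where
  "iid_draws P X n Q \<longleftrightarrow> prob_space P \<and> prob_space.indep_vars P (\<lambda>_. Q) X {..<n} \<and>
     (\<forall>i<n. distr P Q (X i) = Q)"

lemma integral_cos_eq_Re:
  fixes f :: "'w \<Rightarrow> real"
  assumes "prob_space P" "f \<in> borel_measurable P"
  shows "(\<integral>\<omega>. cos (f \<omega> + b) \<partial>P) = Re (iexp b * (\<integral>\<omega>. iexp (f \<omega>) \<partial>P))"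
proof -
  interpret prob_space P by fact
  have i: "integrable P (\<lambda>\<omega>. iexp (f \<omega>))"
    using assms(2) by (intro integrable_const_bound[where B = 1]) auto
  have "Re (iexp b * iexp x) = cos (x + b)" for x :: real
    by (simp add: cis_conv_exp[symmetric] cis_mult add.commute)
  then have "(\<integral>\<omega>. cos (f \<omega> + b) \<partial>P) = (\<integral>\<omega>. Re (iexp b * iexp (f \<omega>)) \<partial>P)" by simp
  also have "\<dots> = Re (\<integral>\<omega>. iexp b * iexp (f \<omega>) \<partial>P)"
    using i by (intro integral_Re integrable_mult_right)
  finally show ?thesis by simp
qed

text \<open>Linear combinations determine everything here, a single coordinate being the combination
  with indicator weights. The bound 4 matches that for the frequency deviations, so one constant
  serves both sides of \<open>cramer_wold\<close>.\<close>

lemma centered_gaussian_facts: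
  assumes "finite_support S \<mu>" and g: "centered_gaussian N S \<xi> (multinomial_cov \<mu>)"
  shows "prob_space N" and "\<And>z. z \<in> S \<Longrightarrow> \<xi> z \<in> borel_measurable N"
    and "\<And>z. z \<in> S \<Longrightarrow> integrable N (\<lambda>\<omega>. (\<xi> z \<omega>)\<^sup>2)"
    and "\<And>z. z \<in> S \<Longrightarrow> (\<integral>\<omega>. (\<xi> z \<omega>)\<^sup>2 \<partial>N) \<le> 4"
    and "\<And>a. (\<integral>\<omega>. iexp (\<Sum>z\<in>S. a z * \<xi> z \<omega>) \<partial>N) = exp (- cov_form S \<mu> a / 2)"
proof -
  interpret \<mu>: finite_support S \<mu> by fact
  show N: "prob_space N" and m: "\<And>z. z \<in> S \<Longrightarrow> \<xi> z \<in> borel_measurable N"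
    using g by (auto simp: centered_gaussian_def)
  have lc: "(\<lambda>\<omega>. \<Sum>z\<in>S. a z * \<xi> z \<omega>) \<in> borel_measurable N" for a
    using m by (intro borel_measurable_sum) auto
  have d: "distr N borel (\<lambda>\<omega>. \<Sum>z\<in>S. a z * \<xi> z \<omega>) = normal_law 0 (cov_form S \<mu> a)" for a
    using g by (simp add: centered_gaussian_def cov_form_def)
  show "(\<integral>\<omega>. iexp (\<Sum>z\<in>S. a z * \<xi> z \<omega>) \<partial>N) = exp (- cov_form S \<mu> a / 2)" for a
    using char_normal_law[OF \<mu>.cov_form_nonneg, of a] unfolding d[symmetric]
    by (subst (asm) integral_distr[OF lc]) auto
  fix z assume z: "z \<in> S"
  let ?a = "indicator {z} :: _ \<Rightarrow> real"
  have \<xi>: "(\<Sum>z'\<in>S. ?a z' * \<xi> z' \<omega>) = \<xi> z \<omega>" for \<omega>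
    using z \<mu>.finite_S by (simp add: indicator_def if_distrib[of "\<lambda>u. u * _"] cong: if_cong)
  have dz: "distr N borel (\<xi> z) = normal_law 0 (cov_form S \<mu> ?a)"
    using d[of ?a] by (simp add: \<xi>)
  have "(\<Sum>z'\<in>S. \<bar>?a z'\<bar>) = 1" using z \<mu>.finite_S by (simp add: indicator_def)
  then have le: "cov_form S \<mu> ?a \<le> 4" using \<mu>.cov_form_le[of ?a] by simp
  note mom = normal_law_moment[OF \<mu>.cov_form_nonneg, of ?a, folded dz]
  show "integrable N (\<lambda>\<omega>. (\<xi> z \<omega>)\<^sup>2)"
    using mom(1) by (subst (asm) integrable_distr_eq[OF m[OF z]]) auto
  show "(\<integral>\<omega>. (\<xi> z \<omega>)\<^sup>2 \<partial>N) \<le> 4"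
    using mom(2) le by (subst (asm) integral_distr[OF m[OF z]]) auto
qed

text \<open>The uniform rate compares with the Gaussian value for \<open>Q i\<close>; continuity of
  the quadratic form in the finitely many atoms then carries that value to the one for
  \<open>\<mu>\<close>.\<close>

lemma tendsto_freq_dev_char:
  fixes F :: "'i filter" and P :: "'i \<Rightarrow> 'w measure"
  assumes \<mu>: "finite_support S \<mu>" and Q: "\<And>i. finite_support S (Q i)"
    and X: "\<And>i. iid_draws (P i) (X i) (n i) (Q i)"
    and n: "filterlim n sequentially F"
    and q: "\<And>z. z \<in> S \<Longrightarrow> ((\<lambda>i. measure (Q i) {z}) \<longlongrightarrow> measure \<mu> {z}) F"
  shows "((\<lambda>i. \<integral>\<omega>. iexp (\<Sum>z\<in>S. a z * freq_dev (n i) (\<lambda>k. X i k \<omega>) (Q i) z) \<partial>P i)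
    \<longlongrightarrow> exp (- cov_form S \<mu> a / 2)) F"
proof -
  define B where "B = 2 * (\<Sum>z\<in>S. \<bar>a z\<bar>)"
  define c where "c i = (\<integral>\<omega>. iexp (\<Sum>z\<in>S. a z * freq_dev (n i) (\<lambda>k. X i k \<omega>) (Q i) z) \<partial>P i)" for i
  have "((\<lambda>i. complex_of_real (exp (- cov_form S (Q i) a / 2))) \<longlongrightarrow> complex_of_real (exp (- cov_form S \<mu> a / 2))) F"
    unfolding cov_form_eq[OF finite_support.finite_S[OF \<mu>]]
    by (intro tendsto_intros q) auto
  moreover have "((\<lambda>i. c i - complex_of_real (exp (- cov_form S (Q i) a / 2))) \<longlongrightarrow> 0) F"
  proof (rule Lim_null_comparison)
    have "\<forall>\<^sub>F i in F. n i \<ge> 1"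
      using n by (simp add: filterlim_at_top)
    then show "\<forall>\<^sub>F i in F. cmod (c i - complex_of_real (exp (- cov_form S (Q i) a / 2)))
        \<le> (B ^ 3 / 6 + B ^ 4 / 8) / sqrt (real (n i))"
    proof eventually_elim
      case (elim i)
      interpret Q: finite_support S "Q i" by (rule Q)
      show ?case
        using Q.freq_dev_char[of "P i" "X i" "n i" a, OF _ _ _ elim] X[of i]
        by (auto simp: iid_draws_def c_def B_def of_real_exp)
    qed
    show "((\<lambda>i. (B ^ 3 / 6 + B ^ 4 / 8) / sqrt (real (n i))) \<longlongrightarrow> 0) F"
      by (rule real_tendsto_divide_at_top[OF tendsto_const])
         (rule filterlim_compose[OF sqrt_at_top filterlim_compose[OF filterlim_real_sequentially n]])
  qed
  ultimately have "((\<lambda>i. (c i - complex_of_real (exp (- cov_form S (Q i) a / 2)))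
      + complex_of_real (exp (- cov_form S (Q i) a / 2))) \<longlongrightarrow> 0 + complex_of_real (exp (- cov_form S \<mu> a / 2))) F"
    by (intro tendsto_add)
  then show ?thesis by (simp add: c_def of_real_exp)
qed

context contact_problem
begin

lemma contact_sup_measurable:
  assumes "\<And>z. z \<in> S \<Longrightarrow> V z \<in> borel_measurable P"
  shows "(\<lambda>\<omega>. contact_sup (\<lambda>z. V z \<omega>)) \<in> borel_measurable P"
  using contact_sup_lipschitz
  by (intro borel_measurable_lipschitz_coords[where C = 1, OF finite_S assms]) (auto simp: l1_def)

lemma integral_l1_square:
  fixes B :: real
  assumes "prob_space P" "\<And>z. z \<in> S \<Longrightarrow> integrable P (\<lambda>\<omega>. (V z \<omega>)\<^sup>2)"
    and V: "\<And>z. z \<in> S \<Longrightarrow> V z \<in> borel_measurable P"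
    and "\<And>z. z \<in> S \<Longrightarrow> (\<integral>\<omega>. (V z \<omega>)\<^sup>2 \<partial>P) \<le> B"
  shows "integrable P (\<lambda>\<omega>. (l1 S (\<lambda>z. V z \<omega>))\<^sup>2)"
    and "(\<integral>\<omega>. (l1 S (\<lambda>z. V z \<omega>))\<^sup>2 \<partial>P) \<le> (card S)\<^sup>2 * B"
proof -
  have s: "integrable P (\<lambda>\<omega>. real (card S) * (\<Sum>z\<in>S. (V z \<omega>)\<^sup>2))"
    using assms by (intro integrable_mult_right Bochner_Integration.integrable_sum)
  show i: "integrable P (\<lambda>\<omega>. (l1 S (\<lambda>z. V z \<omega>))\<^sup>2)"
  proof (rule Bochner_Integration.integrable_bound[OF s])
    show "(\<lambda>\<omega>. (l1 S (\<lambda>z. V z \<omega>))\<^sup>2) \<in> borel_measurable P"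
      unfolding l1_def using V by (intro borel_measurable_power borel_measurable_sum borel_measurable_abs)
  qed (auto simp: sum_nonneg l1_square_le)
  have "(\<integral>\<omega>. (l1 S (\<lambda>z. V z \<omega>))\<^sup>2 \<partial>P) \<le> (\<integral>\<omega>. real (card S) * (\<Sum>z\<in>S. (V z \<omega>)\<^sup>2) \<partial>P)"
    by (rule integral_mono[OF i s l1_square_le])
  also have "\<dots> = real (card S) * (\<Sum>z\<in>S. \<integral>\<omega>. (V z \<omega>)\<^sup>2 \<partial>P)"
    using assms(2) by simp
  also have "\<dots> \<le> real (card S) * (\<Sum>z\<in>S. B)"
    using assms(4) by (intro mult_left_mono sum_mono) auto
  finally show "(\<integral>\<omega>. (l1 S (\<lambda>z. V z \<omega>))\<^sup>2 \<partial>P) \<le> (card S)\<^sup>2 * B"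
    by (simp add: power2_eq_square mult_ac)
qed

text \<open>Source of both limits. The statistic takes the fixed law, weight sqrt n and error zero;
  the bootstrap takes the resampling law, weight \<lambda>_n and the error caused by estimating the
  criterion. Measurability is asked of \<open>Y\<close>; the function \<open>penalized\<close>
  enters only through an almost everywhere bound.\<close>

theorem tendsto_d_BL_contact_sup:
  fixes F :: "'i filter" and P :: "'i \<Rightarrow> 'w measure" and N :: "'v measure"
  assumes \<mu>: "finite_support S \<mu>" and gauss: "centered_gaussian N S \<xi> (multinomial_cov \<mu>)"
    and Q: "\<And>i. finite_support S (Q i)" and X: "\<And>i. iid_draws (P i) (X i) (n i) (Q i)"
    and n: "filterlim n sequentially F"
    and q: "\<And>z. z \<in> S \<Longrightarrow> ((\<lambda>i. measure (Q i) {z}) \<longlongrightarrow> measure \<mu> {z}) F"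
    and \<kappa>: "filterlim \<kappa> at_top F"
    and Y: "\<And>i. Y i \<in> borel_measurable (P i)"
    and err: "(err \<longlongrightarrow> 0) F"
    and close: "\<forall>\<^sub>F i in F. AE \<omega> in P i.
      \<bar>Y i \<omega> - penalized (\<kappa> i) (freq_dev (n i) (\<lambda>k. X i k \<omega>) (Q i))\<bar> \<le> err i"
  shows "((\<lambda>i. d_BL (distr (P i) borel (Y i)) (distr N borel (\<lambda>\<omega>. contact_sup (\<lambda>z. \<xi> z \<omega>)))) \<longlongrightarrow> 0) F"
proof -
  define V where "V i z \<omega> = freq_dev (n i) (\<lambda>k. X i k \<omega>) (Q i) z" for i z \<omega>
  have P: "prob_space (P i)" for i using X[of i] by (simp add: iid_draws_def)
  have X': "prob_space.indep_vars (P i) (\<lambda>_. Q i) (X i) {..<n i}" "k < n i \<Longrightarrow> distr (P i) (Q i) (X i k) = Q i" for i k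
    using X[of i] by (auto simp: iid_draws_def)
  have V: "V i z \<in> borel_measurable (P i)" for i z
    unfolding V_def using finite_support.borel_measurable_freq_dev[OF Q P X'] by simp
  have mom: "integrable (P i) (\<lambda>\<omega>. (V i z \<omega>)\<^sup>2)" "(\<integral>\<omega>. (V i z \<omega>)\<^sup>2 \<partial>P i) \<le> 4" if "z \<in> S" for i z
    unfolding V_def using finite_support.freq_dev_moment[OF Q P X' that] by simp_all
  note N = centered_gaussian_facts[OF \<mu> gauss]
  have cs: "(\<lambda>\<omega>. contact_sup (\<lambda>z. V i z \<omega>)) \<in> borel_measurable (P i)" for i
    by (rule contact_sup_measurable) (rule V)
  have csN: "(\<lambda>\<omega>. contact_sup (\<lambda>z. \<xi> z \<omega>)) \<in> borel_measurable N"
    by (rule contact_sup_measurable) (rule N(2))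
  show ?thesis
  proof (rule tendsto_d_BL_zero)
    show "real_distribution (distr (P i) borel (Y i))" for i
      by (rule prob_space.real_distribution_distr[OF P Y])
    show "real_distribution (distr N borel (\<lambda>\<omega>. contact_sup (\<lambda>z. \<xi> z \<omega>)))"
      by (rule prob_space.real_distribution_distr[OF N(1) csN])
    fix g :: "real \<Rightarrow> real" and C assume g1: "\<And>x. \<bar>g x\<bar> \<le> 1"
      and gC: "\<And>x y. \<bar>g x - g y\<bar> \<le> C * \<bar>x - y\<bar>" and C: "C \<ge> 0"
    have "C-lipschitz_on UNIV g" using gC C by (simp add: lipschitz_on_real_iff)
    then have gm [measurable]: "g \<in> borel_measurable borel"
      by (intro borel_measurable_continuous_onI lipschitz_on_continuous_on)
    have gi: "integrable (P i) (\<lambda>\<omega>. g (f \<omega>))" if "f \<in> borel_measurable (P i)" for f i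
      using P[of i] that g1 by (intro finite_measure.integrable_const_bound[where B = 1])
        (auto simp: prob_space_def)
    have lim: "((\<lambda>i. \<integral>\<omega>. g (contact_sup (\<lambda>z. V i z \<omega>)) \<partial>P i) \<longlongrightarrow> (\<integral>\<omega>. g (contact_sup (\<lambda>z. \<xi> z \<omega>)) \<partial>N)) F"
    proof (rule cramer_wold[where h = "\<lambda>v. g (contact_sup v)" and C = C and D = 1 and B = 4 and V = V and \<xi> = \<xi>, OF finite_S P V mom N(1-4)])
      fix a b
      have "(\<lambda>\<omega>. \<Sum>z\<in>S. a z * V i z \<omega>) \<in> borel_measurable (P i)" for i
        using V by (intro borel_measurable_sum) auto
      moreover have "(\<lambda>\<omega>. \<Sum>z\<in>S. a z * \<xi> z \<omega>) \<in> borel_measurable N"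
        using N(2) by (intro borel_measurable_sum) auto
      moreover have "((\<lambda>i. \<integral>\<omega>. iexp (\<Sum>z\<in>S. a z * V i z \<omega>) \<partial>P i) \<longlongrightarrow>
          (\<integral>\<omega>. iexp (\<Sum>z\<in>S. a z * \<xi> z \<omega>) \<partial>N)) F"
        using tendsto_freq_dev_char[OF \<mu> Q X n q, of a] by (simp only: V_def N(5))
      ultimately show "((\<lambda>i. \<integral>\<omega>. cos ((\<Sum>z\<in>S. a z * V i z \<omega>) + b) \<partial>P i) \<longlongrightarrow>
        (\<integral>\<omega>. cos ((\<Sum>z\<in>S. a z * \<xi> z \<omega>) + b) \<partial>N)) F"
        by (simp only: integral_cos_eq_Re[OF P] integral_cos_eq_Re[OF N(1)] tendsto_Re tendsto_mult_left)
    next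
      fix v w
      have "\<bar>g (contact_sup v) - g (contact_sup w)\<bar> \<le> C * \<bar>contact_sup v - contact_sup w\<bar>" by (rule gC)
      also have "\<dots> \<le> C * (\<Sum>z\<in>S. \<bar>v z - w z\<bar>)"
        using contact_sup_lipschitz[of v w] C unfolding l1_def by (intro mult_left_mono)
      finally show "\<bar>g (contact_sup v) - g (contact_sup w)\<bar> \<le> C * (\<Sum>z\<in>S. \<bar>v z - w z\<bar>)" .
    qed (auto simp: g1 C)
    have diff: "((\<lambda>i. (\<integral>\<omega>. g (Y i \<omega>) \<partial>P i) - (\<integral>\<omega>. g (contact_sup (\<lambda>z. V i z \<omega>)) \<partial>P i)) \<longlongrightarrow> 0) F"
    proof (rule tendstoI)
      fix r :: real assume r: "r > 0"
      define M where "M = 1 + (card S)\<^sup>2 * (4::real)"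
      have M: "M > 0" by (simp add: M_def add_pos_nonneg)
      \<comment> \<open>\<open>M\<close> bounds the mean of 1 plus the squared norm, so the
        quadratic error has mean at most \<epsilon> M = r/(2(C+1)), as much as is allowed to
        \<open>err\<close>. Dividing by C + 1 instead of \<open>C\<close> admits C = 0 and makes the
        final inequality strict.\<close>
      define \<epsilon> where "\<epsilon> = r / (2 * (C + 1) * M)"
      have \<epsilon>: "\<epsilon> > 0" using r C M by (simp add: \<epsilon>_def)
      obtain \<Lambda> where \<Lambda>: "\<And>k v. k \<ge> \<Lambda> \<Longrightarrow> \<bar>penalized k v - contact_sup v\<bar> \<le> \<epsilon> * (1 + (l1 S v)\<^sup>2)"
        using abs_penalized_diff[OF \<epsilon>] by blast
      have "\<forall>\<^sub>F i in F. \<kappa> i \<ge> \<Lambda>" using \<kappa> by (simp add: filterlim_at_top)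
      moreover have "\<forall>\<^sub>F i in F. err i < r / (2 * (C + 1))"
        using order_tendstoD(2)[OF err, of "r / (2 * (C + 1))"] r C by simp
      ultimately show "\<forall>\<^sub>F i in F. dist ((\<integral>\<omega>. g (Y i \<omega>) \<partial>P i) - (\<integral>\<omega>. g (contact_sup (\<lambda>z. V i z \<omega>)) \<partial>P i)) 0 < r"
        using close
      proof eventually_elim
        case (elim i)
        interpret Pi: prob_space "P i" by (rule P)
        have ly: "integrable (P i) (\<lambda>\<omega>. (l1 S (\<lambda>z. V i z \<omega>))\<^sup>2)"
          and lb: "(\<integral>\<omega>. (l1 S (\<lambda>z. V i z \<omega>))\<^sup>2 \<partial>P i) \<le> (card S)\<^sup>2 * 4"
          using integral_l1_square[where V = "V i", OF P mom(1) V mom(2)] by simp_all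
        let ?b = "\<lambda>\<omega>. C * (err i + \<epsilon> * (1 + (l1 S (\<lambda>z. V i z \<omega>))\<^sup>2))"
        have bi: "integrable (P i) ?b" using ly by auto
        have "AE \<omega> in P i. \<bar>g (Y i \<omega>) - g (contact_sup (\<lambda>z. V i z \<omega>))\<bar> \<le> ?b \<omega>"
          using elim(3)
        proof eventually_elim
          case (elim \<omega>)
          have "\<bar>Y i \<omega> - contact_sup (\<lambda>z. V i z \<omega>)\<bar> \<le> err i + \<epsilon> * (1 + (l1 S (\<lambda>z. V i z \<omega>))\<^sup>2)"
            using elim \<Lambda>[OF \<open>\<kappa> i \<ge> \<Lambda>\<close>, of "\<lambda>z. V i z \<omega>"] unfolding V_def by linarith
          with gC[of "Y i \<omega>" "contact_sup (\<lambda>z. V i z \<omega>)"] mult_left_mono[OF _ C]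
          show ?case by (meson order_trans)
        qed
        then have "(\<integral>\<omega>. \<bar>g (Y i \<omega>) - g (contact_sup (\<lambda>z. V i z \<omega>))\<bar> \<partial>P i) \<le> (\<integral>\<omega>. ?b \<omega> \<partial>P i)"
          using gi[OF Y] gi[OF cs] bi by (intro integral_mono_AE) auto
        also have "\<dots> = C * (err i + \<epsilon> * (1 + (\<integral>\<omega>. (l1 S (\<lambda>z. V i z \<omega>))\<^sup>2 \<partial>P i)))"
          using ly Pi.prob_space by simp
        also have "\<dots> \<le> C * (err i + \<epsilon> * M)"
          using lb \<epsilon> C by (intro mult_left_mono add_left_mono) (auto simp: M_def)
        also have "\<epsilon> * M = r / (2 * (C + 1))"
          using M C by (simp add: \<epsilon>_def)
        also have "C * (err i + r / (2 * (C + 1))) \<le> C * (r / (2 * (C + 1)) + r / (2 * (C + 1)))"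
          using elim(2) C by (intro mult_left_mono add_right_mono) auto
        also have "r / (2 * (C + 1)) + r / (2 * (C + 1)) = r / (C + 1)"
          using field_sum_of_halves[of "r / (C + 1)"] by (simp only: divide_divide_eq_left mult.commute)
        also have "C * (r / (C + 1)) < r"
          using r C by (simp add: pos_divide_less_eq algebra_simps)
        finally have *: "(\<integral>\<omega>. \<bar>g (Y i \<omega>) - g (contact_sup (\<lambda>z. V i z \<omega>))\<bar> \<partial>P i) < r" .
        have "\<bar>(\<integral>\<omega>. g (Y i \<omega>) \<partial>P i) - (\<integral>\<omega>. g (contact_sup (\<lambda>z. V i z \<omega>)) \<partial>P i)\<bar>
          = \<bar>\<integral>\<omega>. g (Y i \<omega>) - g (contact_sup (\<lambda>z. V i z \<omega>)) \<partial>P i\<bar>"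
          using gi[OF Y] gi[OF cs] by simp
        also have "\<dots> \<le> (\<integral>\<omega>. \<bar>g (Y i \<omega>) - g (contact_sup (\<lambda>z. V i z \<omega>))\<bar> \<partial>P i)"
          by (rule integral_abs_bound)
        finally show ?case using * by (simp add: dist_real_def)
      qed
    qed
    have "((\<lambda>i. \<integral>\<omega>. g (Y i \<omega>) \<partial>P i) \<longlongrightarrow> (\<integral>\<omega>. g (contact_sup (\<lambda>z. \<xi> z \<omega>)) \<partial>N)) F"
      using tendsto_add[OF diff lim] by simp
    then show "((\<lambda>i. integral\<^sup>L (distr (P i) borel (Y i)) g) \<longlongrightarrow>
        integral\<^sup>L (distr N borel (\<lambda>\<omega>. contact_sup (\<lambda>z. \<xi> z \<omega>))) g) F"
      by (simp add: integral_distr[OF Y gm] integral_distr[OF csN gm])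
  qed
qed

end

section \<open>Finite moment models\<close>

text \<open>Any predicted law lies in the closure, at distance zero from itself. Nonemptiness
  matters because \<open>eta\<close> is a real infimum, which has no meaningful value on the empty
  set.\<close>

lemma closed_laws_nonempty:
  assumes wf: "well_formed_model m" and \<theta>: "\<theta> \<in> params m" and "latent_laws m \<theta> \<noteq> {}"
  shows "closed_laws m \<theta> \<noteq> {}"
proof -
  obtain \<gamma> where \<gamma>: "\<gamma> \<in> latent_laws m \<theta>" using assms(3) by auto
  let ?\<nu> = "\<gamma> \<bind> kernel m \<theta>"
  have "\<gamma> \<in> space (prob_algebra (w_space m))" using \<gamma> by (simp add: latent_laws_def)
  moreover have "kernel m \<theta> \<in> w_space m \<rightarrow>\<^sub>M prob_algebra (z_space m)"
    using wf \<theta> by (simp add: well_formed_model_def)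
  ultimately have "?\<nu> \<in> space (prob_algebra (z_space m))"
    using measurable_space[OF measurable_bind_prob_space[OF measurable_ident]] by auto
  moreover have "?\<nu> \<in> predicted_laws m \<theta>" using \<gamma> by (simp add: predicted_laws_def)
  moreover have "tv_dist ?\<nu> ?\<nu> = 0"
    using sets.empty_sets[of ?\<nu>] by (auto simp: tv_dist_def intro!: cSUP_const)
  ultimately have "?\<nu> \<in> closed_laws m \<theta>"
    by (auto simp: closed_laws_def tv_closure_def intro!: bexI[of _ ?\<nu>])
  then show ?thesis by auto
qed

section \<open>Empirical means and functions of finitely many observations\<close>

lemma emp_mean_cong:
  assumes "\<And>i. i < n \<Longrightarrow> d i = d' i"
  shows "emp_mean n d = emp_mean n d'"
  using assms by (auto simp: emp_mean_def fun_eq_iff)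

lemma emp_mean_eq_lin:
  assumes "finite S" "\<forall>i<n. d i \<in> S"
  shows "emp_mean n d \<phi> = lin S (\<lambda>z. emp_mean n d (indicator {z})) \<phi>"
proof -
  have "\<phi> (d i) = (\<Sum>z\<in>S. \<phi> z * indicator {z} (d i))" if "i < n" for i
    using assms that by (simp add: indicator_def if_distrib[of "(*) _"] cong: if_cong)
  then have "(\<Sum>i<n. \<phi> (d i)) = (\<Sum>i<n. \<Sum>z\<in>S. \<phi> z * indicator {z} (d i))"
    by (intro sum.cong) auto
  also have "\<dots> = (\<Sum>z\<in>S. \<Sum>i<n. \<phi> z * indicator {z} (d i))" by (rule sum.swap)
  finally show ?thesis
    by (simp only: emp_mean_def lin_def sum_divide_distrib sum_distrib_left times_divide_eq_right)
qed

text \<open>Such an \<open>f\<close> factors through the finite discrete space of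
  \<open>n\<close>-tuples of outcomes, from which every map is measurable. This covers statistics
  built from suprema and distances between conditional laws alike.\<close>

lemma borel_measurable_finite_sample:
  fixes Zs :: "nat \<Rightarrow> 'o \<Rightarrow> 'z" and n :: nat and f :: "'o \<Rightarrow> real"
  assumes Z: "\<And>i. Zs i \<in> measurable M Z" "finite (space Z)" "sets Z = Pow (space Z)"
    and dep: "\<And>\<omega> \<omega>'. \<omega> \<in> space M \<Longrightarrow> \<omega>' \<in> space M \<Longrightarrow> (\<And>i. i < n \<Longrightarrow> Zs i \<omega> = Zs i \<omega>') \<Longrightarrow> f \<omega> = f \<omega>'"
  shows "f \<in> borel_measurable M"
proof -
  define T where "T \<omega> = (\<lambda>i\<in>{..<n}. Zs i \<omega>)" for \<omega>
  let ?A = "{..<n} \<rightarrow>\<^sub>E space Z"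
  have fin: "finite ?A" using Z(2) by (intro finite_PiE) auto
  have T: "T \<in> measurable M (count_space ?A)"
  proof (subst measurable_count_space_eq2[OF fin], intro conjI ballI)
    show "T \<in> space M \<rightarrow> ?A" using measurable_space[OF Z(1)] by (auto simp: T_def)
    fix t assume t: "t \<in> ?A"
    have "T -` {t} \<inter> space M = {\<omega> \<in> space M. \<forall>i\<in>{..<n}. Zs i \<omega> = t i}"
      using t by (auto simp: T_def fun_eq_iff PiE_def extensional_def)
    also have "\<dots> \<in> sets M"
    proof (rule sets.sets_Collect_finite_All)
      fix i assume "i \<in> {..<n}"
      then have "{t i} \<in> sets Z" using t Z(3) by auto
      from measurable_sets[OF Z(1)[of i] this]
      show "{\<omega> \<in> space M. Zs i \<omega> = t i} \<in> sets M"
        by (simp add: vimage_def Int_def conj_commute)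
    qed simp
    finally show "T -` {t} \<inter> space M \<in> sets M" .
  qed
  \<comment> \<open>The factor is found by choosing, for each attained tuple, some sample point that
    produces it; \<open>dep\<close> makes the choice irrelevant.\<close>
  define H where "H t = f (SOME \<omega>. \<omega> \<in> space M \<and> T \<omega> = t)" for t
  have "f \<omega> = H (T \<omega>)" if "\<omega> \<in> space M" for \<omega>
  proof -
    define \<omega>' where "\<omega>' = (SOME \<omega>'. \<omega>' \<in> space M \<and> T \<omega>' = T \<omega>)"
    have w: "\<omega>' \<in> space M \<and> T \<omega>' = T \<omega>"
      unfolding \<omega>'_def by (rule someI[of _ \<omega>]) (use that in simp)
    then have "Zs i \<omega> = Zs i \<omega>'" if "i < n" for i
      using that by (metis T_def lessThan_iff restrict_apply')
    then show ?thesis using dep[OF that, of \<omega>'] w by (simp add: H_def \<omega>'_def)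
  qed
  moreover have "(\<lambda>\<omega>. H (T \<omega>)) \<in> borel_measurable M"
    by (rule measurable_compose[OF T]) simp
  ultimately show ?thesis by (subst measurable_cong) auto
qed

text \<open>Nonemptiness of the closed set is the common consequence of two situations: \<theta> in
  the identified set, where \<open>\<mu>\<close> itself is a member, and nonempty
  \<open>latent_laws\<close>.\<close>

locale finite_model =
  fixes m :: "('y, 'x, 'u, 'j, 'k, 't) moment_model" and \<theta> :: 't and \<mu> :: "('y \<times> 'x) measure"
  assumes finite_Z: "finite (space (z_space m))"
    and sets_Z: "sets (z_space m) = Pow (space (z_space m))"
    and \<mu>_prob: "\<mu> \<in> space (prob_algebra (z_space m))"
    and closed_nonempty: "closed_laws m \<theta> \<noteq> {}"
begin

abbreviation S :: "('y \<times> 'x) set" where "S \<equiv> space (z_space m)"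

lemma finite_support_law:
  assumes "\<nu> \<in> space (prob_algebra (z_space m))"
  shows "finite_support S \<nu>" "space \<nu> = S"
proof -
  have \<nu>: "sets \<nu> = sets (z_space m)" "prob_space \<nu>" using assms by (auto simp: space_prob_algebra)
  then show sp: "space \<nu> = S" by (auto dest: sets_eq_imp_space_eq)
  show "finite_support S \<nu>" by (rule finite_support.intro) (simp_all add: \<nu> sp finite_Z sets_Z)
qed

lemma integral_eq_lin:
  fixes \<phi> :: "'y \<times> 'x \<Rightarrow> real"
  assumes "\<nu> \<in> space (prob_algebra (z_space m))"
  shows "integral\<^sup>L \<nu> \<phi> = lin S (\<lambda>z. measure \<nu> {z}) \<phi>"
proof -
  interpret finite_support S \<nu> by (rule finite_support_law[OF assms])
  have "integral\<^sup>L \<nu> \<phi> = (\<integral>x. finite_comb S \<phi> x \<partial>\<nu>)"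
  proof (rule Bochner_Integration.integral_cong)
    fix x assume "x \<in> space \<nu>"
    then have "x \<in> S" using finite_support_law(2)[OF assms] by simp
    then show "\<phi> x = finite_comb S \<phi> x"
      using finite_S by (simp add: finite_comb_def indicator_def if_distrib[of "(*) _"] cong: if_cong)
  qed simp
  then show ?thesis by (simp add: integral_finite_comb lin_def)
qed

lemma closed_laws_subset: "\<nu> \<in> closed_laws m \<theta> \<Longrightarrow> \<nu> \<in> space (prob_algebra (z_space m))"
  by (simp add: closed_laws_def tv_closure_def)

lemma law_lin_lipschitz:
  fixes \<phi> \<psi> :: "'y \<times> 'x \<Rightarrow> real"
  assumes "\<nu> \<in> space (prob_algebra (z_space m))"
  shows "\<bar>integral\<^sup>L \<nu> \<phi> - integral\<^sup>L \<nu> \<psi>\<bar> \<le> l1 S (\<lambda>z. \<phi> z - \<psi> z)"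
proof -
  interpret finite_support S \<nu> by (rule finite_support_law[OF assms])
  have "integral\<^sup>L \<nu> \<phi> - integral\<^sup>L \<nu> \<psi> = (\<Sum>z\<in>S. (\<phi> z - \<psi> z) * measure \<nu> {z})"
    by (simp add: integral_eq_lin[OF assms] lin_def left_diff_distrib sum_subtractf)
  also have "\<bar>\<dots>\<bar> \<le> l1 S (\<lambda>z. \<phi> z - \<psi> z)"
    unfolding l1_def
    by (rule order_trans[OF sum_abs], rule sum_mono) (simp add: abs_mult mult_left_le)
  finally show ?thesis .
qed

text \<open>Minus the support function of the closed laws at \<phi>: the part of the criterion that
  involves neither data nor sampling law.\<close>

definition c :: "('y \<times> 'x \<Rightarrow> real) \<Rightarrow> real" where
  "c \<phi> = (INF \<nu>\<in>closed_laws m \<theta>. - integral\<^sup>L \<nu> \<phi>)"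

lemma bdd_below_shifted:
  fixes \<phi> :: "'y \<times> 'x \<Rightarrow> real"
  shows "bdd_below ((\<lambda>\<nu>. b - integral\<^sup>L \<nu> \<phi>) ` closed_laws m \<theta>)"
proof (rule bdd_belowI2[where m = "b - l1 S \<phi>"])
  fix \<nu> assume "\<nu> \<in> closed_laws m \<theta>"
  from law_lin_lipschitz[OF closed_laws_subset[OF this], of \<phi> "\<lambda>_. 0"]
  show "b - l1 S \<phi> \<le> b - integral\<^sup>L \<nu> \<phi>" by simp
qed

lemma eta_eq: "eta m \<theta> E \<phi> = E \<phi> + c \<phi>"
proof (rule antisym)
  have "eta m \<theta> E \<phi> - E \<phi> \<le> c \<phi>"
    unfolding c_def
  proof (rule cINF_greatest[OF closed_nonempty])
    fix \<nu> assume "\<nu> \<in> closed_laws m \<theta>"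
    from cINF_lower[OF bdd_below_shifted this, of "E \<phi>" \<phi>]
    show "eta m \<theta> E \<phi> - E \<phi> \<le> - integral\<^sup>L \<nu> \<phi>" by (simp add: eta_def)
  qed
  then show "eta m \<theta> E \<phi> \<le> E \<phi> + c \<phi>" by simp
  show "E \<phi> + c \<phi> \<le> eta m \<theta> E \<phi>"
    unfolding eta_def
  proof (rule cINF_greatest[OF closed_nonempty])
    fix \<nu> assume "\<nu> \<in> closed_laws m \<theta>"
    from cINF_lower[OF bdd_below_shifted this, of 0 \<phi>]
    show "E \<phi> + c \<phi> \<le> E \<phi> - integral\<^sup>L \<nu> \<phi>" by (simp add: c_def)
  qed
qed

lemma c_lipschitz: "\<bar>c \<phi> - c \<psi>\<bar> \<le> l1 S (\<lambda>z. \<phi> z - \<psi> z)"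
proof -
  have "c \<phi> - l1 S (\<lambda>z. \<phi> z - \<psi> z) \<le> c \<psi>" for \<phi> \<psi>
    unfolding c_def[of \<psi>]
  proof (rule cINF_greatest[OF closed_nonempty])
    fix \<nu> assume \<nu>: "\<nu> \<in> closed_laws m \<theta>"
    show "c \<phi> - l1 S (\<lambda>z. \<phi> z - \<psi> z) \<le> - integral\<^sup>L \<nu> \<psi>"
      using cINF_lower[OF bdd_below_shifted \<nu>, of 0 \<phi>] law_lin_lipschitz[OF closed_laws_subset[OF \<nu>], of \<phi> \<psi>]
      by (simp add: c_def abs_le_iff)
  qed
  from this[of \<phi> \<psi>] this[of \<psi> \<phi>] show ?thesis by (simp add: l1_def abs_minus_commute abs_le_iff)
qed

text \<open>The constant 2 has one unit from \<open>c\<close> and one from the expectation under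
  \<open>\<mu>\<close>.\<close>

sublocale contact_problem S "eta m \<theta> (integral\<^sup>L \<mu>)" 2
proof
  show "finite S" by (rule finite_Z)
  fix \<phi> \<psi>
  show "\<bar>eta m \<theta> (integral\<^sup>L \<mu>) \<phi> - eta m \<theta> (integral\<^sup>L \<mu>) \<psi>\<bar> \<le> 2 * l1 S (\<lambda>z. \<phi> z - \<psi> z)"
    using c_lipschitz[of \<phi> \<psi>] law_lin_lipschitz[OF \<mu>_prob, of \<phi> \<psi>] unfolding eta_eq by linarith
qed

abbreviation dev :: "nat \<Rightarrow> (nat \<Rightarrow> 'y \<times> 'x) \<Rightarrow> 'y \<times> 'x \<Rightarrow> real" where
  "dev n d z \<equiv> emp_mean n d (indicator {z}) - measure \<mu> {z}"

lemma test_functions_eq: "test_functions m = \<Phi>"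
  by (simp add: test_functions_def)

lemma contact_set_eq: "contact_set m \<theta> \<mu> = K"
  by (simp add: contact_set_def K_def T_def T_stat_def test_functions_eq)

lemma emp_mean_diff:
  assumes "\<forall>i<n. d i \<in> S"
  shows "emp_mean n d \<phi> - integral\<^sup>L \<mu> \<phi> = lin S (dev n d) \<phi>"
  by (simp add: emp_mean_eq_lin[OF finite_Z assms, of \<phi>] integral_eq_lin[OF \<mu>_prob] lin_diff)

lemma eta_emp_mean:
  assumes "\<forall>i<n. d i \<in> S"
  shows "eta m \<theta> (emp_mean n d) \<phi> = eta m \<theta> (integral\<^sup>L \<mu>) \<phi> + lin S (dev n d) \<phi>"
  using emp_mean_diff[OF assms, of \<phi>] by (simp add: eta_eq)

lemma T_stat_emp_mean:
  assumes "\<forall>i<n. d i \<in> S"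
  shows "T_stat m \<theta> (emp_mean n d) = (SUP \<phi>\<in>\<Phi>. eta m \<theta> (integral\<^sup>L \<mu>) \<phi> + lin S (dev n d) \<phi>)"
  by (simp add: T_stat_def test_functions_eq eta_emp_mean[OF assms])

text \<open>Taking \<nu> = \<mu> in the infimum shows that the population criterion is nonpositive.
  The left side plus l times the statistic is the supremum of (sqrt n + l) times the sample
  criterion; dropping sqrt n times the population part from it can only raise the supremum, and what
  remains is the one on the right.\<close>

lemma conservative_bound:
  assumes d: "\<forall>i<n. d i \<in> S" and "l \<ge> 0" and \<mu>: "\<mu> \<in> closed_laws m \<theta>"
  shows "sqrt (real n) * T_stat m \<theta> (emp_mean n d)
    \<le> (SUP \<phi>\<in>test_functions m. emp_process n d \<mu> \<phi> + l * eta m \<theta> (emp_mean n d) \<phi>)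
      - l * T_stat m \<theta> (emp_mean n d)"
proof -
  let ?e = "eta m \<theta> (integral\<^sup>L \<mu>)" and ?u = "dev n d"
  have e: "?e \<phi> \<le> 0" for \<phi>
    using cINF_lower[OF bdd_below_shifted \<mu>, of "integral\<^sup>L \<mu> \<phi>" \<phi>] by (simp add: eta_def)
  have proc: "emp_process n d \<mu> \<phi> = lin S (\<lambda>z. sqrt (real n) * ?u z) \<phi>" for \<phi>
    unfolding emp_process_def emp_mean_diff[OF d] by (simp add: lin_def sum_distrib_left mult_ac)
  have "(sqrt (real n) + l) * T_stat m \<theta> (emp_mean n d)
      = (SUP \<phi>\<in>\<Phi>. (sqrt (real n) + l) * (?e \<phi> + lin S ?u \<phi>) + 0)"
    unfolding T_stat_emp_mean[OF d]
    using assms(2) cSUP_affine[OF \<Phi>_nonempty bdd_above_perturbed, of "sqrt (real n) + l" ?u 0] by simp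
  also have "\<dots> \<le> (SUP \<phi>\<in>\<Phi>. lin S (\<lambda>z. sqrt (real n) * ?u z) \<phi> + l * (?e \<phi> + lin S ?u \<phi>)) + 0"
  proof (rule cSUP_diff_le[OF \<Phi>_nonempty bdd_above_perturbed_penalized[OF assms(2)]])
    fix \<phi>
    have "sqrt (real n) * ?e \<phi> \<le> 0" using e by (simp add: mult_nonneg_nonpos)
    moreover have "lin S (\<lambda>z. sqrt (real n) * ?u z) \<phi> = sqrt (real n) * lin S ?u \<phi>"
      by (simp add: lin_def sum_distrib_left mult_ac)
    ultimately show "(sqrt (real n) + l) * (?e \<phi> + lin S ?u \<phi>) + 0
      \<le> lin S (\<lambda>z. sqrt (real n) * ?u z) \<phi> + l * (?e \<phi> + lin S ?u \<phi>) + 0"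
      by (simp add: distrib_right distrib_left)
  qed
  finally show ?thesis
    by (simp add: test_functions_eq proc eta_emp_mean[OF d] distrib_right)
qed

lemma scaled_statistic:
  assumes "\<forall>i<n. d i \<in> S"
  shows "sqrt (real n) * (T_stat m \<theta> (emp_mean n d) - T_stat m \<theta> (integral\<^sup>L \<mu>))
    = penalized (sqrt (real n)) (freq_dev n d \<mu>)"
proof -
  have "T_stat m \<theta> (integral\<^sup>L \<mu>) = T" by (simp add: T_stat_def T_def test_functions_eq)
  then show ?thesis
    unfolding T_stat_emp_mean[OF assms] by (simp add: scaled_sup_diff freq_dev_def[abs_def])
qed

section \<open>The bootstrap statistic and the resampling law\<close>

definition boot_stat :: "real \<Rightarrow> nat \<Rightarrow> (nat \<Rightarrow> 'y \<times> 'x) \<Rightarrow> (nat \<Rightarrow> 'y \<times> 'x) \<Rightarrow> real" where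
  "boot_stat l n d zs = (SUP \<phi>\<in>test_functions m. boot_process n d zs \<phi> + l * eta m \<theta> (emp_mean n d) \<phi>)
     - l * T_stat m \<theta> (emp_mean n d)"

definition boot_pmf :: "nat \<Rightarrow> (nat \<Rightarrow> 'y \<times> 'x) \<Rightarrow> ('y \<times> 'x) pmf" where
  "boot_pmf n d = map_pmf d (pmf_of_set {..<n})"

lemma measure_boot_pmf:
  assumes "n \<ge> 1"
  shows "measure (measure_pmf (boot_pmf n d)) {z} = emp_mean n d (indicator {z})"
proof -
  have "{..<n} \<noteq> {}" using assms by (auto simp: lessThan_empty_iff)
  then have "measure (measure_pmf (boot_pmf n d)) {z} = real (card ({..<n} \<inter> d -` {z})) / real n"
    unfolding boot_pmf_def by (simp add: measure_pmf_of_set)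
  moreover have "(\<Sum>i<n. indicator {z} (d i) :: real) = card ({..<n} \<inter> d -` {z})"
    by (simp add: indicator_def sum.If_cases Int_def vimage_def)
  ultimately show ?thesis by (simp add: emp_mean_def)
qed

text \<open>The atoms of the resampling law are the sample frequencies, so the bootstrap process is
  exactly linear in the deviations of the resample. The only error is that of centring the penalty
  at the sample criterion, and \<open>perturbed_penalized\<close> bounds it.\<close>

lemma boot_stat_close:
  assumes n: "n \<ge> 1" and d: "\<forall>i<n. d i \<in> S" and l: "l \<ge> 0"
    and zs: "\<forall>i<n. zs i \<in> S"
  shows "\<bar>boot_stat l n d zs - penalized l (freq_dev n zs (measure_pmf (boot_pmf n d)))\<bar> \<le> 2 * l * l1 S (dev n d)"
proof -
  have "boot_process n d zs \<phi> = lin S (freq_dev n zs (measure_pmf (boot_pmf n d))) \<phi>" for \<phi>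
  proof -
    have "emp_mean n zs \<phi> - emp_mean n d \<phi> = lin S (\<lambda>z. emp_mean n zs (indicator {z}) - measure (measure_pmf (boot_pmf n d)) {z}) \<phi>"
      by (simp add: emp_mean_eq_lin[OF finite_Z zs, of \<phi>]
          emp_mean_eq_lin[OF finite_Z d, of \<phi>] lin_diff measure_boot_pmf[OF n])
    then show ?thesis
      by (simp add: boot_process_def freq_dev_def[abs_def] lin_def sum_distrib_left mult_ac)
  qed
  then show ?thesis
    unfolding boot_stat_def T_stat_emp_mean[OF d] test_functions_eq eta_emp_mean[OF d]
    using perturbed_penalized[OF l, of "freq_dev n zs (measure_pmf (boot_pmf n d))" "dev n d"] by simp
qed

lemma finite_support_boot: "finite_support S (measure_pmf (boot_pmf n d))"
  by (rule finite_support.intro) (simp_all add: finite_Z measure_pmf.prob_space_axioms)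

lemma iid_draws_boot:
  "iid_draws (measure_pmf (Pi_pmf {..<n} undefined (\<lambda>_. p))) (\<lambda>i zs. zs i) n (measure_pmf p)"
proof -
  let ?P = "measure_pmf (Pi_pmf {..<n} undefined (\<lambda>_. p))"
  have "prob_space.indep_vars ?P (\<lambda>_. measure_pmf p) (\<lambda>i zs. zs i) {..<n}
      \<longleftrightarrow> prob_space.indep_vars ?P (\<lambda>_. count_space UNIV) (\<lambda>i zs. zs i) {..<n}"
    by (simp add: prob_space.indep_vars_def[OF measure_pmf.prob_space_axioms])
  moreover have "distr ?P (measure_pmf p) (\<lambda>zs. zs i) = measure_pmf p" if "i < n" for i
  proof -
    have "distr ?P (measure_pmf p) (\<lambda>zs. zs i) = distr ?P (count_space UNIV) (\<lambda>zs. zs i)"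
      by (intro distr_cong) auto
    also have "\<dots> = measure_pmf (map_pmf (\<lambda>zs. zs i) (Pi_pmf {..<n} undefined (\<lambda>_. p)))"
      by (simp add: map_pmf_rep_eq)
    finally show ?thesis using that by (simp add: Pi_pmf_component)
  qed
  ultimately show ?thesis
    by (simp add: iid_draws_def indep_vars_Pi_pmf measure_pmf.prob_space_axioms)
qed

lemma boot_draws_in_support:
  assumes "n \<ge> 1" "\<forall>i<n. d i \<in> S"
  shows "AE zs in measure_pmf (Pi_pmf {..<n} undefined (\<lambda>_. boot_pmf n d)). \<forall>i<n. zs i \<in> S"
proof -
  have "{..<n} \<noteq> {}" using assms(1) by (auto simp: lessThan_empty_iff)
  then have "set_pmf (boot_pmf n d) \<subseteq> S" using assms(2) by (auto simp: boot_pmf_def)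
  then show ?thesis
    by (auto simp: AE_measure_pmf_iff set_Pi_pmf PiE_dflt_def)
qed

end

section \<open>The conditional limit of the bootstrap\<close>

context finite_model
begin

text \<open>For n \<ge> 1 and positive \<open>lam n\<close> the three nonnegative terms ask in turn
  for a growing sample size, for frequencies close to \<open>\<mu>\<close>, and for an estimated
  penalty close to the true one. Their sum packs these demands into one number, to which Markov's
  inequality applies.\<close>

definition boot_rate :: "(nat \<Rightarrow> real) \<Rightarrow> nat \<times> (nat \<Rightarrow> 'y \<times> 'x) \<Rightarrow> real" where
  "boot_rate lam i = 1 / real (fst i) + l1 S (dev (fst i) (snd i)) + lam (fst i) * l1 S (dev (fst i) (snd i))"

text \<open>The bootstrap limit is taken along all pairs of a sample size and a data sequence for which
  \<open>boot_rate\<close> tends to zero; about the random data one then only needs that \<open>boot_rate\<close> tends to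
  zero in probability.\<close>

definition data_filter :: "(nat \<Rightarrow> real) \<Rightarrow> (nat \<times> (nat \<Rightarrow> 'y \<times> 'x)) filter" where
  "data_filter lam = inf (filtercomap (boot_rate lam) (nhds 0))
     (principal {i. fst i \<ge> 1 \<and> (\<forall>k<fst i. snd i k \<in> S)})"

text \<open>This form connects the filter with probability: data that violate an eventual property
  must have rate at least \<delta>.\<close>

lemma eventually_data_filter:
  "eventually Q (data_filter lam) \<longleftrightarrow>
    (\<exists>\<delta>>0. \<forall>n d. n \<ge> 1 \<longrightarrow> (\<forall>k<n. d k \<in> S) \<longrightarrow> \<bar>boot_rate lam (n, d)\<bar> < \<delta> \<longrightarrow> Q (n, d))"
  unfolding data_filter_def eventually_inf_principal eventually_filtercomap eventually_nhds_metric
proof safe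
  fix R and \<delta> :: real assume "\<delta> > 0" "\<forall>x. dist x 0 < \<delta> \<longrightarrow> R x"
    "\<forall>i. R (boot_rate lam i) \<longrightarrow> i \<in> {i. fst i \<ge> 1 \<and> (\<forall>k<fst i. snd i k \<in> S)} \<longrightarrow> Q i"
  then show "\<exists>\<delta>>0. \<forall>n d. n \<ge> 1 \<longrightarrow> (\<forall>k<n. d k \<in> S) \<longrightarrow> \<bar>boot_rate lam (n, d)\<bar> < \<delta> \<longrightarrow> Q (n, d)"
    by (intro exI[of _ \<delta>]) (simp add: dist_real_def)
next
  fix \<delta> :: real assume "\<delta> > 0"
    "\<forall>n d. n \<ge> 1 \<longrightarrow> (\<forall>k<n. d k \<in> S) \<longrightarrow> \<bar>boot_rate lam (n, d)\<bar> < \<delta> \<longrightarrow> Q (n, d)"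
  then show "\<exists>R. (\<exists>\<delta>>0. \<forall>x. dist x 0 < \<delta> \<longrightarrow> R x) \<and>
      (\<forall>i. R (boot_rate lam i) \<longrightarrow> i \<in> {i. fst i \<ge> 1 \<and> (\<forall>k<fst i. snd i k \<in> S)} \<longrightarrow> Q i)"
    by (intro exI[of _ "\<lambda>x. \<bar>x\<bar> < \<delta>"]) (auto simp: dist_real_def)
qed

lemma boot_law_tendsto:
  assumes gauss: "centered_gaussian N S \<xi> (multinomial_cov \<mu>)"
    and pos: "\<forall>n\<ge>1. lam n > 0" and lam: "filterlim lam at_top sequentially"
  shows "((\<lambda>i. d_BL (boot_law (fst i) (snd i) (boot_stat (lam (fst i)) (fst i) (snd i)))
      (distr N borel (\<lambda>\<omega>. contact_sup (\<lambda>z. \<xi> z \<omega>)))) \<longlongrightarrow> 0) (data_filter lam)"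
proof -
  let ?F = "data_filter lam" and ?r = "boot_rate lam"
  define Pb where "Pb i = measure_pmf (Pi_pmf {..<fst i} undefined (\<lambda>_. boot_pmf (fst i) (snd i)))"
    for i :: "nat \<times> (nat \<Rightarrow> 'y \<times> 'x)"
  have ev: "\<forall>\<^sub>F i in ?F. fst i \<ge> 1 \<and> (\<forall>k<fst i. snd i k \<in> S)"
    unfolding eventually_data_filter by (intro exI[of _ 1]) simp
  have r: "(?r \<longlongrightarrow> 0) ?F"
    unfolding data_filter_def by (rule filterlim_mono[OF filterlim_filtercomap order_refl inf_le1])
  \<comment> \<open>Each summand is dominated by the total because the others are nonnegative; this
    uses n \<ge> 1, where \<open>lam\<close> is positive.\<close>
  have parts: "\<forall>\<^sub>F i in ?F. 1 / real (fst i) \<le> ?r i \<and> l1 S (dev (fst i) (snd i)) \<le> ?r i \<and>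
      lam (fst i) * l1 S (dev (fst i) (snd i)) \<le> ?r i"
    using ev
  proof eventually_elim
    case (elim i)
    have "0 \<le> lam (fst i) * l1 S (dev (fst i) (snd i))"
      using elim pos by (intro mult_nonneg_nonneg l1_nonneg) (auto intro: less_imp_le)
    then show ?case
      using l1_nonneg[of S "dev (fst i) (snd i)"] by (simp add: boot_rate_def)
  qed
  have n: "filterlim fst sequentially ?F"
    unfolding filterlim_at_top
  proof
    fix N :: nat
    have "\<forall>\<^sub>F i in ?F. ?r i < 1 / (real N + 1)"
      by (rule order_tendstoD(2)[OF r]) simp
    then show "\<forall>\<^sub>F i in ?F. N \<le> fst i"
      using parts ev
    proof eventually_elim
      case (elim i)
      then have "1 / real (fst i) < 1 / (real N + 1)" by linarith
      then have "real N + 1 < real (fst i)"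
        using elim by (simp add: divide_less_eq less_divide_eq)
      then show ?case by simp
    qed
  qed
  show ?thesis
    unfolding boot_law_def boot_pmf_def[symmetric]
  proof (rule tendsto_d_BL_contact_sup[where P = Pb and \<xi> = \<xi> and N = N and \<mu> = \<mu> and X = "\<lambda>i k zs. zs k"
        and n = fst and Q = "\<lambda>i. measure_pmf (boot_pmf (fst i) (snd i))" and \<kappa> = "\<lambda>i. lam (fst i)"
        and err = "\<lambda>i. 2 * ?r i" and Y = "\<lambda>i. boot_stat (lam (fst i)) (fst i) (snd i)", unfolded Pb_def])
    show "finite_support S \<mu>" by (rule finite_support_law[OF \<mu>_prob])
    show "centered_gaussian N S \<xi> (multinomial_cov \<mu>)" by (rule gauss)
    show "filterlim (\<lambda>i. lam (fst i)) at_top ?F" by (rule filterlim_compose[OF lam n])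
    show "filterlim fst sequentially ?F" by (rule n)
    show "((\<lambda>i. 2 * ?r i) \<longlongrightarrow> 0) ?F" using tendsto_mult_left[OF r, of 2] by simp
    show "((\<lambda>i. measure (measure_pmf (boot_pmf (fst i) (snd i))) {z}) \<longlongrightarrow> measure \<mu> {z}) ?F" if z: "z \<in> S" for z
    proof (rule LIM_zero_cancel, rule Lim_null_comparison[OF _ r])
      show "\<forall>\<^sub>F i in ?F. norm (measure (measure_pmf (boot_pmf (fst i) (snd i))) {z} - measure \<mu> {z}) \<le> ?r i"
        using ev parts
      proof eventually_elim
        case (elim i)
        have "\<bar>dev (fst i) (snd i) z\<bar> \<le> l1 S (dev (fst i) (snd i))"
          unfolding l1_def using z finite_Z by (intro member_le_sum) auto
        then show ?case using elim by (simp add: measure_boot_pmf)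
      qed
    qed
    show "\<forall>\<^sub>F i in ?F. AE zs in measure_pmf (Pi_pmf {..<fst i} undefined (\<lambda>_. boot_pmf (fst i) (snd i))).
      \<bar>boot_stat (lam (fst i)) (fst i) (snd i) zs
        - penalized (lam (fst i)) (freq_dev (fst i) (\<lambda>k. zs k) (measure_pmf (boot_pmf (fst i) (snd i))))\<bar> \<le> 2 * ?r i"
      using ev parts
    proof eventually_elim
      case (elim i)
      have "AE zs in measure_pmf (Pi_pmf {..<fst i} undefined (\<lambda>_. boot_pmf (fst i) (snd i))). \<forall>k<fst i. zs k \<in> S"
        using elim by (intro boot_draws_in_support) auto
      then show ?case
      proof eventually_elim
        case (elim zs)
        have "0 \<le> lam (fst i)" using pos \<open>1 \<le> fst i \<and> _\<close> by (auto intro: less_imp_le)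
        from boot_stat_close[OF _ _ this elim, of "snd i"] \<open>1 \<le> fst i \<and> _\<close> \<open>1 / real (fst i) \<le> _ \<and> _\<close>
        show ?case by simp
      qed
    qed
  qed (auto simp: finite_support_boot iid_draws_boot)
qed

lemma boot_law_cong:
  assumes "\<forall>i<n. d i = d' i"
  shows "boot_law n d (boot_stat l n d) = boot_law n d' (boot_stat l n d')"
proof -
  have "emp_mean n d = emp_mean n d'" using assms by (intro emp_mean_cong) auto
  then have "boot_stat l n d = boot_stat l n d'"
    by (intro ext) (simp add: boot_stat_def boot_process_def)
  \<comment> \<open>At n = 0 the uniform law on the empty set is unspecified, but a product over no
    draws ignores it.\<close>
  moreover have "map_pmf d (pmf_of_set {..<n}) = map_pmf d' (pmf_of_set {..<n})" if "n \<noteq> 0"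
    using that assms by (intro map_pmf_cong) (auto simp: set_pmf_of_set lessThan_empty_iff)
  ultimately show ?thesis by (cases "n = 0") (simp_all add: boot_law_def)
qed

context
  fixes M :: "'o measure" and Zs :: "nat \<Rightarrow> 'o \<Rightarrow> 'y \<times> 'x"
  assumes sample: "iid_sample M Zs \<mu>"
begin

lemma prob_M: "prob_space M"
  using sample by (simp add: iid_sample_def)

lemma space_\<mu>: "space \<mu> = S"
  by (rule finite_support_law(2)[OF \<mu>_prob])

lemma measurable_Zs: "Zs i \<in> measurable M \<mu>"
  using sample by (simp add: iid_sample_def prob_space.indep_vars_def[OF prob_M])

lemma Zs_in_S: "\<omega> \<in> space M \<Longrightarrow> Zs i \<omega> \<in> S"
  using measurable_space[OF measurable_Zs] space_\<mu> by auto

lemma iid_draws_sample: "iid_draws M Zs n \<mu>"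
  using sample prob_space.indep_vars_subset[OF prob_M, of "\<lambda>_. \<mu>" Zs UNIV "{..<n}"]
  by (auto simp: iid_draws_def iid_sample_def)

lemma measurable_sample_functional:
  fixes f :: "(nat \<Rightarrow> 'y \<times> 'x) \<Rightarrow> real"
  assumes "\<And>d d'. \<forall>i<n. d i = d' i \<Longrightarrow> f d = f d'"
  shows "(\<lambda>\<omega>. f (\<lambda>i. Zs i \<omega>)) \<in> borel_measurable M"
proof (rule borel_measurable_finite_sample[where Zs = Zs and n = n, OF measurable_Zs])
  show "finite (space \<mu>)" "sets \<mu> = Pow (space \<mu>)"
    using finite_Z sets_Z \<mu>_prob by (simp_all add: space_\<mu> space_prob_algebra)
  fix \<omega> \<omega>' assume "\<And>i. i < n \<Longrightarrow> Zs i \<omega> = Zs i \<omega>'"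
  then show "f (\<lambda>i. Zs i \<omega>) = f (\<lambda>i. Zs i \<omega>')" by (intro assms) simp
qed

lemma statistic_converges:
  assumes gauss: "centered_gaussian N S \<xi> (multinomial_cov \<mu>)"
  shows "converges_in_law M
    (\<lambda>n \<omega>. sqrt (real n) * (T_stat m \<theta> (emp_mean n (\<lambda>i. Zs i \<omega>)) - T_stat m \<theta> (integral\<^sup>L \<mu>)))
    N (\<lambda>\<omega>. contact_sup (\<lambda>z. \<xi> z \<omega>))"
  unfolding converges_in_law_def
proof (intro conjI allI)
  note \<mu> = finite_support_law(1)[OF \<mu>_prob]
  let ?Y = "\<lambda>n \<omega>. sqrt (real n) * (T_stat m \<theta> (emp_mean n (\<lambda>i. Zs i \<omega>)) - T_stat m \<theta> (integral\<^sup>L \<mu>))"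
  show Y: "?Y n \<in> borel_measurable M" for n
  proof (rule measurable_sample_functional)
    fix d d' :: "nat \<Rightarrow> 'y \<times> 'x" assume "\<forall>i<n. d i = d' i"
    then have "emp_mean n d = emp_mean n d'" by (intro emp_mean_cong) auto
    then show "sqrt (real n) * (T_stat m \<theta> (emp_mean n d) - T_stat m \<theta> (integral\<^sup>L \<mu>))
      = sqrt (real n) * (T_stat m \<theta> (emp_mean n d') - T_stat m \<theta> (integral\<^sup>L \<mu>))" by simp
  qed
  show "(\<lambda>\<omega>. contact_sup (\<lambda>z. \<xi> z \<omega>)) \<in> borel_measurable N"
    using centered_gaussian_facts(2)[OF \<mu> gauss] by (rule contact_sup_measurable)
  show "(\<lambda>n. d_BL (distr M borel (?Y n)) (distr N borel (\<lambda>\<omega>. contact_sup (\<lambda>z. \<xi> z \<omega>)))) \<longlonglongrightarrow> 0"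
  \<comment> \<open>The error is zero because \<open>scaled_statistic\<close> is an identity on data
    with values in \<open>S\<close>.\<close>
  proof (rule tendsto_d_BL_contact_sup[where P = "\<lambda>_. M" and \<xi> = \<xi> and N = N and \<mu> = \<mu> and X = "\<lambda>_. Zs"
        and n = "\<lambda>n. n" and Q = "\<lambda>_. \<mu>" and \<kappa> = "\<lambda>n. sqrt (real n)" and err = "\<lambda>_. 0" and Y = ?Y])
    show "filterlim (\<lambda>n. sqrt (real n)) at_top sequentially"
      by (rule filterlim_compose[OF sqrt_at_top filterlim_real_sequentially])
    show "\<forall>\<^sub>F n in sequentially. AE \<omega> in M. \<bar>?Y n \<omega> - penalized (sqrt (real n)) (freq_dev n (\<lambda>k. Zs k \<omega>) \<mu>)\<bar> \<le> 0"
      using Zs_in_S by (intro always_eventually allI AE_I2) (simp add: scaled_statistic)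
  qed (use \<mu> gauss Y iid_draws_sample in \<open>auto simp: filterlim_ident\<close>)
qed

text \<open>This is where \<lambda>_n = o(sqrt n) enters: the deviation of the frequencies is 1/sqrt
  n times a vector with bounded second moments, so the last term of the rate is of order \<lambda>_n
  / sqrt n in mean.\<close>

lemma boot_rate_prob:
  assumes pos: "\<forall>n\<ge>1. lam n > 0" and small: "lam \<in> o(\<lambda>n. sqrt (real n))" and \<delta>: "\<delta> > 0"
  shows "(\<lambda>n. measure M {\<omega> \<in> space M. boot_rate lam (n, \<lambda>i. Zs i \<omega>) \<ge> \<delta>}) \<longlonglongrightarrow> 0"
proof -
  interpret M: prob_space M by (rule prob_M)
  interpret \<mu>: finite_support S \<mu> by (rule finite_support_law[OF \<mu>_prob])
  define B where "B = 1 + (card S)\<^sup>2 * (4::real)"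
  have iid: "M.indep_vars (\<lambda>_. \<mu>) Zs {..<n}" "\<And>i. i < n \<Longrightarrow> distr M \<mu> (Zs i) = \<mu>" for n
    using iid_draws_sample[of n] by (auto simp: iid_draws_def)
  let ?V = "\<lambda>n z \<omega>. freq_dev n (\<lambda>i. Zs i \<omega>) \<mu> z"
  have V: "?V n z \<in> borel_measurable M" for n z
    using \<mu>.borel_measurable_freq_dev[OF prob_M iid] by simp
  have mom: "integrable M (\<lambda>\<omega>. (?V n z \<omega>)\<^sup>2)" "(\<integral>\<omega>. (?V n z \<omega>)\<^sup>2 \<partial>M) \<le> 4" if "z \<in> S" for n z
    using \<mu>.freq_dev_moment[OF prob_M iid that] by simp_all
  have sq: "integrable M (\<lambda>\<omega>. (l1 S (\<lambda>z. ?V n z \<omega>))\<^sup>2)"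
    "(\<integral>\<omega>. (l1 S (\<lambda>z. ?V n z \<omega>))\<^sup>2 \<partial>M) \<le> (card S)\<^sup>2 * 4" for n
    using integral_l1_square[where V = "?V n", OF prob_M mom(1) V mom(2)] by simp_all
  \<comment> \<open>Trades the first power for the second, whose mean is bounded uniformly in
    \<open>n\<close>.\<close>
  have le: "l1 S v \<le> 1 + (l1 S v)\<^sup>2" for v
  proof -
    have "0 \<le> (l1 S v - 1 / 2)\<^sup>2" by simp
    then show ?thesis by (simp add: power2_eq_square algebra_simps)
  qed
  define b where "b n = (1 / real n + (1 / sqrt (real n) + lam n / sqrt (real n)) * B) / \<delta>" for n
  have bound: "measure M {\<omega> \<in> space M. boot_rate lam (n, \<lambda>i. Zs i \<omega>) \<ge> \<delta>} \<le> b n" if n: "n \<ge> 1" for n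
  proof -
    let ?g = "\<lambda>\<omega>. 1 / real n + (1 / sqrt (real n) + lam n / sqrt (real n)) * (1 + (l1 S (\<lambda>z. ?V n z \<omega>))\<^sup>2)"
    have "0 \<le> lam n" using pos n by (auto intro: less_imp_le)
    then have k: "0 \<le> 1 / sqrt (real n) + lam n / sqrt (real n)" by simp
    have g: "integrable M ?g" using sq(1) by auto
    have "boot_rate lam (n, \<lambda>i. Zs i \<omega>) \<le> ?g \<omega>" for \<omega>
    proof -
      have "l1 S (\<lambda>z. ?V n z \<omega>) = sqrt (real n) * l1 S (dev n (\<lambda>i. Zs i \<omega>))"
        by (simp add: l1_def freq_dev_def abs_mult sum_distrib_left)
      then have "l1 S (dev n (\<lambda>i. Zs i \<omega>)) = l1 S (\<lambda>z. ?V n z \<omega>) / sqrt (real n)"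
        using n by simp
      then have "boot_rate lam (n, \<lambda>i. Zs i \<omega>)
          = 1 / real n + (1 / sqrt (real n) + lam n / sqrt (real n)) * l1 S (\<lambda>z. ?V n z \<omega>)"
        by (simp add: boot_rate_def distrib_right)
      also have "\<dots> \<le> ?g \<omega>" using k le by (intro add_left_mono mult_left_mono)
      finally show ?thesis .
    qed
    then have "measure M {\<omega> \<in> space M. boot_rate lam (n, \<lambda>i. Zs i \<omega>) \<ge> \<delta>} \<le> measure M {\<omega> \<in> space M. ?g \<omega> \<ge> \<delta>}"
      using g by (intro M.finite_measure_mono) (auto intro: order_trans)
    also have "\<dots> \<le> (\<integral>\<omega>. ?g \<omega> \<partial>M) / \<delta>"
      using k \<delta> by (intro integral_Markov_inequality_measure[OF g sets.empty_sets])
        (auto intro!: AE_I2 add_nonneg_nonneg mult_nonneg_nonneg)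
    also have "(\<integral>\<omega>. ?g \<omega> \<partial>M) = 1 / real n + (1 / sqrt (real n) + lam n / sqrt (real n)) * (1 + (\<integral>\<omega>. (l1 S (\<lambda>z. ?V n z \<omega>))\<^sup>2 \<partial>M))"
      using sq(1) M.prob_space by simp
    also have "\<dots> \<le> 1 / real n + (1 / sqrt (real n) + lam n / sqrt (real n)) * B"
      using k sq(2)[of n] by (intro add_left_mono mult_left_mono) (auto simp: B_def)
    finally show ?thesis using \<delta> by (simp add: b_def divide_right_mono)
  qed
  have b: "b \<longlonglongrightarrow> 0"
  proof -
    have "(\<lambda>n. lam n / sqrt (real n)) \<longlonglongrightarrow> 0" by (rule smalloD_tendsto[OF small])
    moreover have "(\<lambda>n. 1 / sqrt (real n)) \<longlonglongrightarrow> 0"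
      by (rule real_tendsto_divide_at_top[OF tendsto_const filterlim_compose[OF sqrt_at_top filterlim_real_sequentially]])
    ultimately have "b \<longlonglongrightarrow> (0 + (0 + 0) * B) / \<delta>"
      unfolding b_def[abs_def] using \<delta> by (intro tendsto_intros lim_1_over_n) auto
    then show ?thesis by simp
  qed
  show ?thesis
  proof (rule tendsto_sandwich[OF _ _ tendsto_const b])
    show "\<forall>\<^sub>F n in sequentially. measure M {\<omega> \<in> space M. boot_rate lam (n, \<lambda>i. Zs i \<omega>) \<ge> \<delta>} \<le> b n"
      by (rule eventually_sequentiallyI[of 1]) (rule bound)
  qed simp
qed

text \<open>The limit along \<open>data_filter\<close> is a deterministic statement about data
  sequences. For each \<epsilon> it supplies a \<delta>, so the event of a distance above \<epsilon>
  lies in the event of a rate of at least \<delta>, whose probability vanishes.\<close>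

lemma bootstrap_converges:
  assumes gauss: "centered_gaussian N S \<xi> (multinomial_cov \<mu>)"
    and pos: "\<forall>n\<ge>1. lam n > 0" and lam: "filterlim lam at_top sequentially"
    and small: "lam \<in> o(\<lambda>n. sqrt (real n))"
  shows "converges_in_cond_law M
    (\<lambda>n \<omega>. boot_law n (\<lambda>i. Zs i \<omega>) (boot_stat (lam n) n (\<lambda>i. Zs i \<omega>)))
    N (\<lambda>\<omega>. contact_sup (\<lambda>z. \<xi> z \<omega>))"
  unfolding converges_in_cond_law_def converges_in_prob_def
proof (intro conjI allI impI)
  interpret M: prob_space M by (rule prob_M)
  note \<mu> = finite_support_law(1)[OF \<mu>_prob]
  show "(\<lambda>\<omega>. contact_sup (\<lambda>z. \<xi> z \<omega>)) \<in> borel_measurable N"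
    using centered_gaussian_facts(2)[OF \<mu> gauss] by (rule contact_sup_measurable)
  let ?\<nu> = "distr N borel (\<lambda>\<omega>. contact_sup (\<lambda>z. \<xi> z \<omega>))"
  let ?D = "\<lambda>n d. d_BL (boot_law n d (boot_stat (lam n) n d)) ?\<nu>"
  show "(\<lambda>\<omega>. ?D n (\<lambda>i. Zs i \<omega>)) \<in> borel_measurable M" for n
  proof (rule measurable_sample_functional)
    fix d d' :: "nat \<Rightarrow> 'y \<times> 'x" assume "\<forall>i<n. d i = d' i"
    from boot_law_cong[OF this] show "?D n d = ?D n d'" by simp
  qed
  fix \<epsilon> :: real assume \<epsilon>: "\<epsilon> > 0"
  have "\<forall>\<^sub>F i in data_filter lam. dist (?D (fst i) (snd i)) 0 < \<epsilon>"
    using boot_law_tendsto[OF gauss pos lam] \<epsilon> by (rule tendstoD)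
  then obtain \<delta> where \<delta>: "\<delta> > 0"
    and D: "\<And>n d. n \<ge> 1 \<Longrightarrow> \<forall>k<n. d k \<in> S \<Longrightarrow> \<bar>boot_rate lam (n, d)\<bar> < \<delta> \<Longrightarrow> \<bar>?D n d\<bar> < \<epsilon>"
    unfolding eventually_data_filter by (auto simp: dist_real_def)
  have rate_nonneg: "0 \<le> boot_rate lam (n, d)" if "n \<ge> 1" for n d
  proof -
    have "0 \<le> lam n" using pos that by (auto intro: less_imp_le)
    then show ?thesis by (simp add: boot_rate_def l1_nonneg)
  qed
  have rate_meas: "(\<lambda>\<omega>. boot_rate lam (n, \<lambda>i. Zs i \<omega>)) \<in> borel_measurable M" for n
  proof (rule measurable_sample_functional)
    fix d d' :: "nat \<Rightarrow> 'y \<times> 'x" assume "\<forall>i<n. d i = d' i"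
    then have "emp_mean n d = emp_mean n d'" by (intro emp_mean_cong) auto
    then show "boot_rate lam (n, d) = boot_rate lam (n, d')" by (simp add: boot_rate_def)
  qed
  have bound: "measure M {\<omega> \<in> space M. \<bar>?D n (\<lambda>i. Zs i \<omega>) - 0\<bar> > \<epsilon>}
      \<le> measure M {\<omega> \<in> space M. boot_rate lam (n, \<lambda>i. Zs i \<omega>) \<ge> \<delta>}" if n: "n \<ge> 1" for n
  proof (rule M.finite_measure_mono)
    show "{\<omega> \<in> space M. boot_rate lam (n, \<lambda>i. Zs i \<omega>) \<ge> \<delta>} \<in> sets M"
      using rate_meas by measurable
    show "{\<omega> \<in> space M. \<bar>?D n (\<lambda>i. Zs i \<omega>) - 0\<bar> > \<epsilon>} \<subseteq> {\<omega> \<in> space M. boot_rate lam (n, \<lambda>i. Zs i \<omega>) \<ge> \<delta>}"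
    proof safe
      fix \<omega> assume \<omega>: "\<omega> \<in> space M" "\<epsilon> < \<bar>?D n (\<lambda>i. Zs i \<omega>) - 0\<bar>"
      show "\<delta> \<le> boot_rate lam (n, \<lambda>i. Zs i \<omega>)"
      proof (rule ccontr)
        assume "\<not> ?thesis"
        then have "\<bar>boot_rate lam (n, \<lambda>i. Zs i \<omega>)\<bar> < \<delta>" using rate_nonneg[OF n, of "\<lambda>i. Zs i \<omega>"] by simp
        with D[OF n _ this] \<omega> Zs_in_S show False by auto
      qed
    qed
  qed
  show "(\<lambda>n. measure M {\<omega> \<in> space M. \<epsilon> < \<bar>?D n (\<lambda>i. Zs i \<omega>) - 0\<bar>}) \<longlonglongrightarrow> 0"
  proof (rule tendsto_sandwich[OF _ _ tendsto_const boot_rate_prob[OF pos small \<delta>]])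
    show "\<forall>\<^sub>F n in sequentially. measure M {\<omega> \<in> space M. \<epsilon> < \<bar>?D n (\<lambda>i. Zs i \<omega>) - 0\<bar>}
        \<le> measure M {\<omega> \<in> space M. boot_rate lam (n, \<lambda>i. Zs i \<omega>) \<ge> \<delta>}"
      by (rule eventually_sequentiallyI[of 1]) (rule bound)
  qed simp
qed

end

end

theorem proposition1:
  fixes m :: "('y, 'x, 'u, 'j, 'k, 't) moment_model"
    and P :: "('y \<times> 'x) measure set"
    and \<mu> :: "('y \<times> 'x) measure"
    and M :: "'o measure"
    and Zs :: "nat \<Rightarrow> 'o \<Rightarrow> 'y \<times> 'x"
    and lam :: "nat \<Rightarrow> real"
  assumes "well_formed_model m"
    and "finite (space (z_space m))"
    and "sets (z_space m) = Pow (space (z_space m))"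
    and "P \<subseteq> space (prob_algebra (z_space m))"
    and "\<mu> \<in> P"
    and "iid_sample M Zs \<mu>"
    and "\<forall>n\<ge>1. lam n > 0"
  shows
    "(\<forall>n\<ge>1. \<forall>\<theta>\<in>identified_set m \<mu>. \<forall>\<omega>\<in>space M.
        sqrt (real n) * T_stat m \<theta> (emp_mean n (\<lambda>i. Zs i \<omega>))
        \<le> (SUP \<phi>\<in>test_functions m.
              emp_process n (\<lambda>i. Zs i \<omega>) \<mu> \<phi> + lam n * eta m \<theta> (emp_mean n (\<lambda>i. Zs i \<omega>)) \<phi>)
           - lam n * T_stat m \<theta> (emp_mean n (\<lambda>i. Zs i \<omega>)))
     \<and>
     (filterlim lam at_top sequentially \<and> lam \<in> o(\<lambda>n. sqrt (real n)) \<longrightarrow>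
      (\<forall>\<theta>\<in>params m. latent_laws m \<theta> \<noteq> {} \<longrightarrow>
         contact_set m \<theta> \<mu> \<noteq> {} \<and>
         (\<forall>(N :: 'b measure) \<xi>.
            centered_gaussian N (space (z_space m)) \<xi> (multinomial_cov \<mu>) \<longrightarrow>
            converges_in_law M
              (\<lambda>n \<omega>. sqrt (real n) *
                 (T_stat m \<theta> (emp_mean n (\<lambda>i. Zs i \<omega>)) - T_stat m \<theta> (integral\<^sup>L \<mu>)))
              N (\<lambda>\<omega>'. SUP \<phi>\<in>contact_set m \<theta> \<mu>. gaussian_process (space (z_space m)) \<xi> \<phi> \<omega>') \<and>
            converges_in_cond_law M
              (\<lambda>n \<omega>. boot_law n (\<lambda>i. Zs i \<omega>) (\<lambda>zs.
                 (SUP \<phi>\<in>test_functions m.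
                    boot_process n (\<lambda>i. Zs i \<omega>) zs \<phi>
                    + lam n * eta m \<theta> (emp_mean n (\<lambda>i. Zs i \<omega>)) \<phi>)
                 - lam n * T_stat m \<theta> (emp_mean n (\<lambda>i. Zs i \<omega>))))
              N (\<lambda>\<omega>'. SUP \<phi>\<in>contact_set m \<theta> \<mu>. gaussian_process (space (z_space m)) \<xi> \<phi> \<omega>'))))"
proof (intro conjI allI impI ballI)
  have \<mu>: "\<mu> \<in> space (prob_algebra (z_space m))" using assms(4,5) by auto
  fix n :: nat and \<theta> \<omega> assume n: "n \<ge> 1" and \<theta>: "\<theta> \<in> identified_set m \<mu>" and \<omega>: "\<omega> \<in> space M"
  have cl: "\<mu> \<in> closed_laws m \<theta>" using \<theta> by (simp add: identified_set_def)
  \<comment> \<open>Here \<open>\<mu>\<close> itself witnesses that the closed set of laws is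
    nonempty.\<close>
  interpret finite_model m \<theta> \<mu>
    by unfold_locales (use assms(2,3) \<mu> cl in auto)
  show "sqrt (real n) * T_stat m \<theta> (emp_mean n (\<lambda>i. Zs i \<omega>))
        \<le> (SUP \<phi>\<in>test_functions m.
              emp_process n (\<lambda>i. Zs i \<omega>) \<mu> \<phi> + lam n * eta m \<theta> (emp_mean n (\<lambda>i. Zs i \<omega>)) \<phi>)
           - lam n * T_stat m \<theta> (emp_mean n (\<lambda>i. Zs i \<omega>))"
    using Zs_in_S[OF assms(6) \<omega>] assms(7) n cl by (intro conservative_bound) (auto intro: less_imp_le)
next
  have \<mu>: "\<mu> \<in> space (prob_algebra (z_space m))" using assms(4,5) by auto
  fix \<theta> assume lam: "filterlim lam at_top sequentially \<and> lam \<in> o(\<lambda>n. sqrt (real n))"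
    and \<theta>: "\<theta> \<in> params m" "latent_laws m \<theta> \<noteq> {}"
  interpret finite_model m \<theta> \<mu>
    by unfold_locales (use assms(2,3) \<mu> closed_laws_nonempty[OF assms(1) \<theta>] in auto)
  show "contact_set m \<theta> \<mu> \<noteq> {}" using K_nonempty by (simp add: contact_set_eq)
  fix N :: "'b measure" and \<xi> assume gauss: "centered_gaussian N S \<xi> (multinomial_cov \<mu>)"
  have sup: "(\<lambda>\<omega>'. SUP \<phi>\<in>contact_set m \<theta> \<mu>. gaussian_process S \<xi> \<phi> \<omega>') = (\<lambda>\<omega>'. contact_sup (\<lambda>z. \<xi> z \<omega>'))"
    by (simp add: contact_sup_def contact_set_eq gaussian_process_def lin_def)
  show "converges_in_law M
      (\<lambda>n \<omega>. sqrt (real n) * (T_stat m \<theta> (emp_mean n (\<lambda>i. Zs i \<omega>)) - T_stat m \<theta> (integral\<^sup>L \<mu>)))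
      N (\<lambda>\<omega>'. SUP \<phi>\<in>contact_set m \<theta> \<mu>. gaussian_process S \<xi> \<phi> \<omega>')"
    unfolding sup by (rule statistic_converges[OF assms(6) gauss])
  show "converges_in_cond_law M
      (\<lambda>n \<omega>. boot_law n (\<lambda>i. Zs i \<omega>) (\<lambda>zs.
         (SUP \<phi>\<in>test_functions m.
            boot_process n (\<lambda>i. Zs i \<omega>) zs \<phi> + lam n * eta m \<theta> (emp_mean n (\<lambda>i. Zs i \<omega>)) \<phi>)
         - lam n * T_stat m \<theta> (emp_mean n (\<lambda>i. Zs i \<omega>))))
      N (\<lambda>\<omega>'. SUP \<phi>\<in>contact_set m \<theta> \<mu>. gaussian_process S \<xi> \<phi> \<omega>')"
    unfolding sup using bootstrap_converges[OF assms(6) gauss assms(7)] lam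
    by (simp add: boot_stat_def[abs_def])
qed

end
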